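(* Let $d\ge2$, let $f$ be a monic centered polynomial of degree $d$ with distinct critical points $c_1,\dots,c_p$ of multiplicities $m_1,\dots,m_p$, and critical values $v_k=f(c_k)$; consider $f$ as a point of the space $\Pi_{d,\bar p}$ with local coordinates given by the critical values. (a) Let $c$ be a weakly expanding critical point of $f$ and $v=f(c)$. Then for every $k=1,\dots,p$ the limit $$L(c,v_k):=\lim_{m\to\infty}\frac{\frac{\partial (f^m(c))}{\partial v_k}}{(f^{m-1})'(v)}$$ exists. (b) Suppose that $c_1,\dots,c_r$ are pairwise different weakly expanding critical points of $f$ (some $r$ of the critical points, labelled first). Then the rank of the matrix $$\mathbf L=\big(L(c_j,v_k)\big)_{1\le j\le r,\ 1\le k\le p}$$ is equal to $r$, i.e. maximal.
   Context: A monic centered polynomial of degree $d$ is one of the form $z^d+a_1z^{d-2}+\dots+a_{d-1}$; the space $\Pi_d$ of these is identified with $\mathbf C^{d-1}$ by coefficients. Given such $f$ with distinct critical points $c_1,\dots,c_p$ and multiplicities $\bar p=\{m_1,\dots,m_p\}$ (so $f'(z)=d\prod_{i=1}^p(z-c_i)^{m_i}$), $\Pi_{d,\bar p}$ is the set of all $g\in\Pi_d$ in a small neighborhood of $f$ having the same number $p$ of distinct critical points $c_1(g),\dots,c_p(g)$, with $c_i(g)$ close to $c_i$ and of multiplicity $m_i$. Some critical values $v_i$ may coincide. It is known that $\Pi_{d,\bar p}$ is a $p$-dimensional complex manifold and that $V(g)=(v_1(g),\dots,v_p(g))$, $v_i(g)=g(c_i(g))$, is a local holomorphic coordinate on it;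 the $c_i(g)$ are holomorphic in $g$. For $c=c_j$, $\frac{\partial (f^m(c))}{\partial v_k}$ denotes the partial derivative of $g\mapsto g^m(c_j(g))$ with respect to the coordinate $v_k(g)$, evaluated at $g=f$; $f^m$ is the $m$-th iterate, and $'$ is the derivative in $z$. A critical point $c$ of $f$ is weakly expanding (summable) if, with $v=f(c)$, $\sum_{n=0}^\infty \frac{1+|f^n(v)|^2}{1+|v|^2}\frac{1}{|(f^n)'(v)|}<\infty$ (in particular $(f^n)'(v)\ne0$ for all $n$). *)

theory Defs
  imports "HOL-Analysis.Analysis" "HOL-Computational_Algebra.Polynomial"
begin

definition monic_centered :: "nat \<Rightarrow> complex poly set" where
  "monic_centered d = {g. degree g = d \<and> coeff g d = 1 \<and> coeff g (d - 1) = 0}"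

text \<open>The finite index type \<open>'p\<close> plays the role of \<open>{1, \<dots>, p}\<close>.\<close>

definition has_critical_points :: "complex poly \<Rightarrow> ('p::finite \<Rightarrow> complex) \<Rightarrow> ('p \<Rightarrow> nat) \<Rightarrow> bool" where
  "has_critical_points g c ms \<longleftrightarrow>
     inj c \<and> (\<forall>i. 1 \<le> ms i) \<and>
     pderiv g = smult (of_nat (degree g)) (\<Prod>i\<in>UNIV. [:- c i, 1:] ^ ms i)"

text \<open>
  The local stratum of \<open>f\<close>, where \<open>c\<close> lists the distinct critical points of \<open>f\<close> and \<open>ms\<close> their
  multiplicities. The radius \<open>\<epsilon>\<close> measures both the size of the neighbourhood of \<open>f\<close> in
  coefficient space and the closeness of the critical points; all notions depending
  on \<open>\<epsilon>\<close> are meant for sufficiently small \<open>\<epsilon> > 0\<close>.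
\<close>

definition stratum ::
    "real \<Rightarrow> complex poly \<Rightarrow> ('p::finite \<Rightarrow> complex) \<Rightarrow> ('p \<Rightarrow> nat) \<Rightarrow> complex poly set" where
  "stratum \<epsilon> f c ms =
     {g \<in> monic_centered (degree f).
        (\<forall>n. dist (coeff g n) (coeff f n) < \<epsilon>) \<and>
        (\<exists>c'. has_critical_points g c' ms \<and> (\<forall>i. dist (c' i) (c i) < \<epsilon>))}"

definition crit_pt :: "real \<Rightarrow> ('p::finite \<Rightarrow> complex) \<Rightarrow> 'p \<Rightarrow> complex poly \<Rightarrow> complex" where
  "crit_pt \<epsilon> c i g = (THE z. poly (pderiv g) z = 0 \<and> dist z (c i) < \<epsilon>)"

definition crit_vals :: "real \<Rightarrow> ('p::finite \<Rightarrow> complex) \<Rightarrow> complex poly \<Rightarrow> complex ^ 'p" where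
  "crit_vals \<epsilon> c g = (\<chi> i. poly g (crit_pt \<epsilon> c i g))"

text \<open>
  Partial derivative at \<open>x\<close> of a function \<open>F\<close> on \<open>S\<close> with respect to the \<open>k\<close>-th component
  of a local coordinate \<open>V\<close> on \<open>S\<close>.
\<close>

definition coord_deriv ::
    "'a set \<Rightarrow> ('a \<Rightarrow> complex ^ 'p::finite) \<Rightarrow> 'p \<Rightarrow> ('a \<Rightarrow> complex) \<Rightarrow> 'a \<Rightarrow> complex" where
  "coord_deriv S V k F x = deriv (\<lambda>t. F (inv_into S V (V x + axis k t))) 0"

definition weakly_expanding :: "complex poly \<Rightarrow> complex \<Rightarrow> bool" where
  "weakly_expanding f c \<longleftrightarrow>
     poly (pderiv f) c = 0 \<and>
     (let v = poly f c in
       (\<forall>n. deriv (poly f ^^ n) v \<noteq> 0) \<and>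
       summable (\<lambda>n. (1 + (cmod ((poly f ^^ n) v))\<^sup>2) / (1 + (cmod v)\<^sup>2)
                     * (1 / cmod (deriv (poly f ^^ n) v))))"

definition L_quot ::
    "real \<Rightarrow> complex poly \<Rightarrow> ('p::finite \<Rightarrow> complex) \<Rightarrow> ('p \<Rightarrow> nat) \<Rightarrow> 'p \<Rightarrow> 'p \<Rightarrow> nat \<Rightarrow> complex" where
  "L_quot \<epsilon> f c ms j k m =
     coord_deriv (stratum \<epsilon> f c ms) (crit_vals \<epsilon> c) k
       (\<lambda>g. (poly g ^^ m) (crit_pt \<epsilon> c j g)) f
     / deriv (poly f ^^ (m - 1)) (poly f (c j))"

definition L_lim ::
    "real \<Rightarrow> complex poly \<Rightarrow> ('p::finite \<Rightarrow> complex) \<Rightarrow> ('p \<Rightarrow> nat) \<Rightarrow> 'p \<Rightarrow> 'p \<Rightarrow> complex" where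
  "L_lim \<epsilon> f c ms j k = lim (L_quot \<epsilon> f c ms j k)"

end

theory Submission
  imports Defs "HOL-Complex_Analysis.Complex_Analysis" "HOL-Computational_Algebra.Fundamental_Theorem_Algebra"
begin

text \<open>
  Along the coordinate curve of \<open>v\<^sub>k\<close> the polynomial moves with velocity \<open>Q\<^sub>k\<close>, the polynomial of degree
  at most \<open>d - 2\<close> with \<open>Q\<^sub>k = \<delta>\<^sub>i\<^sub>k\<close> modulo \<open>(z - c\<^sub>i)\<close> to the power \<open>m\<^sub>i\<close>. Hence
  \<open>L(c\<^sub>j, v\<^sub>k) = \<delta>\<^sub>j\<^sub>k + \<Sum>\<^sub>n Q\<^sub>k(f\<^sup>n(v\<^sub>j)) / (f\<^bsup>n+1\<^esup>)'(v\<^sub>j)\<close>, which converges because weakly expanding orbits are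
  bounded.

  Suppose \<open>\<Sum>\<^sub>j b\<^sub>j L(c\<^sub>j, v\<^sub>k) = 0\<close> for all \<open>k\<close>, and let \<open>\<mu>\<close> be the atomic measure with mass
  \<open>b\<^sub>j / (f\<^sup>n)'(v\<^sub>j)\<close> at \<open>f\<^sup>n(v\<^sub>j)\<close>; its atoms lie on the boundary of the filled Julia set \<open>K\<close>. The
  relation says exactly that the Cauchy transform \<open>H\<close> of \<open>\<mu>\<close> is fixed by the transfer operator:
  \<open>H(y)\<close> is the sum of \<open>H(x) / f'(x)\<^sup>2\<close> over \<open>f(x) = y\<close>. By the area formula the integral of \<open>|H|\<close> over a
  large disc \<open>V\<close> is at most its integral over the preimage of \<open>V\<close>, which is a smaller set; hence \<open>H\<close>
  vanishes on the difference. Thus \<open>H\<close> has zeros near infinity and \<open>\<mu>\<close> annihilates all polynomials. Since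
  the complement of \<open>K\<close> has no bounded components, every boundary point of \<open>K\<close> is a peak point for
  polynomials, so all atoms of \<open>\<mu>\<close> vanish. Then \<open>b\<^sub>k = - \<integral> Q\<^sub>k / f' d\<mu> = 0\<close>.
\<close>

no_notation fps_nth (infixl "$" 75)

section \<open>Uniform approximation by polynomials\<close>

definition poly_approx :: "complex set \<Rightarrow> (complex \<Rightarrow> complex) \<Rightarrow> bool" where
  "poly_approx K g \<longleftrightarrow> (\<forall>e>0. \<exists>p. \<forall>w\<in>K. norm (g w - poly p w) < e)"

lemma poly_approx_poly: "poly_approx K (poly p)"
  unfolding poly_approx_def by (metis cancel_comm_monoid_add_class.diff_cancel norm_zero)

lemma poly_approx_cong:
  assumes "poly_approx K g" "\<And>w. w \<in> K \<Longrightarrow> g w = h w"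
  shows "poly_approx K h"
  using assms unfolding poly_approx_def by simp

lemma poly_approx_const: "poly_approx K (\<lambda>w. a)"
  by (rule poly_approx_cong[OF poly_approx_poly[of K "[:a:]"]]) simp

lemma poly_approx_linear: "poly_approx K (\<lambda>w. a * w - b)"
  by (rule poly_approx_cong[OF poly_approx_poly[of K "[:-b, a:]"]]) simp

lemma poly_approx_limit:
  assumes "\<And>e. e > 0 \<Longrightarrow> \<exists>h. poly_approx K h \<and> (\<forall>w\<in>K. norm (g w - h w) < e)"
  shows "poly_approx K g"
  unfolding poly_approx_def
proof (intro allI impI)
  fix e :: real assume "e > 0"
  then obtain h where h: "poly_approx K h" "\<forall>w\<in>K. norm (g w - h w) < e/2"
    using assms[of "e/2"] by auto
  then obtain p where p: "\<forall>w\<in>K. norm (h w - poly p w) < e/2"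
    using \<open>e > 0\<close> unfolding poly_approx_def by (meson half_gt_zero)
  have "norm (g w - poly p w) < e" if "w \<in> K" for w
    using norm_triangle_lt[of "g w - h w" "h w - poly p w" e] h(2) p that by force
  then show "\<exists>p. \<forall>w\<in>K. norm (g w - poly p w) < e" by blast
qed

lemma poly_approx_add:
  assumes "poly_approx K g" "poly_approx K h"
  shows "poly_approx K (\<lambda>w. g w + h w)"
  unfolding poly_approx_def
proof (intro allI impI)
  fix e :: real assume "e > 0"
  then obtain p q where pq: "\<forall>w\<in>K. norm (g w - poly p w) < e/2" "\<forall>w\<in>K. norm (h w - poly q w) < e/2"
    using assms unfolding poly_approx_def by (meson half_gt_zero)
  have "norm (g w + h w - poly (p + q) w) < e" if "w \<in> K" for w
    using norm_triangle_lt[of "g w - poly p w" "h w - poly q w" e] pq that by (force simp: algebra_simps)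
  then show "\<exists>p. \<forall>w\<in>K. norm (g w + h w - poly p w) < e" by blast
qed

lemma poly_bounded_on_compact:
  fixes p :: "'a::real_normed_field poly"
  assumes "compact K"
  obtains B where "B > 0" "\<And>w. w \<in> K \<Longrightarrow> norm (poly p w) \<le> B"
proof -
  have "compact (poly p ` K)"
    using assms by (intro compact_continuous_image continuous_intros)
  then show ?thesis
    using that compact_imp_bounded bounded_pos[of "poly p ` K"] by blast
qed

lemma poly_approx_bounded:
  assumes "poly_approx K g" "compact K"
  obtains B where "B > 0" "\<And>w. w \<in> K \<Longrightarrow> norm (g w) \<le> B"
proof -
  obtain p where p: "\<forall>w\<in>K. norm (g w - poly p w) < 1"
    using assms unfolding poly_approx_def by (meson zero_less_one)
  obtain B where B: "B > 0" "\<And>w. w \<in> K \<Longrightarrow> norm (poly p w) \<le> B"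
    using poly_bounded_on_compact[OF assms(2)] by blast
  have "norm (g w) \<le> B + 1" if "w \<in> K" for w
    using norm_triangle_ineq[of "g w - poly p w" "poly p w"] p B(2) that by force
  then show ?thesis using that[of "B + 1"] B(1) by simp
qed

lemma poly_approx_mult:
  assumes "poly_approx K g" "poly_approx K h" "compact K"
  shows "poly_approx K (\<lambda>w. g w * h w)"
  unfolding poly_approx_def
proof (intro allI impI)
  fix e :: real assume e: "e > 0"
  obtain B where B: "B > 0" "\<And>w. w \<in> K \<Longrightarrow> norm (g w) \<le> B"
    using poly_approx_bounded assms by blast
  obtain q where q: "\<forall>w\<in>K. norm (h w - poly q w) < e / (2*B)"
    using assms e B(1) unfolding poly_approx_def by (meson divide_pos_pos mult_pos_pos zero_less_numeral)
  obtain C where C: "C > 0" "\<And>w. w \<in> K \<Longrightarrow> norm (poly q w) \<le> C"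
    using poly_bounded_on_compact assms(3) by blast
  obtain p where p: "\<forall>w\<in>K. norm (g w - poly p w) < e / (2*C)"
    using assms e C(1) unfolding poly_approx_def by (meson divide_pos_pos mult_pos_pos zero_less_numeral)
  have "norm (g w * h w - poly (p * q) w) < e" if w: "w \<in> K" for w
  proof -
    have "g w * h w - poly (p * q) w = g w * (h w - poly q w) + (g w - poly p w) * poly q w"
      by (simp add: algebra_simps)
    also have "norm \<dots> \<le> norm (g w) * norm (h w - poly q w) + norm (g w - poly p w) * norm (poly q w)"
      by (metis norm_mult norm_triangle_ineq)
    also have "\<dots> \<le> B * norm (h w - poly q w) + norm (g w - poly p w) * C"
      using B C(2)[OF w] by (intro add_mono mult_mono B(2)[OF w]) auto
    also have "\<dots> < B * (e / (2*B)) + (e / (2*C)) * C"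
      using p q w B(1) C(1) by (intro add_strict_mono mult_strict_left_mono mult_strict_right_mono) auto
    also have "\<dots> = e" using B(1) C(1) by simp
    finally show ?thesis .
  qed
  then show "\<exists>p. \<forall>w\<in>K. norm (g w * h w - poly p w) < e" by blast
qed

lemma poly_approx_diff:
  assumes "poly_approx K g" "poly_approx K h" "compact K"
  shows "poly_approx K (\<lambda>w. g w - h w)"
  using poly_approx_add[OF assms(1) poly_approx_mult[OF poly_approx_const[of K "-1"] assms(2,3)]] by simp

lemma poly_approx_power:
  assumes "poly_approx K g" "compact K"
  shows "poly_approx K (\<lambda>w. g w ^ n)"
  by (induction n) (auto intro: poly_approx_const poly_approx_mult assms)

lemma poly_approx_sum:
  assumes "\<And>i. i \<in> I \<Longrightarrow> poly_approx K (g i)"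
  shows "poly_approx K (\<lambda>w. \<Sum>i\<in>I. g i w)"
  using assms
  by (induction I rule: infinite_finite_induct) (auto intro: poly_approx_const poly_approx_add)

lemma holomorphic_uniform_limit_Taylor:
  assumes F: "F holomorphic_on ball z r" and q: "q < r"
  shows "uniform_limit (cball z q) (\<lambda>n w. \<Sum>i<n. (deriv ^^ i) F z / fact i * (w - z) ^ i) F sequentially"
proof -
  define a where "a i = (deriv ^^ i) F z / fact i" for i
  have sums: "(\<lambda>i. a i * (w - z) ^ i) sums F w" if "w \<in> ball z r" for w
    using holomorphic_power_series[OF F that] by (simp add: a_def)
  show ?thesis
  proof (cases "q < 0")
    case True
    then show ?thesis by (auto intro!: uniform_limitI)
  next
    case False
    obtain q' where q': "q < q'" "q' < r" using q dense by blast
    have "summable (\<lambda>i. a i * of_real q' ^ i)"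
      using sums[of "z + of_real q'"] q' False by (auto simp: sums_iff dist_norm)
    then have "ereal q' \<le> conv_radius a"
      using conv_radius_geI[of a "of_real q'"] q' False by auto
    then have "ereal q < conv_radius a"
      using q'(1) by (meson less_ereal.simps(1) order_less_le_trans)
    then have "uniform_limit (cball z q) (\<lambda>n w. \<Sum>i<n. a i * (w - z) ^ i) (\<lambda>w. \<Sum>i. a i * (w - z) ^ i) sequentially"
      by (rule powser_uniform_limit)
    moreover have "(\<Sum>i. a i * (w - z) ^ i) = F w" if "w \<in> cball z q" for w
      using sums[of w] that q by (simp add: sums_iff)
    ultimately show ?thesis
      unfolding a_def by (subst (asm) uniform_limit_cong'[OF refl, of _ _ F]) auto
  qed
qed

lemma poly_approx_holomorphic:
  assumes F: "F holomorphic_on ball 0 1" and t: "poly_approx K t" "compact K"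
    and q: "q < 1" "\<And>w. w \<in> K \<Longrightarrow> norm (t w) \<le> q"
  shows "poly_approx K (\<lambda>w. F (t w))"
proof (rule poly_approx_limit)
  fix e :: real assume e: "e > 0"
  let ?T = "\<lambda>n z. \<Sum>i<n. (deriv ^^ i) F 0 / fact i * (z - 0) ^ i"
  have "\<forall>\<^sub>F n in sequentially. \<forall>z\<in>cball 0 q. dist (?T n z) (F z) < e"
    using holomorphic_uniform_limit_Taylor[OF F q(1)] e by (rule uniform_limitD)
  then obtain n where n: "\<And>z. z \<in> cball 0 q \<Longrightarrow> dist (?T n z) (F z) < e"
    using eventually_happens'[OF sequentially_bot] by blast
  show "\<exists>h. poly_approx K h \<and> (\<forall>w\<in>K. norm (F (t w) - h w) < e)"
  proof (intro exI conjI ballI)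
    show "poly_approx K (\<lambda>w. ?T n (t w))"
      by (intro poly_approx_sum poly_approx_mult poly_approx_const poly_approx_power poly_approx_diff t)
    show "norm (F (t w) - ?T n (t w)) < e" if "w \<in> K" for w
      using n[of "t w"] q(2)[OF that] by (simp add: dist_norm norm_minus_commute)
  qed
qed

lemma poly_approx_inverse_step:
  assumes "poly_approx K (\<lambda>w. 1 / u w)" "poly_approx K u'" "compact K"
    and nonzero: "\<And>w. w \<in> K \<Longrightarrow> u w \<noteq> 0"
    and close: "q < 1" "\<And>w. w \<in> K \<Longrightarrow> norm (u' w / u w - 1) \<le> q"
  shows "poly_approx K (\<lambda>w. 1 / u' w)"
proof -
  have t: "poly_approx K (\<lambda>w. u' w * (1 / u w) - 1)"
    by (intro poly_approx_diff poly_approx_mult poly_approx_const assms)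
  have F: "(\<lambda>z. 1 / (1 + z)) holomorphic_on ball 0 1"
  proof (intro holomorphic_intros)
    fix z :: complex assume "z \<in> ball 0 1"
    then have "norm z < norm (- 1 :: complex)" by simp
    then show "1 + z \<noteq> 0" by (metis add_eq_0_iff less_irrefl)
  qed
  have "poly_approx K (\<lambda>w. 1 / (1 + (u' w * (1 / u w) - 1)))"
    by (rule poly_approx_holomorphic[OF F t assms(3) close(1)]) (use close in auto)
  from poly_approx_mult[OF assms(1) this assms(3)]
  show ?thesis by (rule poly_approx_cong) (use nonzero in auto)
qed

lemma poly_approx_sqrt_step:
  assumes "poly_approx K (\<lambda>w. (r w)\<^sup>2)" "compact K"
    and close: "\<And>w. w \<in> K \<Longrightarrow> norm (r w - 1) \<le> 1/4"
  shows "poly_approx K r"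
proof -
  have t: "poly_approx K (\<lambda>w. (r w)\<^sup>2 - 1)"
    by (intro poly_approx_diff poly_approx_const assms)
  have F: "(\<lambda>z. csqrt (1 + z)) holomorphic_on ball 0 1"
  proof (intro holomorphic_intros)
    fix z :: complex assume "z \<in> ball 0 1"
    then have "\<bar>Re z\<bar> < 1" using abs_Re_le_cmod[of z] by (simp del: abs_Re_le_cmod)
    then show "1 + z \<notin> \<real>\<^sub>\<le>\<^sub>0" by (auto simp: complex_nonpos_Reals_iff)
  qed
  have square_bound: "norm ((r w)\<^sup>2 - 1) \<le> 9/16" if w: "w \<in> K" for w
  proof -
    have "(r w)\<^sup>2 - 1 = (r w - 1) * ((r w - 1) + 2)" by (simp add: power2_eq_square algebra_simps)
    moreover have "norm ((r w - 1) + 2) \<le> 1/4 + 2"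
      using norm_triangle_ineq[of "r w - 1" 2] close[OF w] by simp
    ultimately show ?thesis
      using mult_mono[OF close[OF w], of "norm ((r w - 1) + 2)" "9/4"] by (simp add: norm_mult)
  qed
  have "poly_approx K (\<lambda>w. csqrt (1 + ((r w)\<^sup>2 - 1)))"
    by (rule poly_approx_holomorphic[OF F t assms(2), of "9/16"]) (use square_bound in auto)
  then show ?thesis
  proof (rule poly_approx_cong)
    fix w assume w: "w \<in> K"
    have "\<bar>Re (r w - 1)\<bar> \<le> 1/4" using abs_Re_le_cmod[of "r w - 1"] close[OF w] by linarith
    then have "0 < Re (r w)" by (simp add: abs_if split: if_splits)
    then have "csqrt ((r w)\<^sup>2) = r w" by (rule csqrt_square[OF disjI1])
    then show "csqrt (1 + ((r w)\<^sup>2 - 1)) = r w" by simp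
  qed
qed

lemma homotopy_ratio_near_1:
  fixes h :: "real \<times> 'a::metric_space \<Rightarrow> 'b::{real_normed_field, heine_borel}"
  assumes "compact K" and cont: "continuous_on ({0..1} \<times> K) h"
    and nonzero: "\<And>s w. s \<in> {0..1} \<Longrightarrow> w \<in> K \<Longrightarrow> h (s, w) \<noteq> 0" and "q > 0"
  obtains \<delta> where "\<delta> > 0"
    "\<And>s t w. s \<in> {0..1} \<Longrightarrow> t \<in> {0..1} \<Longrightarrow> \<bar>t - s\<bar> < \<delta> \<Longrightarrow> w \<in> K \<Longrightarrow> norm (h (t, w) / h (s, w) - 1) \<le> q"
proof -
  have comp: "compact ({0..1::real} \<times> K)" using assms by (intro compact_Times) auto
  have "closed (h ` ({0..1} \<times> K))"
    using compact_continuous_image[OF cont comp] by (rule compact_imp_closed)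
  moreover have "0 \<notin> h ` ({0..1} \<times> K)" using nonzero by force
  ultimately obtain m where m: "m > 0" "\<And>z. z \<in> {0..1} \<times> K \<Longrightarrow> m \<le> norm (h z)"
    using separate_point_closed[of "h ` ({0..1} \<times> K)" 0] by auto
  have "uniformly_continuous_on ({0..1} \<times> K) h"
    using cont comp by (rule compact_uniformly_continuous)
  then obtain \<delta> where \<delta>: "\<delta> > 0"
    "\<And>x y. x \<in> {0..1} \<times> K \<Longrightarrow> y \<in> {0..1} \<times> K \<Longrightarrow> dist y x < \<delta> \<Longrightarrow> dist (h y) (h x) < q * m"
    using m(1) \<open>q > 0\<close> unfolding uniformly_continuous_on_def by (metis mult_pos_pos)
  show ?thesis
  proof (rule that[OF \<delta>(1)])
    fix s t w assume st: "s \<in> {0..1}" "t \<in> {0..1}" "\<bar>t - s\<bar> < \<delta>" and w: "w \<in> K"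
    then have "norm (h (t, w) - h (s, w)) \<le> q * m"
      using \<delta>(2)[of "(s, w)" "(t, w)"] by (simp add: dist_Pair_Pair dist_real_def dist_norm)
    also have "\<dots> \<le> q * norm (h (s, w))"
      using m(2)[of "(s, w)"] st(1) w \<open>q > 0\<close> by (intro mult_left_mono) auto
    finally have "norm ((h (t, w) - h (s, w)) / h (s, w)) \<le> q"
      using nonzero[OF st(1) w] by (simp add: norm_divide divide_le_eq)
    then show "norm (h (t, w) / h (s, w) - 1) \<le> q"
      using nonzero[OF st(1) w] by (simp add: diff_divide_distrib)
  qed
qed

lemma unit_interval_small_step_induct:
  fixes \<delta> t :: real
  assumes "\<delta> > 0" "t \<in> {0..1}" "P 0"
    and step: "\<And>s s'. s \<in> {0..1} \<Longrightarrow> s' \<in> {0..1} \<Longrightarrow> \<bar>s' - s\<bar> < \<delta> \<Longrightarrow> P s \<Longrightarrow> P s'"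
  shows "P t"
proof -
  obtain N where N: "N > 0" "inverse (real N) < \<delta>"
    using \<open>\<delta> > 0\<close> reals_Archimedean by (metis neq0_conv of_nat_0 of_nat_Suc zero_less_Suc)
  define d where "d = t / real N"
  have "d \<le> inverse (real N)"
    using assms(2) N(1) unfolding d_def inverse_eq_divide by (intro divide_right_mono) auto
  then have d: "0 \<le> d" "d < \<delta>" "real N * d = t" using assms(2) N by (auto simp: d_def)
  have unit: "real i * d \<in> {0..1}" if "i \<le> N" for i
  proof -
    have "real i * d \<le> real N * d" using that d(1) by (intro mult_right_mono) auto
    then show ?thesis using assms(2) d by simp
  qed
  have "P (real i * d)" if "i \<le> N" for i
    using that
  proof (induction i)
    case 0 then show ?case using \<open>P 0\<close> by simp
  next
    case (Suc i)
    have "real (Suc i) * d - real i * d = d" by (simp add: distrib_right)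
    then show ?case
      using step[of "real i * d" "real (Suc i) * d"] unit[of i] unit[of "Suc i"] Suc d by simp
  qed
  from this[of N] show ?thesis using d(3) by simp
qed

lemma poly_approx_inverse_homotopy:
  fixes h :: "real \<times> complex \<Rightarrow> complex"
  assumes K: "compact K" and cont: "continuous_on ({0..1} \<times> K) h"
    and nonzero: "\<And>s w. s \<in> {0..1} \<Longrightarrow> w \<in> K \<Longrightarrow> h (s, w) \<noteq> 0"
    and appr: "\<And>s. s \<in> {0..1} \<Longrightarrow> poly_approx K (\<lambda>w. h (s, w))"
    and start: "poly_approx K (\<lambda>w. 1 / h (0, w))" and t: "t \<in> {0..1}"
  shows "poly_approx K (\<lambda>w. 1 / h (t, w))"
proof -
  obtain \<delta> where \<delta>: "\<delta> > 0" "\<And>s t w. s \<in> {0..1} \<Longrightarrow> t \<in> {0..1} \<Longrightarrow> \<bar>t - s\<bar> < \<delta> \<Longrightarrow> w \<in> K \<Longrightarrow>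
      norm (h (t, w) / h (s, w) - 1) \<le> 1/2"
    using homotopy_ratio_near_1[OF K cont nonzero, of "1/2"] by auto
  show ?thesis
  proof (rule unit_interval_small_step_induct[where P = "\<lambda>s. poly_approx K (\<lambda>w. 1 / h (s, w))", OF \<delta>(1) t start])
    fix s s' assume s: "s \<in> {0..1}" "s' \<in> {0..1}" "\<bar>s' - s\<bar> < \<delta>" and IH: "poly_approx K (\<lambda>w. 1 / h (s, w))"
    show "poly_approx K (\<lambda>w. 1 / h (s', w))"
      by (rule poly_approx_inverse_step[OF IH appr[OF s(2)] K nonzero[OF s(1)] _ \<delta>(2)[OF s]]) simp_all
  qed
qed

lemma poly_approx_sqrt_homotopy:
  fixes k :: "real \<times> complex \<Rightarrow> complex"
  assumes K: "compact K" and cont: "continuous_on ({0..1} \<times> K) k"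
    and nonzero: "\<And>s w. s \<in> {0..1} \<Longrightarrow> w \<in> K \<Longrightarrow> k (s, w) \<noteq> 0"
    and square: "\<And>s. s \<in> {0..1} \<Longrightarrow> poly_approx K (\<lambda>w. (k (s, w))\<^sup>2)"
    and inverse_square: "\<And>s. s \<in> {0..1} \<Longrightarrow> poly_approx K (\<lambda>w. 1 / (k (s, w))\<^sup>2)"
    and start: "poly_approx K (\<lambda>w. k (0, w))" and t: "t \<in> {0..1}"
  shows "poly_approx K (\<lambda>w. k (t, w))"
proof -
  obtain \<delta> where \<delta>: "\<delta> > 0" "\<And>s t w. s \<in> {0..1} \<Longrightarrow> t \<in> {0..1} \<Longrightarrow> \<bar>t - s\<bar> < \<delta> \<Longrightarrow> w \<in> K \<Longrightarrow>
      norm (k (t, w) / k (s, w) - 1) \<le> 1/4"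
    using homotopy_ratio_near_1[OF K cont nonzero, of "1/4"] by auto
  show ?thesis
  proof (rule unit_interval_small_step_induct[where P = "\<lambda>s. poly_approx K (\<lambda>w. k (s, w))", OF \<delta>(1) t start])
    fix s s' assume s: "s \<in> {0..1}" "s' \<in> {0..1}" "\<bar>s' - s\<bar> < \<delta>" and IH: "poly_approx K (\<lambda>w. k (s, w))"
    let ?r = "\<lambda>w. k (s', w) / k (s, w)"
    have "poly_approx K (\<lambda>w. (?r w)\<^sup>2)"
      by (rule poly_approx_cong[OF poly_approx_mult[OF square[OF s(2)] inverse_square[OF s(1)] K]])
         (simp add: power_divide)
    then have "poly_approx K ?r"
      by (rule poly_approx_sqrt_step[OF _ K]) (rule \<delta>(2)[OF s])
    from poly_approx_mult[OF IH this K]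
    show "poly_approx K (\<lambda>w. k (s', w))" by (rule poly_approx_cong) (use nonzero[OF s(1)] in auto)
  qed
qed

lemma complement_escape_path:
  fixes K :: "'a::euclidean_space set"
  assumes K: "compact K" "connected (- K)" and \<zeta>: "\<zeta> \<notin> K"
  obtains g where "path g" "path_image g \<subseteq> - K" "pathstart g = \<zeta>" "norm (pathfinish g) > B"
proof -
  have "path_connected (- K)"
    using K by (intro connected_open_path_connected) (auto simp: compact_imp_closed)
  moreover obtain y where y: "y \<in> - K" "norm y > B"
  proof -
    obtain C where C: "\<And>z. z \<in> K \<Longrightarrow> norm z \<le> C" using K(1) compact_imp_bounded bounded_iff by metis
    obtain y :: 'a where "norm y = \<bar>B\<bar> + \<bar>C\<bar> + 1" using vector_choose_size[of "\<bar>B\<bar> + \<bar>C\<bar> + 1"] by auto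
    then have "y \<notin> K" "norm y > B" using C[of y] by auto
    then show ?thesis using that by blast
  qed
  ultimately obtain g where "path g" "path_image g \<subseteq> - K" "pathstart g = \<zeta>" "pathfinish g = y"
    using \<zeta> unfolding path_connected_def by (metis ComplI)
  then show ?thesis using that y(2) by blast
qed

lemma poly_approx_inverse_linear_far:
  assumes K: "compact K" and y: "\<And>w. w \<in> K \<Longrightarrow> norm w < norm y"
  shows "poly_approx K (\<lambda>w. 1 / (w - y))"
proof -
  have "poly_approx K (\<lambda>w. 1 / (of_real (fst (1::real, w)) * snd (1::real, w) - y))"
  proof (rule poly_approx_inverse_homotopy[OF K, where h = "\<lambda>z. of_real (fst z) * snd z - y"])
    show "continuous_on ({0..1} \<times> K) (\<lambda>z. complex_of_real (fst z) * snd z - y)"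
      by (intro continuous_intros)
    show "complex_of_real (fst (s, w)) * snd (s, w) - y \<noteq> 0" if "s \<in> {0..1}" "w \<in> K" for s w
    proof -
      have "norm (complex_of_real s * w) \<le> 1 * norm w"
        using that unfolding norm_mult by (intro mult_right_mono) auto
      then show ?thesis using y[OF that(2)] by auto
    qed
  qed (auto intro: poly_approx_linear poly_approx_const)
  then show ?thesis by simp
qed

lemma poly_approx_inverse_linear:
  assumes K: "compact K" "connected (- K)" and \<zeta>: "\<zeta> \<notin> K"
  shows "poly_approx K (\<lambda>w. 1 / (w - \<zeta>))"
proof -
  obtain B where B: "\<And>w. w \<in> K \<Longrightarrow> norm w \<le> B"
    using K compact_imp_bounded bounded_iff by metis
  obtain g where g: "path g" "path_image g \<subseteq> - K" "pathstart g = \<zeta>" "norm (pathfinish g) > B"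
    using complement_escape_path[OF K \<zeta>] by blast
  have g': "path (reversepath g)" "path_image (reversepath g) \<subseteq> - K" using g by auto
  let ?h = "\<lambda>z. snd z - reversepath g (fst z) :: complex"
  have "poly_approx K (\<lambda>w. 1 / ?h (1, w))"
  proof (rule poly_approx_inverse_homotopy[OF K(1)])
    show "continuous_on ({0..1} \<times> K) ?h"
      by (intro continuous_intros continuous_on_compose2[OF g'(1)[unfolded path_def]]) auto
    show "?h (s, w) \<noteq> 0" if "s \<in> {0..1}" "w \<in> K" for s w
      using subsetD[OF g'(2), of "reversepath g s"] that by (auto simp: path_image_def)
    show "poly_approx K (\<lambda>w. ?h (s, w))" for s using poly_approx_linear[of K 1 "reversepath g s"] by simp
    have "poly_approx K (\<lambda>w. 1 / (w - pathfinish g))"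
      using B g(4) by (intro poly_approx_inverse_linear_far K) fastforce
    then show "poly_approx K (\<lambda>w. 1 / ?h (0, w))" by (simp add: reversepath_def pathfinish_def)
  qed simp
  then show ?thesis using g(3) by (simp add: reversepath_def pathstart_def)
qed

section \<open>Peak points for polynomials\<close>

definition poly_peak_point :: "complex set \<Rightarrow> complex \<Rightarrow> bool" where
  "poly_peak_point K v \<longleftrightarrow> (\<exists>C. \<forall>r>0. \<exists>p. (\<forall>w\<in>K. norm (poly p w) \<le> C) \<and> norm (poly p v - 1) \<le> r
     \<and> (\<forall>w\<in>K. r \<le> dist w v \<longrightarrow> norm (poly p w) \<le> r))"

lemma Re_pos_if_square_near_1:
  fixes \<phi> :: "real \<Rightarrow> complex"
  assumes cont: "continuous_on {0..1} \<phi>" and start: "\<phi> 0 = 1"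
    and near: "\<And>s. s \<in> {0..1} \<Longrightarrow> norm ((\<phi> s)\<^sup>2 - 1) < 1"
  shows "Re (\<phi> 1) > 0"
proof (rule ccontr)
  assume "\<not> Re (\<phi> 1) > 0"
  moreover have "continuous_on {0..1} (\<lambda>s. Re (\<phi> s))" by (intro continuous_intros cont)
  ultimately obtain s where s: "s \<in> {0..1}" "Re (\<phi> s) = 0"
    using IVT2'[of "\<lambda>s. Re (\<phi> s)" 1 0 0] start by auto
  then have "Re ((\<phi> s)\<^sup>2) \<le> 0" by (simp add: power2_eq_square)
  moreover have "\<bar>Re ((\<phi> s)\<^sup>2 - 1)\<bar> < 1"
    using abs_Re_le_cmod[of "(\<phi> s)\<^sup>2 - 1"] near[OF s(1)] by linarith
  ultimately show False by simp
qed

text \<open>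
  The function \<open>(k - 1) / (k + 1)\<close> with \<open>k\<^sup>2 = (w - \<gamma> 0) / (w - \<gamma> 1)\<close> is the Koebe-type map of the
  complement of an arc from \<open>\<gamma> 0\<close> to \<open>\<gamma> 1\<close>; it is bounded by an absolute constant, is small far from
  the arc, and is near 1 at points much closer to \<open>\<gamma> 1\<close> than to \<open>\<gamma> 0\<close>. Moving the second branch point
  along the arc keeps both \<open>k\<close> and \<open>1 / (k + 1)\<close> approximable by polynomials.
\<close>

locale slit_sqrt =
  fixes K :: "complex set" and \<gamma> :: "real \<Rightarrow> complex" and k :: "real \<times> complex \<Rightarrow> complex"
  assumes compact_K: "compact K" and connected_compl: "connected (- K)"
    and avoids_K: "\<And>s. s \<in> {0..1} \<Longrightarrow> \<gamma> s \<notin> K"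
    and start_once: "\<And>s. s \<in> {0..1} \<Longrightarrow> \<gamma> s = \<gamma> 0 \<Longrightarrow> s = 0"
    and cont_k: "continuous_on ({0..1} \<times> K) k"
    and k_start: "\<And>w. w \<in> K \<Longrightarrow> k (0, w) = 1"
    and k_square: "\<And>s w. s \<in> {0..1} \<Longrightarrow> w \<in> K \<Longrightarrow> (k (s, w))\<^sup>2 = (w - \<gamma> 0) / (w - \<gamma> s)"

lemma slit_sqrt_exists:
  assumes K: "compact K" "connected (- K)" and path: "path \<gamma>" and avoids: "path_image \<gamma> \<subseteq> - K"
    and start_once: "\<And>s. s \<in> {0..1} \<Longrightarrow> \<gamma> s = \<gamma> 0 \<Longrightarrow> s = 0"
  obtains k where "slit_sqrt K \<gamma> k"
proof -
  have \<gamma>: "\<gamma> s \<notin> K" if "s \<in> {0..1}" for s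
    using avoids that by (metis ComplD imageI path_image_def subsetD)
  define u where "u z = (snd z - \<gamma> 0) / (snd z - \<gamma> (fst z))" for z :: "real \<times> complex"
  have contu: "continuous_on ({0..1} \<times> K) u"
    unfolding u_def
    by (intro continuous_intros continuous_on_compose2[OF path[unfolded path_def]]) (use \<gamma> in auto)
  obtain k where k: "continuous_on ({0..1} \<times> K) k" "k \<in> ({0..1} \<times> K) \<rightarrow> - {0}"
      "\<And>w. w \<in> K \<Longrightarrow> k (0, w) = 1" "\<And>z. z \<in> {0..1} \<times> K \<Longrightarrow> u z = (k z)\<^sup>2"
  proof (rule covering_space_lift_homotopy[OF covering_space_square_punctured_plane contu, of "\<lambda>w. 1"])
    show "u \<in> {0..1} \<times> K \<rightarrow> - {0}" using \<gamma> \<gamma>[of 0] by (auto simp: u_def)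
    show "u (0, y) = 1\<^sup>2" if "y \<in> K" for y using that \<gamma>[of 0] by (auto simp: u_def)
  qed auto
  then have "slit_sqrt K \<gamma> k"
    by unfold_locales (use K \<gamma> start_once k(4) in \<open>auto simp: u_def\<close>)
  then show ?thesis by (rule that)
qed

context slit_sqrt
begin

lemma k_nonzero: "s \<in> {0..1} \<Longrightarrow> w \<in> K \<Longrightarrow> k (s, w) \<noteq> 0"
  using k_square[of s w] avoids_K[of 0] avoids_K[of s] by auto

lemma k_plus_1_nonzero:
  assumes s: "s \<in> {0..1}" and w: "w \<in> K"
  shows "k (s, w) + 1 \<noteq> 0"
proof
  assume "k (s, w) + 1 = 0"
  then have k: "k (s, w) = -1" by (simp add: add_eq_0_iff2)
  then have "(w - \<gamma> 0) / (w - \<gamma> s) = 1" using k_square[OF s w] by simp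
  then have "\<gamma> s = \<gamma> 0" using avoids_K[OF s] w by (auto simp: field_simps)
  then have "s = 0" using start_once s by simp
  then show False using k_start[OF w] k by simp
qed

lemma poly_approx_ratio: "a \<notin> K \<Longrightarrow> poly_approx K (\<lambda>w. (w - b) / (w - a))"
  using poly_approx_mult[OF poly_approx_linear[of K 1 b]
      poly_approx_inverse_linear[OF compact_K connected_compl] compact_K, of a]
  by simp

lemma poly_approx_k: "s \<in> {0..1} \<Longrightarrow> poly_approx K (\<lambda>w. k (s, w))"
proof (rule poly_approx_sqrt_homotopy[OF compact_K cont_k k_nonzero])
  fix t :: real assume t: "t \<in> {0..1}"
  show "poly_approx K (\<lambda>w. (k (t, w))\<^sup>2)"
    by (rule poly_approx_cong[OF poly_approx_ratio[OF avoids_K[OF t], of "\<gamma> 0"]]) (simp add: k_square[OF t])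
  have "\<gamma> 0 \<notin> K" using avoids_K[of 0] by simp
  then show "poly_approx K (\<lambda>w. 1 / (k (t, w))\<^sup>2)"
    by (rule poly_approx_cong[OF poly_approx_ratio[of _ "\<gamma> t"]]) (simp add: k_square[OF t])
next
  show "poly_approx K (\<lambda>w. k (0, w))"
    by (rule poly_approx_cong[OF poly_approx_const[of K 1]]) (simp add: k_start)
qed

definition koebe :: "complex \<Rightarrow> complex" where
  "koebe w = (k (1, w) - 1) / (k (1, w) + 1)"

lemma koebe_eq: "w \<in> K \<Longrightarrow> koebe w = 1 - 2 * (1 / (k (1, w) + 1))"
  using k_plus_1_nonzero[of 1 w] by (simp add: koebe_def field_simps)

lemma poly_approx_koebe: "poly_approx K koebe"
proof -
  have "poly_approx K (\<lambda>w. 1 / (k (1, w) + 1))"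
  proof (rule poly_approx_inverse_homotopy[OF compact_K, where h = "\<lambda>z. k z + 1"])
    show "poly_approx K (\<lambda>w. 1 / (k (0, w) + 1))"
      by (rule poly_approx_cong[OF poly_approx_const[of K "1/2"]]) (simp add: k_start)
    show "k (s, w) + 1 \<noteq> 0" if "s \<in> {0..1}" "w \<in> K" for s w by (rule k_plus_1_nonzero[OF that])
  qed (auto intro!: continuous_intros cont_k poly_approx_add poly_approx_const poly_approx_k)
  then have "poly_approx K (\<lambda>w. 1 - 2 * (1 / (k (1, w) + 1)))"
    by (intro poly_approx_diff poly_approx_mult poly_approx_const compact_K)
  then show ?thesis by (rule poly_approx_cong) (simp add: koebe_eq)
qed

lemma k_square_minus_1:
  assumes "s \<in> {0..1}" "w \<in> K"
  shows "(k (s, w))\<^sup>2 - 1 = (\<gamma> s - \<gamma> 0) / (w - \<gamma> s)"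
proof -
  have "w - \<gamma> s \<noteq> 0" using avoids_K[OF assms(1)] assms(2) by auto
  then show ?thesis unfolding k_square[OF assms] by (simp add: field_simps)
qed

lemma norm_k_square_minus_1: "norm ((k z)\<^sup>2 - 1) = norm (k z - 1) * norm (k z + 1)"
  by (simp add: norm_mult[symmetric] power2_eq_square algebra_simps)

end

locale slit_sqrt_near = slit_sqrt +
  fixes v :: complex and \<delta> :: real
  assumes \<delta>_pos: "\<delta> > 0" and path_near: "\<And>s. s \<in> {0..1} \<Longrightarrow> dist v (\<gamma> s) \<le> \<delta>"
    and start_dist: "dist v (\<gamma> 0) = \<delta>" and end_dist: "dist v (\<gamma> 1) \<le> \<delta> / 2"
begin

lemma Re_k_pos_far:
  assumes w: "w \<in> K" "dist w v \<ge> 8 * \<delta>"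
  shows "Re (k (1, w)) > 0" "norm (k (1, w) - 1) \<le> 2 * \<delta> / (dist w v - \<delta>)"
proof -
  have small: "norm ((k (s, w))\<^sup>2 - 1) \<le> 2 * \<delta> / (dist w v - \<delta>)" if s: "s \<in> {0..1}" for s
  proof -
    have "norm (\<gamma> s - \<gamma> 0) \<le> 2 * \<delta>"
      using dist_triangle3[of "\<gamma> s" "\<gamma> 0" v] path_near[OF s] start_dist by (simp add: dist_norm)
    moreover have "norm (w - \<gamma> s) \<ge> dist w v - \<delta>"
      using dist_triangle[of w v "\<gamma> s"] path_near[OF s] by (simp add: dist_norm norm_minus_commute)
    ultimately show ?thesis
      unfolding k_square_minus_1[OF s w(1)] norm_divide using w(2) \<delta>_pos by (intro frac_le) auto
  qed
  have "2 * \<delta> / (dist w v - \<delta>) < 1" using w(2) \<delta>_pos by (simp add: divide_less_eq)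
  then show Re: "Re (k (1, w)) > 0"
    by (intro Re_pos_if_square_near_1[where \<phi> = "\<lambda>s. k (s, w)"] continuous_on_compose2[OF cont_k] continuous_intros)
       (use w k_start small in force)+
  then have "norm (k (1, w) + 1) \<ge> 1"
    using complex_Re_le_cmod[of "k (1, w) + 1"] by simp
  then have "norm (k (1, w) - 1) \<le> norm ((k (1, w))\<^sup>2 - 1)"
    unfolding norm_k_square_minus_1 by (simp add: mult_le_cancel_left1)
  then show "norm (k (1, w) - 1) \<le> 2 * \<delta> / (dist w v - \<delta>)" using small[of 1] by simp
qed

lemma norm_k_plus_1_ge:
  assumes w: "w \<in> K"
  shows "norm (k (1, w) + 1) \<ge> 1/54"
proof (cases "dist w v \<ge> 8 * \<delta> \<or> norm (k (1, w)) > 2")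
  case True
  then show ?thesis
    using Re_k_pos_far(1)[OF w] complex_Re_le_cmod[of "k (1, w) + 1"] norm_triangle_ineq2[of "k (1, w)" "-1"]
    by auto
next
  case False
  have "dist (\<gamma> 1) (\<gamma> 0) \<ge> \<delta> / 2"
    using start_dist end_dist dist_triangle[of v "\<gamma> 0" "\<gamma> 1"] by simp
  moreover have "norm (w - \<gamma> 1) \<le> 9 * \<delta>"
    using dist_triangle[of w "\<gamma> 1" v] False end_dist \<delta>_pos by (simp add: dist_norm)
  moreover have "w \<noteq> \<gamma> 1" using w avoids_K[of 1] by auto
  ultimately have "1/18 \<le> norm ((\<gamma> 1 - \<gamma> 0) / (w - \<gamma> 1))"
    by (simp add: norm_divide dist_norm le_divide_eq)
  also have "\<dots> = norm (k (1, w) - 1) * norm (k (1, w) + 1)"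
    using k_square_minus_1[of 1 w] w norm_k_square_minus_1[of "(1, w)"] by simp
  also have "norm (k (1, w) - 1) * norm (k (1, w) + 1) \<le> 3 * norm (k (1, w) + 1)"
    using False norm_triangle_ineq4[of "k (1, w)" 1] by (intro mult_right_mono) auto
  finally show ?thesis by simp
qed

lemma norm_koebe_le: "w \<in> K \<Longrightarrow> norm (koebe w) \<le> 109"
proof -
  assume w: "w \<in> K"
  then have "norm (2 * (1 / (k (1, w) + 1))) \<le> 108"
    using norm_k_plus_1_ge[OF w] by (simp add: norm_mult norm_divide divide_le_eq)
  then show ?thesis
    using norm_triangle_ineq4[of 1 "2 * (1 / (k (1, w) + 1))"] by (simp add: koebe_eq[OF w])
qed

lemma norm_koebe_far:
  assumes w: "w \<in> K" "dist w v \<ge> 8 * \<delta>"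
  shows "norm (koebe w) \<le> 4 * \<delta> / dist w v"
proof -
  have ge1: "norm (k (1, w) + 1) \<ge> 1"
    using Re_k_pos_far(1)[OF w] complex_Re_le_cmod[of "k (1, w) + 1"] by simp
  have "norm (koebe w) = norm (k (1, w) - 1) / norm (k (1, w) + 1)"
    by (simp add: koebe_def norm_divide)
  also have "\<dots> \<le> norm (k (1, w) - 1) / 1" using ge1 by (intro divide_left_mono) auto
  also have "\<dots> \<le> 2 * \<delta> / (dist w v - \<delta>)" using Re_k_pos_far(2)[OF w] by simp
  also have "\<dots> \<le> 2 * \<delta> / (dist w v / 2)"
    using w(2) \<delta>_pos by (intro divide_left_mono mult_pos_pos) auto
  finally show ?thesis by simp
qed

lemma koebe_near_1:
  assumes v: "v \<in> K" and N: "N > 1" "N\<^sup>2 * dist v (\<gamma> 1) \<le> \<delta>"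
  shows "norm (koebe v - 1) \<le> 2 / (N - 1)"
proof -
  have "v \<noteq> \<gamma> 1" using v avoids_K[of 1] by auto
  then have "N\<^sup>2 \<le> dist v (\<gamma> 0) / dist v (\<gamma> 1)" using N(2) by (simp add: start_dist le_divide_eq)
  also have "\<dots> = (norm (k (1, v)))\<^sup>2"
    using k_square[of 1 v] v by (simp add: dist_norm norm_divide norm_power[symmetric])
  finally have "N \<le> norm (k (1, v))" by (rule power2_le_imp_le) simp
  then have "N - 1 \<le> norm (k (1, v) + 1)"
    using norm_triangle_ineq2[of "k (1, v)" "-1"] by simp
  then have "2 / norm (k (1, v) + 1) \<le> 2 / (N - 1)" using N(1) by (intro divide_left_mono mult_pos_pos) auto
  then show ?thesis by (simp add: koebe_eq[OF v] norm_mult norm_divide)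
qed

end

lemma local_escape_path:
  fixes K :: "'a::euclidean_space set"
  assumes K: "compact K" "connected (- K)" and \<zeta>: "\<zeta> \<notin> K" "dist v \<zeta> < \<delta>"
  obtains \<gamma> where "path \<gamma>" "path_image \<gamma> \<subseteq> - K" "pathfinish \<gamma> = \<zeta>" "dist v (pathstart \<gamma>) = \<delta>"
    "\<And>s. s \<in> {0<..1} \<Longrightarrow> dist v (\<gamma> s) < \<delta>"
proof -
  have \<delta>: "\<delta> > 0" using \<zeta>(2) zero_le_dist[of v \<zeta>] by linarith
  obtain g where g: "path g" "path_image g \<subseteq> - K" "pathstart g = \<zeta>" "norm (pathfinish g) > norm v + \<delta>"
    using complement_escape_path[OF K \<zeta>(1)] by blast
  have "pathfinish g \<notin> ball v \<delta>"
    using g(4) norm_triangle_sub[of "pathfinish g" v] by (auto simp: dist_norm norm_minus_commute)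
  moreover have "pathstart g \<in> closure (ball v \<delta>)" using g(3) \<zeta>(2) \<delta> by simp
  ultimately obtain u where u: "0 \<le> u" "u \<le> 1" "\<And>x. 0 \<le> x \<and> x < u \<Longrightarrow> g x \<in> interior (ball v \<delta>)"
      "g u \<notin> interior (ball v \<delta>)" "u = 0 \<or> g u \<in> closure (ball v \<delta>)"
    using subpath_to_frontier_explicit[OF g(1), of "ball v \<delta>"] by metis
  have "u \<noteq> 0" using u(4) g(3) \<zeta>(2) by (auto simp: pathstart_def)
  define \<gamma> where "\<gamma> = reversepath (subpath 0 u g)"
  have \<gamma>: "\<gamma> s = g (u * (1 - s))" for s
    by (simp add: \<gamma>_def reversepath_def subpath_def)
  show ?thesis
  proof (rule that)
    show "path \<gamma>" using g(1) u(1,2) by (simp add: \<gamma>_def path_subpath)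
    show "path_image \<gamma> \<subseteq> - K"
      using g(2) path_image_subpath_subset[of 0 u g] u(1,2) by (auto simp: \<gamma>_def)
    show "pathfinish \<gamma> = \<zeta>" using g(3) by (simp add: pathfinish_def \<gamma> pathstart_def)
    show "dist v (pathstart \<gamma>) = \<delta>"
      using u(4,5) \<open>u \<noteq> 0\<close> \<delta> by (simp add: pathstart_def \<gamma> interior_open)
    show "dist v (\<gamma> s) < \<delta>" if s: "s \<in> {0<..1}" for s
    proof -
      have "u * (1 - s) < u * 1" using s u(1) \<open>u \<noteq> 0\<close> by (intro mult_strict_left_mono) auto
      moreover have "0 \<le> u * (1 - s)" using s u(1) by simp
      ultimately show ?thesis using u(3)[of "u * (1 - s)"] by (simp add: \<gamma> interior_open)
    qed
  qed
qed

lemma slit_sqrt_near_frontier: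
  assumes K: "compact K" "connected (- K)" and v: "v \<in> closure (- K)" and \<delta>: "\<delta> > 0" and \<eta>: "\<eta> > 0"
  obtains \<gamma> k where "slit_sqrt_near K \<gamma> k v \<delta>" "dist v (\<gamma> 1) < \<eta>"
proof -
  obtain \<zeta> where \<zeta>: "\<zeta> \<notin> K" "dist \<zeta> v < min \<eta> (\<delta> / 2)"
    using v \<delta> \<eta> unfolding closure_approachable by (metis ComplD half_gt_zero min_less_iff_conj)
  have "dist v \<zeta> < \<delta>" using \<zeta>(2) \<delta> by (simp add: dist_commute)
  from local_escape_path[OF K \<zeta>(1) this]
  obtain \<gamma> where \<gamma>: "path \<gamma>" "path_image \<gamma> \<subseteq> - K" "pathfinish \<gamma> = \<zeta>" "dist v (pathstart \<gamma>) = \<delta>"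
    "\<And>s. s \<in> {0<..1} \<Longrightarrow> dist v (\<gamma> s) < \<delta>" by blast
  have \<gamma>_ends: "dist v (\<gamma> 0) = \<delta>" "\<gamma> 1 = \<zeta>" using \<gamma>(3,4) by (simp_all add: pathstart_def pathfinish_def)
  have "s = 0" if "s \<in> {0..1}" "\<gamma> s = \<gamma> 0" for s using \<gamma>(5)[of s] \<gamma>_ends that by force
  then obtain k where k: "slit_sqrt K \<gamma> k" using slit_sqrt_exists[OF K \<gamma>(1,2)] by blast
  have "dist v (\<gamma> s) \<le> \<delta>" if "s \<in> {0..1}" for s
    using \<gamma>(5)[of s] \<gamma>_ends(1) that by (cases "s = 0") auto
  then have "slit_sqrt_near K \<gamma> k v \<delta>"
    using \<gamma>_ends \<zeta>(2) \<delta>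
    by (intro slit_sqrt_near.intro k slit_sqrt_near_axioms.intro) (auto simp: dist_commute)
  then show ?thesis using that \<zeta>(2) \<gamma>_ends(2) by (simp add: dist_commute)
qed

theorem frontier_imp_poly_peak_point:
  assumes K: "compact K" "connected (- K)" and v: "v \<in> K" "v \<in> closure (- K)"
  shows "poly_peak_point K v"
  unfolding poly_peak_point_def
proof (rule exI[of _ 110], intro allI impI)
  fix r :: real assume r: "r > 0"
  define e where "e = min r 1 / 2"
  have e: "0 < e" "e \<le> 1/2" "2 * e \<le> r" using r by (auto simp: e_def)
  define \<delta> N where "\<delta> = e * e / 8" and "N = 1 + 2 / e"
  have \<delta>: "\<delta> > 0" "8 * \<delta> \<le> e" using e mult_left_mono[of e 1 e] by (auto simp: \<delta>_def)
  have N: "N > 1" using e by (simp add: N_def)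
  have "\<delta> / N\<^sup>2 > 0" using \<delta>(1) N by simp
  then obtain \<gamma> k where "slit_sqrt_near K \<gamma> k v \<delta>" and \<gamma>1: "dist v (\<gamma> 1) < \<delta> / N\<^sup>2"
    using slit_sqrt_near_frontier[OF K v(2) \<delta>(1)] by blast
  then interpret slit_sqrt_near K \<gamma> k v \<delta> by simp
  have "N\<^sup>2 * dist v (\<gamma> 1) \<le> \<delta>" using \<gamma>1 N by (simp add: field_simps)
  then have at_v: "norm (koebe v - 1) \<le> e" using koebe_near_1[OF v(1) N] by (simp add: N_def)
  have far: "norm (koebe w) \<le> e" if w: "w \<in> K" "r \<le> dist w v" for w
  proof -
    have "norm (koebe w) \<le> 4 * \<delta> / dist w v" using w \<delta> e by (intro norm_koebe_far) auto
    also have "\<dots> \<le> 4 * \<delta> / e" using w \<delta> e by (intro divide_left_mono mult_pos_pos) auto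
    also have "\<dots> \<le> e" using e by (simp add: \<delta>_def)
    finally show ?thesis .
  qed
  obtain p where p: "\<forall>w\<in>K. norm (koebe w - poly p w) < e"
    using poly_approx_koebe e(1) unfolding poly_approx_def by blast
  have pw: "norm (poly p w) \<le> norm (koebe w) + e" if "w \<in> K" for w
    using p that norm_triangle_ineq3[of "koebe w" "poly p w"] by force
  show "\<exists>p. (\<forall>w\<in>K. norm (poly p w) \<le> 110) \<and> norm (poly p v - 1) \<le> r
     \<and> (\<forall>w\<in>K. r \<le> dist w v \<longrightarrow> norm (poly p w) \<le> r)"
  proof (intro exI conjI ballI impI)
    show "norm (poly p w) \<le> 110" if "w \<in> K" for w using pw[OF that] norm_koebe_le[OF that] e by linarith
    show "norm (poly p w) \<le> r" if "w \<in> K" "r \<le> dist w v" for w using pw[OF that(1)] far[OF that] e by linarith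
    show "norm (poly p v - 1) \<le> r"
      using p v(1) at_v e norm_triangle_ineq[of "koebe v - 1" "poly p v - koebe v"]
      by (force simp: norm_minus_commute)
  qed
qed

section \<open>Cauchy transforms of complex measures\<close>

lemma integrable_mult_bounded:
  fixes f \<phi> :: "'i \<Rightarrow> 'b::{real_normed_div_algebra, banach, second_countable_topology}"
  assumes f: "integrable M f" and "\<phi> \<in> borel_measurable M" "\<And>i. i \<in> space M \<Longrightarrow> norm (\<phi> i) \<le> B"
  shows "integrable M (\<lambda>i. f i * \<phi> i)"
proof (rule Bochner_Integration.integrable_bound)
  show "integrable M (\<lambda>i. B * norm (f i))" using f by simp
  have "norm (f i * \<phi> i) \<le> norm (B * norm (f i))" if "i \<in> space M" for i
    using mult_left_mono[OF assms(3)[OF that], of "norm (f i)"] by (simp add: norm_mult mult.commute)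
  then show "AE i in M. norm (f i * \<phi> i) \<le> norm (B * norm (f i))" by auto
qed (use assms in measurable)

lemma poly_peak_point_sequence:
  assumes peak: "poly_peak_point K v"
  obtains C p where "\<And>n z. z \<in> K \<Longrightarrow> norm (poly (p n) z) \<le> C"
    "\<And>z. z \<in> K \<Longrightarrow> (\<lambda>n. poly (p n) z) \<longlonglongrightarrow> of_bool (z = v)"
proof -
  obtain C where C: "\<And>r. r > 0 \<Longrightarrow> \<exists>p. (\<forall>z\<in>K. norm (poly p z) \<le> C) \<and> norm (poly p v - 1) \<le> r
     \<and> (\<forall>z\<in>K. r \<le> dist z v \<longrightarrow> norm (poly p z) \<le> r)"
    using peak unfolding poly_peak_point_def by blast
  have "\<forall>n. \<exists>p. (\<forall>z\<in>K. norm (poly p z) \<le> C) \<and> norm (poly p v - 1) \<le> inverse (real (Suc n))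
     \<and> (\<forall>z\<in>K. inverse (real (Suc n)) \<le> dist z v \<longrightarrow> norm (poly p z) \<le> inverse (real (Suc n)))"
    by (intro allI C) simp
  then obtain p where p: "\<And>n z. z \<in> K \<Longrightarrow> norm (poly (p n) z) \<le> C"
    "\<And>n. norm (poly (p n) v - 1) \<le> inverse (real (Suc n))"
    "\<And>n z. z \<in> K \<Longrightarrow> inverse (real (Suc n)) \<le> dist z v \<Longrightarrow> norm (poly (p n) z) \<le> inverse (real (Suc n))"
    by metis
  have "(\<lambda>n. poly (p n) z) \<longlonglongrightarrow> of_bool (z = v)" if z: "z \<in> K" for z
  proof (cases "z = v")
    case True
    have "(\<lambda>n. poly (p n) v - 1) \<longlonglongrightarrow> 0"
      by (rule Lim_null_comparison[OF _ LIMSEQ_inverse_real_of_nat]) (use p(2) in auto)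
    then show ?thesis using True by (simp add: LIM_zero_iff)
  next
    case False
    then have "\<forall>\<^sub>F n in sequentially. inverse (real (Suc n)) < dist z v"
      by (intro order_tendstoD(2)[OF LIMSEQ_inverse_real_of_nat]) simp
    then have "\<forall>\<^sub>F n in sequentially. norm (poly (p n) z) \<le> inverse (real (Suc n))"
      by eventually_elim (use p(3)[OF z] in auto)
    then have "(\<lambda>n. poly (p n) z) \<longlonglongrightarrow> 0"
      by (rule Lim_null_comparison[OF _ LIMSEQ_inverse_real_of_nat])
    then show ?thesis using False by simp
  qed
  with p(1) show ?thesis by (rule that)
qed

text \<open>
  The triple \<open>M\<close>, \<open>a\<close>, \<open>w\<close> represents the complex measure on the disc of radius \<open>R\<close> that is the image
  under \<open>w\<close> of the measure with density \<open>a\<close> with respect to \<open>M\<close>.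
\<close>

locale disc_complex_measure = sigma_finite_measure M for M :: "'i measure" +
  fixes a w :: "'i \<Rightarrow> complex" and R :: real
  assumes integrable_density [measurable]: "integrable M a"
    and measurable_w [measurable]: "w \<in> borel_measurable M"
    and norm_w_le: "\<And>i. i \<in> space M \<Longrightarrow> norm (w i) \<le> R"
begin

definition cauchy_transform :: "complex \<Rightarrow> complex" where
  "cauchy_transform y = (\<integral>i. a i / (y - w i) \<partial>M)"

lemma integrable_power_moment: "integrable M (\<lambda>i. a i * w i ^ n)"
proof (rule integrable_mult_bounded[OF integrable_density])
  show "norm (w i ^ n) \<le> R ^ n" if "i \<in> space M" for i
    using norm_w_le[OF that] by (simp add: norm_power power_mono)
qed measurable

lemma cauchy_kernel_bound:
  assumes y: "norm y > \<bar>R\<bar> + 1" and i: "i \<in> space M"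
  shows "norm (y / (y - w i)) \<le> \<bar>R\<bar> + 1"
proof -
  have diff: "norm y - \<bar>R\<bar> \<le> norm (y - w i)"
    using norm_triangle_ineq2[of y "w i"] norm_w_le[OF i] by linarith
  have "0 \<le> \<bar>R\<bar> * (norm y - (\<bar>R\<bar> + 1))" using y by simp
  then have "norm y \<le> (\<bar>R\<bar> + 1) * (norm y - \<bar>R\<bar>)" by (simp add: algebra_simps)
  also have "\<dots> \<le> (\<bar>R\<bar> + 1) * norm (y - w i)" using diff by (intro mult_left_mono) auto
  finally show ?thesis using y diff by (simp add: norm_divide divide_le_eq)
qed

definition moment_transform :: "nat \<Rightarrow> complex \<Rightarrow> complex" where
  "moment_transform n y = (\<integral>i. a i * w i ^ n * (y / (y - w i)) \<partial>M)"

lemma moment_transform_0: "moment_transform 0 y = y * cauchy_transform y"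
  unfolding moment_transform_def cauchy_transform_def integral_mult_right_zero[symmetric]
  by (simp add: mult.commute)

lemma moment_transform_Suc:
  assumes y: "norm y > \<bar>R\<bar> + 1"
  shows "moment_transform (Suc n) y = y * moment_transform n y - y * (\<integral>i. a i * w i ^ n \<partial>M)"
proof -
  have integrable: "integrable M (\<lambda>i. a i * w i ^ n * (y / (y - w i)))"
    by (rule integrable_mult_bounded[OF integrable_power_moment _ cauchy_kernel_bound[OF y]]) measurable
  have "moment_transform (Suc n) y
      = (\<integral>i. y * (a i * w i ^ n * (y / (y - w i))) - y * (a i * w i ^ n) \<partial>M)"
    unfolding moment_transform_def
  proof (rule Bochner_Integration.integral_cong[OF refl])
    fix i assume "i \<in> space M"
    then have "y \<noteq> w i" using norm_w_le[of i] y by auto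
    then show "a i * w i ^ Suc n * (y / (y - w i))
        = y * (a i * w i ^ n * (y / (y - w i))) - y * (a i * w i ^ n)"
      by (simp add: field_simps)
  qed
  also have "\<dots> = y * moment_transform n y - y * (\<integral>i. a i * w i ^ n \<partial>M)"
    unfolding moment_transform_def
    by (subst Bochner_Integration.integral_diff)
       (simp_all only: integrable_mult_right integrable integrable_power_moment integral_mult_right_zero)
  finally show ?thesis .
qed

lemma moment_transform_tendsto:
  assumes y: "\<And>m. norm (y m) > \<bar>R\<bar> + 1" and y_infinity: "filterlim y at_infinity sequentially"
  shows "(\<lambda>m. moment_transform n (y m)) \<longlonglongrightarrow> (\<integral>i. a i * w i ^ n \<partial>M)"
  unfolding moment_transform_def
proof (rule integral_dominated_convergence)
  show "integrable M (\<lambda>i. norm (a i * w i ^ n) * (\<bar>R\<bar> + 1))" using integrable_power_moment by simp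
  show "AE i in M. norm (a i * w i ^ n * (y m / (y m - w i))) \<le> norm (a i * w i ^ n) * (\<bar>R\<bar> + 1)" for m
    unfolding norm_mult[of "a _ * w _ ^ n"]
    by (intro AE_I2 mult_left_mono cauchy_kernel_bound y) auto
  have "(\<lambda>m. a i * w i ^ n * (y m / (y m - w i))) \<longlonglongrightarrow> a i * w i ^ n * 1" for i
  proof (intro tendsto_intros)
    have "y m / (y m - w i) = 1 / (1 - w i / y m)" for m
    proof -
      have "y m \<noteq> 0" using y[of m] by auto
      then have "1 - w i / y m = (y m - w i) / y m" by (simp add: diff_divide_distrib)
      then show ?thesis by simp
    qed
    moreover have "(\<lambda>m. 1 / (1 - w i / y m)) \<longlonglongrightarrow> 1 / (1 - 0)"
      by (intro tendsto_intros tendsto_divide_0[OF tendsto_const y_infinity]) auto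
    ultimately show "(\<lambda>m. y m / (y m - w i)) \<longlonglongrightarrow> 1" by simp
  qed
  then show "AE i in M. (\<lambda>m. a i * w i ^ n * (y m / (y m - w i))) \<longlonglongrightarrow> a i * w i ^ n" by simp
qed measurable

lemma power_moments_zero:
  assumes zeros: "\<And>B. \<exists>y. norm y > B \<and> cauchy_transform y = 0"
  shows "(\<integral>i. a i * w i ^ n \<partial>M) = 0"
proof -
  have "\<forall>m. \<exists>y. norm y > \<bar>R\<bar> + 1 + real m \<and> cauchy_transform y = 0" using zeros by blast
  then obtain y where y: "\<And>m. norm (y m) > \<bar>R\<bar> + 1 + real m" "\<And>m. cauchy_transform (y m) = 0"
    by metis
  have yR: "norm (y m) > \<bar>R\<bar> + 1" for m using y(1)[of m] by linarith
  have "real m \<le> norm (y m)" for m using y(1)[of m] by linarith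
  then have "filterlim (\<lambda>m. norm (y m)) at_top sequentially"
    by (intro filterlim_at_top_mono[OF filterlim_real_sequentially]) auto
  then have y_infinity: "filterlim y at_infinity sequentially"
    by (simp add: filterlim_norm_at_top_imp_at_infinity)
  have moment: "(\<integral>i. a i * w i ^ n \<partial>M) = 0" if "\<forall>m. moment_transform n (y m) = 0" for n
    using LIMSEQ_unique[OF moment_transform_tendsto[OF yR y_infinity, of n]] that by simp
  have "\<forall>m. moment_transform n (y m) = 0"
    by (induction n) (simp_all add: moment_transform_0 y(2) moment_transform_Suc[OF yR] moment)
  then show ?thesis by (rule moment)
qed

lemma poly_moments_zero:
  assumes "\<And>B. \<exists>y. norm y > B \<and> cauchy_transform y = 0"
  shows "(\<integral>i. a i * poly p (w i) \<partial>M) = 0"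
proof -
  have "(\<integral>i. a i * poly p (w i) \<partial>M) = (\<integral>i. (\<Sum>n\<le>degree p. coeff p n * (a i * w i ^ n)) \<partial>M)"
    by (simp add: poly_altdef sum_distrib_left mult_ac)
  also have "\<dots> = (\<Sum>n\<le>degree p. coeff p n * (\<integral>i. a i * w i ^ n \<partial>M))"
    using integrable_power_moment by simp
  finally show ?thesis using power_moments_zero[OF assms] by simp
qed

lemma peak_point_atom_zero:
  assumes peak: "poly_peak_point K v" and K: "\<And>i. i \<in> space M \<Longrightarrow> w i \<in> K"
    and zero: "\<And>p. (\<integral>i. a i * poly p (w i) \<partial>M) = 0"
  shows "(LINT i:{i\<in>space M. w i = v}|M. a i) = 0"
proof -
  obtain C p where p: "\<And>n z. z \<in> K \<Longrightarrow> norm (poly (p n) z) \<le> C"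
    "\<And>z. z \<in> K \<Longrightarrow> (\<lambda>n. poly (p n) z) \<longlonglongrightarrow> of_bool (z = v)"
    using peak by (rule poly_peak_point_sequence) blast
  have "(\<lambda>n. a i * poly (p n) (w i)) \<longlonglongrightarrow> indicator {i\<in>space M. w i = v} i *\<^sub>R a i" if "i \<in> space M" for i
    using tendsto_mult_left[OF p(2)[OF K[OF that]], of "a i"] that
    by (cases "w i = v") auto
  moreover have "norm (a i * poly (p n) (w i)) \<le> norm (a i) * C" if "i \<in> space M" for i n
    using p(1)[OF K[OF that]] by (simp add: norm_mult mult_left_mono)
  moreover have "(\<lambda>i. poly (p n) (w i)) \<in> borel_measurable M" for n
    by (rule measurable_compose[OF measurable_w]) (intro borel_measurable_continuous_onI continuous_intros)
  ultimately have "(\<lambda>n. \<integral>i. a i * poly (p n) (w i) \<partial>M) \<longlonglongrightarrow> (LINT i:{i\<in>space M. w i = v}|M. a i)"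
    unfolding set_lebesgue_integral_def using integrable_density
    by (intro integral_dominated_convergence[where w = "\<lambda>i. norm (a i) * C"]) auto
  then show ?thesis by (simp add: zero LIMSEQ_const_iff)
qed

lemma integral_zero_if_atoms_zero:
  assumes countable: "countable (w ` space M)"
    and atoms: "\<And>v. v \<in> w ` space M \<Longrightarrow> (LINT i:{i\<in>space M. w i = v}|M. a i) = 0"
    and integrable: "integrable M (\<lambda>i. a i * g (w i))"
  shows "(\<integral>i. a i * g (w i) \<partial>M) = 0"
proof -
  define A where "A n = {i \<in> space M. to_nat_on (w ` space M) (w i) = n}" for n
  have A_atom: "\<exists>v \<in> w ` space M. A n = {i \<in> space M. w i = v}" if nonempty: "A n \<noteq> {}" for n
  proof -
    obtain i where "i \<in> space M" "to_nat_on (w ` space M) (w i) = n" using nonempty unfolding A_def by blast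
    then show ?thesis
      using inj_on_to_nat_on[OF countable] by (intro bexI[of _ "w i"]) (auto simp: A_def inj_on_def)
  qed
  have meas: "A n \<in> sets M" for n
    using A_atom[of n] by (cases "A n = {}") auto
  have "(LINT i:A n|M. a i * g (w i)) = 0" for n
  proof (cases "A n = {}")
    case False
    then obtain v where v: "v \<in> w ` space M" "A n = {i \<in> space M. w i = v}" using A_atom by blast
    have "(LINT i:A n|M. a i * g (w i)) = (LINT i:A n|M. a i * g v)"
      unfolding set_lebesgue_integral_def
      by (rule Bochner_Integration.integral_cong) (auto simp: v(2) indicator_def)
    then show ?thesis using atoms[OF v(1)] v(2) by simp
  qed (simp add: set_lebesgue_integral_def)
  moreover have "(\<Union>n. A n) = space M" by (auto simp: A_def)
  moreover have "(LINT i:(\<Union>n. A n)|M. a i * g (w i)) = (\<Sum>n. LINT i:A n|M. a i * g (w i))"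
  proof (rule lebesgue_integral_countable_add[OF meas])
    show "set_integrable M (\<Union>n. A n) (\<lambda>i. a i * g (w i))"
      unfolding set_integrable_def using integrable \<open>(\<Union>n. A n) = space M\<close>
      by (simp cong: Bochner_Integration.integrable_cong)
  qed (auto simp: A_def)
  ultimately show ?thesis by (simp add: set_integral_space integrable)
qed

theorem integral_zero_if_cauchy_transform_zero:
  assumes K: "compact K" "connected (- K)" and frontier: "\<And>i. i \<in> space M \<Longrightarrow> w i \<in> K \<inter> closure (- K)"
    and countable: "countable (w ` space M)"
    and zeros: "\<And>B. \<exists>y. norm y > B \<and> cauchy_transform y = 0"
    and integrable: "integrable M (\<lambda>i. a i * g (w i))"
  shows "(\<integral>i. a i * g (w i) \<partial>M) = 0"
proof (rule integral_zero_if_atoms_zero[OF countable _ integrable])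
  fix v assume "v \<in> w ` space M"
  then have "poly_peak_point K v"
    using frontier by (intro frontier_imp_poly_peak_point[OF K]) auto
  then show "(LINT i:{i\<in>space M. w i = v}|M. a i) = 0"
    using frontier poly_moments_zero[OF zeros] by (intro peak_point_atom_zero) auto
qed

end

lemma sets_borel_ball [measurable]: "ball x r \<in> sets borel"
  by (rule borel_open[OF open_ball])

lemma inverse_dist_le_dyadic_sum:
  fixes w z :: "'a::metric_space"
  assumes r: "r > 0"
  shows "ennreal (1 / dist z w) * indicator (ball w r) z
    \<le> (\<Sum>n. ennreal (2 ^ Suc n / r) * indicator (ball w (r / 2 ^ n)) z)" (is "_ \<le> (\<Sum>n. ?f n)")
proof (cases "z \<in> ball w r \<and> z \<noteq> w")
  case True
  define n where "n = (LEAST n. r / 2 ^ Suc n \<le> dist z w)"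
  obtain m where "(1/2) ^ m < dist z w / r" using True r real_arch_pow_inv[of "dist z w / r" "1/2"] by auto
  then have "r / 2 ^ Suc m \<le> dist z w" using r True by (simp add: field_simps)
  then have n: "r / 2 ^ Suc n \<le> dist z w" unfolding n_def by (rule LeastI)
  have "dist z w < r / 2 ^ n"
  proof (cases n)
    case 0
    then show ?thesis using True by (simp add: dist_commute)
  next
    case (Suc k)
    then show ?thesis using not_less_Least[of k "\<lambda>n. r / 2 ^ Suc n \<le> dist z w"] by (simp add: n_def)
  qed
  moreover have "1 / dist z w \<le> 2 ^ Suc n / r" using n r True by (simp add: field_simps)
  ultimately have "ennreal (1 / dist z w) * indicator (ball w r) z \<le> ?f n"
    using True by (simp add: dist_commute ennreal_leI)
  also have "\<dots> = (\<Sum>n\<in>{n}. ?f n)" by (simp del: sum_mult_indicator)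
  also have "\<dots> \<le> (\<Sum>n. ?f n)" by (rule sum_le_suminf) auto
  finally show ?thesis .
qed auto

lemma nn_integral_inverse_dist_ball:
  fixes w :: complex
  assumes r: "r > 0"
  shows "(\<integral>\<^sup>+z\<in>ball w r. ennreal (1 / dist z w) \<partial>lborel) \<le> ennreal (4 * pi * r)"
proof -
  let ?f = "\<lambda>n z. ennreal (2 ^ Suc n / r) * indicator (ball w (r / 2 ^ n)) z"
  have "(\<integral>\<^sup>+z\<in>ball w r. ennreal (1 / dist z w) \<partial>lborel) \<le> (\<integral>\<^sup>+z. (\<Sum>n. ?f n z) \<partial>lborel)"
    by (intro nn_integral_mono inverse_dist_le_dyadic_sum r)
  also have "\<dots> = (\<Sum>n. \<integral>\<^sup>+z. ?f n z \<partial>lborel)" by (rule nn_integral_suminf) measurable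
  also have "\<dots> = (\<Sum>n. ennreal (2 * pi * r * (1/2) ^ n))"
  proof (rule suminf_cong)
    fix n
    have "(\<integral>\<^sup>+z. ?f n z \<partial>lborel) = ennreal (2 ^ Suc n / r) * emeasure lborel (ball w (r / 2 ^ n))"
      by (rule nn_integral_cmult_indicator) simp
    also have "emeasure lborel (ball w (r / 2 ^ n)) = ennreal (pi * (r / 2 ^ n)\<^sup>2)"
      using r by (simp add: emeasure_ball unit_ball_vol_2)
    also have "ennreal (2 ^ Suc n / r) * ennreal (pi * (r / 2 ^ n)\<^sup>2)
        = ennreal (2 ^ Suc n / r * (pi * (r / 2 ^ n)\<^sup>2))"
      using r by (intro ennreal_mult[symmetric]) auto
    also have "2 ^ Suc n / r * (pi * (r / 2 ^ n)\<^sup>2) = 2 * pi * r * (1/2) ^ n"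
      using r by (simp add: field_simps power2_eq_square)
    finally show "(\<integral>\<^sup>+z. ?f n z \<partial>lborel) = ennreal (2 * pi * r * (1/2) ^ n)" .
  qed
  also have "\<dots> = ennreal (2 * pi * r * 2)"
    using r geometric_sums[of "1/2 :: real"] by (intro suminf_ennreal_eq sums_mult) auto
  also have "2 * pi * r * 2 = 4 * pi * r" by simp
  finally show ?thesis .
qed

lemma nn_integral_inverse_dist_ball_0:
  fixes w :: complex
  assumes w: "norm w \<le> R" and r: "\<rho> + R < r" "r > 0"
  shows "(\<integral>\<^sup>+z\<in>ball 0 \<rho>. ennreal (1 / dist z w) \<partial>lborel) \<le> ennreal (4 * pi * r)"
proof -
  have subset: "z \<in> ball w r" if "z \<in> ball 0 \<rho>" for z
    using that w r(1) norm_triangle_ineq4[of w z] by (simp add: dist_norm)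
  have "(\<integral>\<^sup>+z\<in>ball 0 \<rho>. ennreal (1 / dist z w) \<partial>lborel) \<le> (\<integral>\<^sup>+z\<in>ball w r. ennreal (1 / dist z w) \<partial>lborel)"
    using subset by (intro nn_integral_mono) (auto split: split_indicator)
  also have "\<dots> \<le> ennreal (4 * pi * r)" using r(2) by (rule nn_integral_inverse_dist_ball)
  finally show ?thesis .
qed

context disc_complex_measure
begin

lemma cauchy_transform_measurable [measurable]: "cauchy_transform \<in> borel_measurable lborel"
  unfolding cauchy_transform_def[abs_def] by measurable

lemma nn_integral_cauchy_kernel_finite:
  "(\<integral>\<^sup>+y\<in>ball 0 \<rho>. (\<integral>\<^sup>+i. ennreal (norm (a i / (y - w i))) \<partial>M) \<partial>lborel) < \<infinity>"
proof -
  define r where "r = \<bar>\<rho>\<bar> + \<bar>R\<bar> + 1"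
  have r: "\<rho> + R < r" "r > 0" by (simp_all add: r_def)
  interpret pair_sigma_finite M lborel ..
  let ?F = "\<lambda>i y. ennreal (norm (a i / (y - w i))) * indicator (ball 0 \<rho>) y"
  have "(\<integral>\<^sup>+y\<in>ball 0 \<rho>. (\<integral>\<^sup>+i. ennreal (norm (a i / (y - w i))) \<partial>M) \<partial>lborel)
      = (\<integral>\<^sup>+y. (\<integral>\<^sup>+i. ?F i y \<partial>M) \<partial>lborel)"
    by (simp add: nn_integral_multc)
  also have "\<dots> = (\<integral>\<^sup>+i. (\<integral>\<^sup>+y. ?F i y \<partial>lborel) \<partial>M)"
    by (rule Fubini') measurable
  also have "\<dots> \<le> (\<integral>\<^sup>+i. ennreal (norm (a i)) * ennreal (4 * pi * r) \<partial>M)"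
  proof (rule nn_integral_mono)
    fix i assume i: "i \<in> space M"
    have "?F i y = ennreal (norm (a i)) * (ennreal (1 / dist y (w i)) * indicator (ball 0 \<rho>) y)" for y
      by (simp add: norm_divide dist_norm ennreal_mult'[symmetric] split: split_indicator)
    then have "(\<integral>\<^sup>+y. ?F i y \<partial>lborel)
        = ennreal (norm (a i)) * (\<integral>\<^sup>+y\<in>ball 0 \<rho>. ennreal (1 / dist y (w i)) \<partial>lborel)"
      by (simp only:) (rule nn_integral_cmult, measurable)
    also have "\<dots> \<le> ennreal (norm (a i)) * ennreal (4 * pi * r)"
      by (rule mult_left_mono[OF nn_integral_inverse_dist_ball_0[OF norm_w_le[OF i] r]]) simp
    finally show "(\<integral>\<^sup>+y. ?F i y \<partial>lborel) \<le> ennreal (norm (a i)) * ennreal (4 * pi * r)" .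
  qed
  also have "\<dots> = (\<integral>\<^sup>+i. ennreal (norm (a i)) \<partial>M) * ennreal (4 * pi * r)"
    by (rule nn_integral_multc) measurable
  also have "\<dots> < \<infinity>"
    using integrable_density unfolding integrable_iff_bounded by (simp add: ennreal_mult_less_top)
  finally show ?thesis .
qed

lemma AE_integrable_cauchy_kernel: "AE y in lborel. integrable M (\<lambda>i. a i / (y - w i))"
proof -
  have "AE y in lborel. y \<in> ball 0 (real n) \<longrightarrow> integrable M (\<lambda>i. a i / (y - w i))" for n
  proof -
    have "AE y in lborel. (\<integral>\<^sup>+i. ennreal (norm (a i / (y - w i))) \<partial>M) * indicator (ball 0 (real n)) y \<noteq> \<infinity>"
      by (rule nn_integral_PInf_AE, measurable) (rule less_imp_neq[OF nn_integral_cauchy_kernel_finite])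
    then show ?thesis by (rule AE_mp) (auto simp: integrable_iff_bounded less_top)
  qed
  then have "AE y in lborel. \<forall>n. y \<in> ball 0 (real n) \<longrightarrow> integrable M (\<lambda>i. a i / (y - w i))"
    by (subst AE_all_countable) blast
  then show ?thesis
  proof (rule AE_mp, intro AE_I2 impI)
    fix y :: complex assume "\<forall>n. y \<in> ball 0 (real n) \<longrightarrow> integrable M (\<lambda>i. a i / (y - w i))"
    moreover obtain n where "norm y < real n" using reals_Archimedean2 by blast
    ultimately show "integrable M (\<lambda>i. a i / (y - w i))" by (metis mem_ball_0)
  qed
qed

lemma nn_integral_cauchy_transform_finite:
  "(\<integral>\<^sup>+y\<in>ball 0 \<rho>. ennreal (norm (cauchy_transform y)) \<partial>lborel) < \<infinity>"
proof -
  have "(\<integral>\<^sup>+y\<in>ball 0 \<rho>. ennreal (norm (cauchy_transform y)) \<partial>lborel)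
      \<le> (\<integral>\<^sup>+y\<in>ball 0 \<rho>. (\<integral>\<^sup>+i. ennreal (norm (a i / (y - w i))) \<partial>M) \<partial>lborel)"
  proof (rule nn_integral_mono_AE, rule AE_mp[OF AE_integrable_cauchy_kernel], intro AE_I2 impI mult_right_mono)
    fix y assume "integrable M (\<lambda>i. a i / (y - w i))"
    then show "ennreal (norm (cauchy_transform y)) \<le> (\<integral>\<^sup>+i. ennreal (norm (a i / (y - w i))) \<partial>M)"
      unfolding cauchy_transform_def by (rule integral_norm_bound_ennreal)
  qed simp
  then show ?thesis using nn_integral_cauchy_kernel_finite by (rule order.strict_trans1)
qed

end

section \<open>The area formula and the transfer operator\<close>

definition complex_of_vec :: "real ^ 2 \<Rightarrow> complex" where
  "complex_of_vec x = Complex (x $ 1) (x $ 2)"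

definition vec_of_complex :: "complex \<Rightarrow> real ^ 2" where
  "vec_of_complex z = vector [Re z, Im z]"

lemma complex_of_vec_of_complex [simp]: "complex_of_vec (vec_of_complex z) = z"
  by (simp add: complex_of_vec_def vec_of_complex_def)

lemma vec_of_complex_of_vec [simp]: "vec_of_complex (complex_of_vec x) = x"
  by (simp add: complex_of_vec_def vec_of_complex_def vec_eq_iff forall_2)

lemma vec_of_complex_eq_iff [simp]: "vec_of_complex z = vec_of_complex z' \<longleftrightarrow> z = z'"
  by (metis complex_of_vec_of_complex)

lemma complex_of_vec_eq_iff [simp]: "complex_of_vec x = complex_of_vec y \<longleftrightarrow> x = y"
  by (metis vec_of_complex_of_vec)

lemma bounded_linear_complex_of_vec: "bounded_linear complex_of_vec"
  unfolding linear_conv_bounded_linear[symmetric] complex_of_vec_def[abs_def]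
  by (rule linearI) (simp_all add: complex_eq_iff)

lemma bounded_linear_vec_of_complex: "bounded_linear vec_of_complex"
  unfolding linear_conv_bounded_linear[symmetric] vec_of_complex_def[abs_def]
  by (rule linearI) (simp_all add: vec_eq_iff forall_2)

lemma complex_of_vec_measurable [measurable]: "complex_of_vec \<in> borel \<rightarrow>\<^sub>M borel"
  using bounded_linear_complex_of_vec
  by (intro borel_measurable_continuous_onI linear_continuous_on)

lemma lborel_complex_eq_distr: "lborel = distr lborel borel complex_of_vec"
proof (rule lborel_eqI)
  fix l u :: complex assume lu: "\<And>b. b \<in> Basis \<Longrightarrow> l \<bullet> b \<le> u \<bullet> b"
  have le: "Re l \<le> Re u" "Im l \<le> Im u" using lu[of 1] lu[of \<i>] by (simp_all add: Basis_complex_def)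
  have "complex_of_vec -` box l u = box (vec_of_complex l) (vec_of_complex u)"
    by (auto simp: complex_of_vec_def vec_of_complex_def in_box_complex_iff mem_box_cart forall_2)
  then have "emeasure (distr lborel borel complex_of_vec) (box l u)
      = emeasure lborel (box (vec_of_complex l) (vec_of_complex u))"
    by (simp add: emeasure_distr)
  also have "\<dots> = ennreal (\<Prod>b\<in>Basis. (vec_of_complex u - vec_of_complex l) \<bullet> b)"
  proof (rule emeasure_lborel_box)
    fix b :: "real ^ 2" assume "b \<in> Basis"
    then obtain i where "b = axis i 1" by (auto simp: Basis_vec_def)
    then show "vec_of_complex l \<bullet> b \<le> vec_of_complex u \<bullet> b"
      using exhaust_2[of i] le by (auto simp: inner_axis vec_of_complex_def)
  qed
  also have "(\<Prod>b\<in>Basis. (vec_of_complex u - vec_of_complex l) \<bullet> b) = (Re u - Re l) * (Im u - Im l)"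
    by (simp add: Basis_vec_def UNIV_2 axis_eq_axis inner_axis vec_of_complex_def)
  also have "\<dots> = (\<Prod>b\<in>Basis. (u - l) \<bullet> b)" by (simp add: Basis_complex_def)
  finally show "emeasure (distr lborel borel complex_of_vec) (box l u) = ennreal (\<Prod>b\<in>Basis. (u - l) \<bullet> b)" .
qed simp

lemma det_matrix_complex_mult:
  "det (matrix (\<lambda>h. vec_of_complex (c * complex_of_vec h))) = (norm c)\<^sup>2"
  unfolding cmod_power2
  by (simp add: det_2 matrix_def vec_of_complex_def complex_of_vec_def axis_def power2_eq_square)

lemma has_derivative_vec_conjugate:
  assumes "(f has_field_derivative f') (at (complex_of_vec x))"
  shows "((\<lambda>x. vec_of_complex (f (complex_of_vec x))) has_derivative
     (\<lambda>h. vec_of_complex (f' * complex_of_vec h))) (at x within S)"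
proof -
  have "(complex_of_vec has_derivative complex_of_vec) (at x within S)"
    by (rule bounded_linear_imp_has_derivative[OF bounded_linear_complex_of_vec])
  moreover have "(f has_derivative (*) f') (at (complex_of_vec x))"
    using assms by (simp only: has_field_derivative_def)
  ultimately have "((\<lambda>x. f (complex_of_vec x)) has_derivative (\<lambda>h. f' * complex_of_vec h)) (at x within S)"
    by (rule has_derivative_compose)
  then show ?thesis by (rule bounded_linear.has_derivative[OF bounded_linear_vec_of_complex])
qed

lemma vec_conjugate_image:
  "(\<lambda>x. vec_of_complex (f (complex_of_vec x))) ` (complex_of_vec -` A) = complex_of_vec -` (f ` A)"
    (is "?g ` ?A = _")
proof
  show "complex_of_vec -` (f ` A) \<subseteq> ?g ` ?A"
  proof
    fix x assume "x \<in> complex_of_vec -` (f ` A)"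
    then obtain z where "z \<in> A" "complex_of_vec x = f z" by auto
    then show "x \<in> ?g ` ?A"
      using vec_of_complex_of_vec[of x] by (intro image_eqI[of _ _ "vec_of_complex z"]) auto
  qed
qed auto

lemma emeasure_lborel_eq_vimage_vec:
  "B \<in> sets borel \<Longrightarrow> emeasure lborel B = emeasure lborel (complex_of_vec -` B)"
  by (subst lborel_complex_eq_distr) (simp add: emeasure_distr)

lemma borel_measurable_holomorphic:
  assumes "f holomorphic_on UNIV"
  shows "f \<in> borel_measurable borel" "deriv f \<in> borel_measurable borel"
  by (intro borel_measurable_continuous_onI holomorphic_on_imp_continuous_on holomorphic_deriv assms open_UNIV)+

lemma emeasure_holomorphic_image:
  assumes f: "f holomorphic_on UNIV" and A [measurable]: "A \<in> sets borel" and inj: "inj_on f A"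
    and image: "f ` A \<in> sets borel" "bounded (f ` A)"
  shows "emeasure lborel (f ` A) = (\<integral>\<^sup>+x\<in>A. ennreal ((norm (deriv f x))\<^sup>2) \<partial>lborel)"
proof -
  note [measurable] = borel_measurable_holomorphic[OF f]
  let ?A = "complex_of_vec -` A" and ?g = "\<lambda>x. vec_of_complex (f (complex_of_vec x))"
  let ?D = "\<lambda>x h. vec_of_complex (deriv f (complex_of_vec x) * complex_of_vec h)"
  have der: "(?g has_derivative ?D x) (at x within ?A)" for x
    using holomorphic_derivI[OF f open_UNIV] by (intro has_derivative_vec_conjugate) auto
  have meas: "?A \<in> sets borel" using measurable_sets_borel[OF complex_of_vec_measurable A] .
  then have A': "?A \<in> sets lebesgue" by simp
  have inj': "inj_on ?g ?A"
  proof (rule inj_onI)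
    fix x y assume "x \<in> ?A" "y \<in> ?A" "?g x = ?g y"
    then show "x = y" using inj_onD[OF inj, of "complex_of_vec x" "complex_of_vec y"] by auto
  qed
  note image_eq = vec_conjugate_image[of f A]
  have "bounded (?g ` ?A)"
    by (rule bounded_subset[OF bounded_linear_image[OF image(2) bounded_linear_vec_of_complex]]) auto
  moreover have "?g ` ?A \<in> sets borel"
    unfolding image_eq by (rule measurable_sets_borel[OF complex_of_vec_measurable image(1)])
  ultimately have finite: "?g ` ?A \<in> lmeasurable"
    by (intro bounded_set_imp_lmeasurable) auto
  have "((\<lambda>x. \<bar>det (matrix (?D x))\<bar>) has_integral measure lebesgue (?g ` ?A)) ?A"
    using has_measure_differentiable_image[OF A' der inj'] finite by blast
  then have "((\<lambda>x. (norm (deriv f (complex_of_vec x)))\<^sup>2) has_integral measure lebesgue (?g ` ?A)) ?A"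
    by (simp add: det_matrix_complex_mult)
  then have "(\<integral>\<^sup>+x. ennreal (indicator ?A x * (norm (deriv f (complex_of_vec x)))\<^sup>2) \<partial>lborel)
      = ennreal (measure lebesgue (?g ` ?A))"
    by (intro nn_integral_has_integral_lebesgue) auto
  also have "\<dots> = emeasure lborel (?g ` ?A)"
    using finite \<open>?g ` ?A \<in> sets borel\<close> by (simp add: emeasure_eq_ennreal_measure fmeasurable_def)
  also have "\<dots> = emeasure lborel (f ` A)"
    unfolding image_eq using image(1) by (simp add: emeasure_lborel_eq_vimage_vec)
  also have "(\<integral>\<^sup>+x. ennreal (indicator ?A x * (norm (deriv f (complex_of_vec x)))\<^sup>2) \<partial>lborel)
      = (\<integral>\<^sup>+x\<in>A. ennreal ((norm (deriv f x))\<^sup>2) \<partial>lborel)"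
    by (subst lborel_complex_eq_distr)
       (auto simp: nn_integral_distr intro!: nn_integral_cong split: split_indicator)
  finally show ?thesis ..
qed

lemma injective_holomorphic_borel_inverse:
  assumes f: "f holomorphic_on U" and U: "open U" "inj_on f U"
  obtains \<psi> where "\<psi> \<in> borel_measurable borel" "\<And>x. x \<in> U \<Longrightarrow> \<psi> (f x) = x"
proof -
  obtain \<psi> where \<psi>: "\<psi> holomorphic_on f ` U" "\<And>x. x \<in> U \<Longrightarrow> \<psi> (f x) = x"
    using holomorphic_has_inverse[OF f U] by metis
  have "open (f ` U)" using open_mapping_thm3[OF f U] .
  then have "(\<lambda>y. if y \<in> f ` U then \<psi> y else 0) \<in> borel_measurable borel"
    using holomorphic_on_imp_continuous_on[OF \<psi>(1)]
    by (intro borel_measurable_continuous_on_if continuous_on_const) auto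
  then show ?thesis by (rule that) (use \<psi>(2) in auto)
qed

lemma sets_borel_injective_holomorphic_image:
  assumes f: "f holomorphic_on U" and U: "open U" "inj_on f U" and B: "B \<in> sets borel" "B \<subseteq> U"
  shows "f ` B \<in> sets borel"
proof -
  obtain \<psi> where \<psi>: "\<psi> \<in> borel_measurable borel" "\<And>x. x \<in> U \<Longrightarrow> \<psi> (f x) = x"
    using injective_holomorphic_borel_inverse[OF f U] by blast
  have "f ` B = f ` U \<inter> \<psi> -` B" using \<psi>(2) B(2) by force
  then show ?thesis
    using open_mapping_thm3[OF f U] measurable_sets_borel[OF \<psi>(1) B(1)] by auto
qed

lemma distr_density_injective_holomorphic:
  assumes f: "f holomorphic_on UNIV" and U: "open U" "inj_on f U" "bounded (f ` U)"
    and A: "A \<in> sets borel" "A \<subseteq> U"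
  shows "distr (density lborel (\<lambda>x. ennreal ((norm (deriv f x))\<^sup>2) * indicator A x)) borel f
    = density lborel (indicator (f ` A))"
proof (rule measure_eqI)
  note [measurable] = borel_measurable_holomorphic[OF f] A(1)
  let ?\<mu> = "density lborel (\<lambda>x. ennreal ((norm (deriv f x))\<^sup>2) * indicator A x)"
  fix B :: "complex set" assume "B \<in> sets (distr ?\<mu> borel f)"
  then have [measurable]: "B \<in> sets borel" by simp
  have B: "A \<inter> f -` B \<in> sets borel" using measurable_sets_borel[of f borel B] by auto
  have image_borel: "f ` C \<in> sets borel" if "C \<in> sets borel" "C \<subseteq> U" for C
    using sets_borel_injective_holomorphic_image[OF holomorphic_on_subset[OF f] U(1,2) that] by simp
  have [measurable]: "f ` A \<in> sets borel" using image_borel[OF A] .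
  have "emeasure (distr ?\<mu> borel f) B = (\<integral>\<^sup>+x\<in>A \<inter> f -` B. ennreal ((norm (deriv f x))\<^sup>2) \<partial>lborel)"
    by (auto simp: emeasure_distr emeasure_density measurable_sets_borel[of f borel B]
        intro!: nn_integral_cong split: split_indicator)
  also have "\<dots> = emeasure lborel (f ` (A \<inter> f -` B))"
    using A(2) by (intro emeasure_holomorphic_image[symmetric] f B image_borel inj_on_subset[OF U(2)]
        bounded_subset[OF U(3)]) auto
  also have "f ` (A \<inter> f -` B) = f ` A \<inter> B" by auto
  also have "emeasure lborel (f ` A \<inter> B) = emeasure (density lborel (indicator (f ` A))) B"
    by (simp add: emeasure_density indicator_inter_arith[symmetric])
  finally show "emeasure (distr ?\<mu> borel f) B = emeasure (density lborel (indicator (f ` A))) B" .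
qed simp

lemma area_formula_injective:
  fixes g :: "complex \<Rightarrow> ennreal"
  assumes f: "f holomorphic_on UNIV" and U: "open U" "inj_on f U" "bounded (f ` U)"
    and A: "A \<in> sets borel" "A \<subseteq> U" and g [measurable]: "g \<in> borel_measurable borel"
  shows "(\<lambda>y. \<Sum>x\<in>{x\<in>A. f x = y}. g x) \<in> borel_measurable lborel" (is ?measurable)
    and "(\<integral>\<^sup>+y. (\<Sum>x\<in>{x\<in>A. f x = y}. g x) \<partial>lborel)
      = (\<integral>\<^sup>+x\<in>A. g x * ennreal ((norm (deriv f x))\<^sup>2) \<partial>lborel)" (is ?area)
proof -
  note [measurable] = borel_measurable_holomorphic[OF f] A(1)
  have f_U: "f holomorphic_on U" using f by (rule holomorphic_on_subset) simp
  note [measurable] = sets_borel_injective_holomorphic_image[OF f_U U(1,2) A]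
  obtain \<psi> where [measurable]: "\<psi> \<in> borel_measurable borel" and \<psi>: "\<And>x. x \<in> U \<Longrightarrow> \<psi> (f x) = x"
    using injective_holomorphic_borel_inverse[OF f_U U(1,2)] by blast
  have fibre: "(\<Sum>x\<in>{x\<in>A. f x = y}. g x) = g (\<psi> y) * indicator (f ` A) y" for y
  proof (cases "y \<in> f ` A")
    case True
    then obtain x where x: "x \<in> A" "y = f x" by auto
    then have "{x\<in>A. f x = y} = {x}" using U(2) A(2) by (auto dest: inj_onD)
    then show ?thesis using x \<psi> A(2) by auto
  next
    case False
    then have "{x\<in>A. f x = y} = {}" by auto
    then have "(\<Sum>x\<in>{x\<in>A. f x = y}. g x) = 0" by (metis sum.empty)
    then show ?thesis using False by simp
  qed
  show ?measurable unfolding fibre by measurable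
  let ?\<mu> = "density lborel (\<lambda>x. ennreal ((norm (deriv f x))\<^sup>2) * indicator A x)"
  have "(\<integral>\<^sup>+y. (\<Sum>x\<in>{x\<in>A. f x = y}. g x) \<partial>lborel) = (\<integral>\<^sup>+y. g (\<psi> y) \<partial>density lborel (indicator (f ` A)))"
    unfolding fibre by (simp add: nn_integral_density mult.commute)
  also have "\<dots> = (\<integral>\<^sup>+x. g (\<psi> (f x)) \<partial>?\<mu>)"
    unfolding distr_density_injective_holomorphic[OF f U A, symmetric] by (rule nn_integral_distr) measurable
  also have "\<dots> = (\<integral>\<^sup>+x\<in>A. g x * ennreal ((norm (deriv f x))\<^sup>2) \<partial>lborel)"
    using A(2) by (auto simp: nn_integral_density \<psi> mult_ac intro!: nn_integral_cong split: split_indicator)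
  finally show ?area .
qed

lemma locally_injective_partition:
  assumes f: "f holomorphic_on UNIV" and S: "open S" "\<And>x. x \<in> S \<Longrightarrow> deriv f x \<noteq> 0"
  obtains U A :: "nat \<Rightarrow> complex set" where
    "\<And>n. open (U n)" "\<And>n. inj_on f (U n)" "\<And>n. bounded (f ` U n)"
    "\<And>n. A n \<in> sets borel" "\<And>n. A n \<subseteq> U n" "disjoint_family A" "(\<Union>n. A n) = S"
proof -
  define \<F> where "\<F> = {U. open U \<and> U \<subseteq> S \<and> inj_on f U \<and> bounded (f ` U)}"
  have "\<exists>U\<in>\<F>. x \<in> U" if x: "x \<in> S" for x
  proof -
    obtain r where r: "r > 0" "inj_on f (ball x r)"
      using has_complex_derivative_locally_injective[OF f UNIV_I open_UNIV S(2)[OF x]] by auto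
    let ?U = "S \<inter> ball x r"
    have "continuous_on (cball x r) f"
      using f by (intro holomorphic_on_imp_continuous_on) (rule holomorphic_on_subset, auto)
    then have "bounded (f ` cball x r)"
      by (intro compact_imp_bounded compact_continuous_image) auto
    then have "bounded (f ` ?U)" by (rule bounded_subset) auto
    moreover have "inj_on f ?U" using r(2) by (rule inj_on_subset) auto
    ultimately have "?U \<in> \<F>" using S(1) by (auto simp: \<F>_def)
    then show ?thesis using x r(1) by (intro bexI[of _ ?U]) auto
  qed
  then have "\<Union>\<F> = S" by (auto simp: \<F>_def)
  obtain \<F>' where \<F>': "\<F>' \<subseteq> \<F>" "countable \<F>'" "\<Union>\<F>' = \<Union>\<F>"
    using Lindelof[of \<F>] by (auto simp: \<F>_def)
  define U where "U = from_nat_into (insert {} \<F>')"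
  have range_U: "range U = insert {} \<F>'"
    unfolding U_def using \<F>'(2) by (intro range_from_nat_into) auto
  have U: "open (U n)" "inj_on f (U n)" "bounded (f ` U n)" for n
    using range_U \<F>'(1) rangeI[of U n] by (auto simp: \<F>_def)
  show ?thesis
  proof (rule that[of U "disjointed U"])
    show "disjointed U n \<in> sets borel" for n
      using sets.range_disjointed_sets[of U borel] U(1) by (auto intro: borel_open)
    show "(\<Union>n. disjointed U n) = S"
      using range_U \<F>'(3) \<open>\<Union>\<F> = S\<close> by (simp add: UN_disjointed_eq)
  qed (use U in \<open>auto intro: disjoint_family_disjointed subsetD[OF disjointed_subset]\<close>)
qed

theorem area_formula_holomorphic:
  fixes g :: "complex \<Rightarrow> ennreal"
  assumes f: "f holomorphic_on UNIV" and S: "open S" "\<And>x. x \<in> S \<Longrightarrow> deriv f x \<noteq> 0"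
    and finite: "\<And>y. finite {x\<in>S. f x = y}" and g [measurable]: "g \<in> borel_measurable borel"
  shows "(\<integral>\<^sup>+y. (\<Sum>x\<in>{x\<in>S. f x = y}. g x) \<partial>lborel) = (\<integral>\<^sup>+x\<in>S. g x * ennreal ((norm (deriv f x))\<^sup>2) \<partial>lborel)"
proof -
  obtain U A :: "nat \<Rightarrow> complex set" where
    U: "\<And>n. open (U n)" "\<And>n. inj_on f (U n)" "\<And>n. bounded (f ` U n)" and
    A: "\<And>n. A n \<in> sets borel" "\<And>n. A n \<subseteq> U n" "disjoint_family A" "(\<Union>n. A n) = S"
    using locally_injective_partition[OF f S] by blast
  note area = area_formula_injective[OF f U A(1,2) g]
  note [measurable] = borel_measurable_holomorphic[OF f]
  have "(\<Sum>x\<in>{x\<in>S. f x = y}. g x) = (\<Sum>n. \<Sum>x\<in>{x\<in>A n. f x = y}. g x)" for y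
  proof -
    have "(\<Sum>x\<in>{x\<in>S. f x = y}. g x) = (\<Sum>x\<in>{x\<in>S. f x = y}. \<Sum>n. indicator (A n) x * g x)"
      using suminf_indicator[OF A(3)] A(4) by (intro sum.cong) (auto simp: ennreal_suminf_multc)
    also have "\<dots> = (\<Sum>n. \<Sum>x\<in>{x\<in>S. f x = y}. indicator (A n) x * g x)"
      by (rule suminf_sum[symmetric]) simp
    also have "\<dots> = (\<Sum>n. \<Sum>x\<in>{x\<in>A n. f x = y}. g x)"
      using A(4) finite by (intro suminf_cong sum.mono_neutral_cong_right) (auto simp: indicator_def)
    finally show ?thesis .
  qed
  then have "(\<integral>\<^sup>+y. (\<Sum>x\<in>{x\<in>S. f x = y}. g x) \<partial>lborel) = (\<Sum>n. \<integral>\<^sup>+y. (\<Sum>x\<in>{x\<in>A n. f x = y}. g x) \<partial>lborel)"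
    by (simp only: nn_integral_suminf[OF area(1)])
  also have "\<dots> = (\<Sum>n. \<integral>\<^sup>+x\<in>A n. g x * ennreal ((norm (deriv f x))\<^sup>2) \<partial>lborel)"
    by (simp only: area(2))
  also have "\<dots> = (\<integral>\<^sup>+x\<in>(\<Union>n. A n). g x * ennreal ((norm (deriv f x))\<^sup>2) \<partial>lborel)"
    using A(1,3) by (intro nn_integral_disjoint_family[symmetric]) auto
  finally show ?thesis by (simp only: A(4))
qed

lemma holomorphic_on_poly: "poly p holomorphic_on S" for p :: "complex poly"
  unfolding holomorphic_on_def
  by (metis field_differentiable_at_within field_differentiable_def poly_DERIV)

lemma deriv_poly: "deriv (poly p) = poly (pderiv p)" for p :: "'a::real_normed_field poly"
  by (rule ext) (rule DERIV_imp_deriv[OF poly_DERIV])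

lemma finite_poly_fibre:
  fixes p :: "'a::idom poly"
  assumes "degree p > 0"
  shows "finite {x. poly p x = y}"
proof -
  have "degree (p - [:y:]) = degree p"
    unfolding diff_conv_add_uminus using assms by (intro degree_add_eq_left) simp
  then have "p - [:y:] \<noteq> 0" using assms by auto
  from poly_roots_finite[OF this] show ?thesis by simp
qed

definition transfer_operator :: "complex poly \<Rightarrow> (complex \<Rightarrow> complex) \<Rightarrow> complex \<Rightarrow> complex" where
  "transfer_operator f H y = (\<Sum>x | poly f x = y. H x / (poly (pderiv f) x)\<^sup>2)"

lemma nn_integral_transfer_operator_le:
  assumes deg: "degree f > 0" and H [measurable]: "H \<in> borel_measurable borel"
    and V [measurable]: "V \<in> sets borel"
  shows "(\<integral>\<^sup>+y\<in>V. ennreal (norm (transfer_operator f H y)) \<partial>lborel)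
    \<le> (\<integral>\<^sup>+x\<in>poly f -` V. ennreal (norm (H x)) \<partial>lborel)"
proof -
  let ?S = "{x. poly (pderiv f) x \<noteq> 0}"
  let ?h = "\<lambda>x. norm (H x) / (norm (poly (pderiv f) x))\<^sup>2"
  let ?g = "\<lambda>x. ennreal (?h x) * indicator (poly f -` V) x"
  have [measurable]: "poly p \<in> borel_measurable borel" for p :: "complex poly"
    by (intro borel_measurable_continuous_onI continuous_intros)
  have [measurable]: "poly f -` V \<in> sets borel" by (rule measurable_sets_borel[OF _ V]) measurable
  have finite: "finite {x\<in>?S. poly f x = y}" for y
    using finite_poly_fibre[OF deg, of y] by (rule rev_finite_subset) auto
  have "ennreal (norm (transfer_operator f H y)) * indicator V y \<le> (\<Sum>x\<in>{x\<in>?S. poly f x = y}. ?g x)" for y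
  proof (cases "y \<in> V")
    case True
    have "transfer_operator f H y = (\<Sum>x\<in>{x\<in>?S. poly f x = y}. H x / (poly (pderiv f) x)\<^sup>2)"
      unfolding transfer_operator_def using finite_poly_fibre[OF deg] by (intro sum.mono_neutral_right) auto
    then have "norm (transfer_operator f H y) \<le> (\<Sum>x\<in>{x\<in>?S. poly f x = y}. ?h x)"
      by (auto simp: norm_divide norm_power intro!: order_trans[OF norm_sum])
    then have "ennreal (norm (transfer_operator f H y)) \<le> (\<Sum>x\<in>{x\<in>?S. poly f x = y}. ennreal (?h x))"
      by (simp add: ennreal_leI)
    also have "\<dots> = (\<Sum>x\<in>{x\<in>?S. poly f x = y}. ?g x)"
      using True by (intro sum.cong) auto
    finally show ?thesis using True by simp
  qed simp
  then have "(\<integral>\<^sup>+y\<in>V. ennreal (norm (transfer_operator f H y)) \<partial>lborel)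
      \<le> (\<integral>\<^sup>+y. (\<Sum>x\<in>{x\<in>?S. poly f x = y}. ?g x) \<partial>lborel)"
    by (rule nn_integral_mono)
  also have "\<dots> = (\<integral>\<^sup>+x\<in>?S. ?g x * ennreal ((norm (deriv (poly f) x))\<^sup>2) \<partial>lborel)"
    using finite
    by (intro area_formula_holomorphic holomorphic_on_poly)
       (auto simp: deriv_poly intro!: open_Collect_neq continuous_intros)
  also have "\<dots> \<le> (\<integral>\<^sup>+x\<in>poly f -` V. ennreal (norm (H x)) \<partial>lborel)"
    by (intro nn_integral_mono)
       (auto simp: deriv_poly ennreal_mult''[symmetric] split: split_indicator)
  finally show ?thesis .
qed

theorem transfer_operator_fixed_point_zero:
  assumes deg: "degree f > 0" and H [measurable]: "H \<in> borel_measurable borel"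
    and V [measurable]: "V \<in> sets borel"
    and invariant: "poly f -` V \<subseteq> V" and finite: "(\<integral>\<^sup>+y\<in>V. ennreal (norm (H y)) \<partial>lborel) < \<infinity>"
    and fixed: "AE y in lborel. H y = transfer_operator f H y"
  shows "AE y in lborel. y \<in> V - poly f -` V \<longrightarrow> H y = 0"
proof -
  let ?I = "\<lambda>A. \<integral>\<^sup>+y\<in>A. ennreal (norm (H y)) \<partial>lborel"
  have [measurable]: "poly f -` V \<in> sets borel"
    by (rule measurable_sets_borel[OF _ V]) (intro borel_measurable_continuous_onI continuous_intros)
  have "?I V = (\<integral>\<^sup>+y\<in>V. ennreal (norm (transfer_operator f H y)) \<partial>lborel)"
    using fixed by (intro nn_integral_cong_AE) auto
  also have "\<dots> \<le> ?I (poly f -` V)" by (rule nn_integral_transfer_operator_le[OF deg H V])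
  finally have integral_le: "?I V \<le> ?I (poly f -` V)" .
  have split: "?I V = ?I (poly f -` V) + ?I (V - poly f -` V)"
    using invariant by (subst nn_integral_disjoint_pair[symmetric]) (auto simp: Un_absorb1)
  then have "?I (poly f -` V) + ?I (V - poly f -` V) \<le> ?I (poly f -` V) + 0" using integral_le by simp
  moreover have "?I (poly f -` V) < \<infinity>" using split finite by (simp add: le_iff_add order.strict_trans1)
  ultimately have "?I (V - poly f -` V) = 0" by (auto simp: ennreal_add_left_cancel_le)
  then have "AE y in lborel. ennreal (norm (H y)) * indicator (V - poly f -` V) y = 0"
    by (subst (asm) nn_integral_0_iff_AE) auto
  then show ?thesis by (rule AE_mp) (auto simp: indicator_def split: if_splits)
qed

section \<open>Iteration and the filled Julia set\<close>

lemma holomorphic_on_funpow: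
  assumes "f holomorphic_on UNIV"
  shows "(f ^^ n) holomorphic_on UNIV"
proof (induction n)
  case 0
  show ?case by (simp add: id_def)
next
  case (Suc n)
  then show ?case unfolding funpow.simps using assms by (rule holomorphic_on_compose_gen) simp
qed

lemma deriv_funpow_add:
  assumes "f holomorphic_on UNIV"
  shows "deriv (f ^^ (m + n)) x = deriv (f ^^ m) ((f ^^ n) x) * deriv (f ^^ n) x"
proof -
  have "(f ^^ k) field_differentiable at z" for k z
    using holomorphic_on_funpow[OF assms, of k] by (simp add: holomorphic_on_def)
  then show ?thesis by (simp add: funpow_add deriv_chain)
qed

lemma deriv_poly_funpow_Suc:
  "deriv (poly f ^^ Suc n) x = poly (pderiv f) ((poly f ^^ n) x) * deriv (poly f ^^ n) x"
  for f :: "complex poly"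
  using deriv_funpow_add[OF holomorphic_on_poly, of 1 n f x] by (simp add: deriv_poly)

lemma deriv_funpow_0 [simp]: "deriv (f ^^ 0) x = 1"
  by (simp add: id_def)

definition filled_julia :: "complex poly \<Rightarrow> complex set" where
  "filled_julia f = {z. bounded (range (\<lambda>n. (poly f ^^ n) z))}"

locale escape_radius =
  fixes f :: "complex poly" and R :: real
  assumes degree_ge_2: "degree f \<ge> 2" and R_nonneg: "R \<ge> 0"
    and escape: "\<And>z. norm z > R \<Longrightarrow> 2 * norm z \<le> norm (poly f z)"
    and escape_deriv: "\<And>z. norm z > R \<Longrightarrow> (norm z)\<^sup>2 * norm (poly (pderiv f) z) \<le> (norm (poly f z))\<^sup>2"

lemma escape_radius_exists:
  assumes deg: "degree f \<ge> 2"
  obtains R where "escape_radius f R"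
proof -
  have "((\<lambda>z. poly [:0, 2:] z / poly f z) \<longlongrightarrow> 0) at_infinity"
    using deg by (intro poly_divide_tendsto_0_at_infinity) simp
  from order_tendstoD(2)[OF tendsto_norm[OF this], of 1]
  have ratio: "\<forall>\<^sub>F z in at_infinity. norm (poly [:0, 2:] z / poly f z) < 1" by simp
  have "f \<noteq> 0" "pderiv f \<noteq> 0" using deg pderiv_eq_0_iff[of f] by auto
  then have "degree ([:0, 0, 1:] * pderiv f) = degree f + 1" "degree (f * f) = 2 * degree f"
    using deg by (simp_all add: degree_mult_eq degree_pderiv)
  then have "((\<lambda>z. poly ([:0, 0, 1:] * pderiv f) z / poly (f * f) z) \<longlongrightarrow> 0) at_infinity"
    using deg by (intro poly_divide_tendsto_0_at_infinity) simp
  from order_tendstoD(2)[OF tendsto_norm[OF this], of 1]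
  have ratio_deriv: "\<forall>\<^sub>F z in at_infinity. norm (poly ([:0, 0, 1:] * pderiv f) z / poly (f * f) z) < 1"
    by simp
  have nonzero: "\<forall>\<^sub>F z in at_infinity. poly f z \<noteq> 0"
    using deg by (intro filterlim_at_infinity_imp_eventually_ne filterlim_poly_at_infinity) simp
  from ratio ratio_deriv nonzero
  have "\<forall>\<^sub>F z in at_infinity. 2 * norm z \<le> norm (poly f z)
      \<and> (norm z)\<^sup>2 * norm (poly (pderiv f) z) \<le> (norm (poly f z))\<^sup>2"
    by eventually_elim (auto simp: norm_divide norm_mult divide_less_eq power2_eq_square mult_ac)
  then obtain R where R: "\<And>z. norm z \<ge> R \<Longrightarrow> 2 * norm z \<le> norm (poly f z)
      \<and> (norm z)\<^sup>2 * norm (poly (pderiv f) z) \<le> (norm (poly f z))\<^sup>2"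
    unfolding eventually_at_infinity by blast
  have "escape_radius f \<bar>R\<bar>" by unfold_locales (use deg R in auto)
  then show ?thesis by (rule that)
qed

context escape_radius
begin

lemma iterate_escape: "norm z > R \<Longrightarrow> 2 ^ n * norm z \<le> norm ((poly f ^^ n) z) \<and> R < norm ((poly f ^^ n) z)"
proof (induction n)
  case (Suc n)
  then have IH: "2 ^ n * norm z \<le> norm ((poly f ^^ n) z)" "R < norm ((poly f ^^ n) z)" by auto
  then show ?case using escape[OF IH(2)] R_nonneg by auto
qed simp

lemma filled_julia_eq: "filled_julia f = {z. \<forall>n. norm ((poly f ^^ n) z) \<le> R}"
proof (intro equalityI subsetI CollectI allI)
  fix z n assume "z \<in> filled_julia f"
  then obtain B where B: "\<And>n. norm ((poly f ^^ n) z) \<le> B"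
    by (auto simp: filled_julia_def bounded_iff)
  show "norm ((poly f ^^ n) z) \<le> R"
  proof (rule ccontr)
    let ?u = "(poly f ^^ n) z"
    assume "\<not> norm ?u \<le> R"
    then have u: "norm ?u > R" by simp
    then have "norm ?u > 0" using R_nonneg by linarith
    then obtain m where "B / norm ?u < 2 ^ m" using real_arch_pow[of 2 "B / norm ?u"] by auto
    then have "B < 2 ^ m * norm ?u" using \<open>norm ?u > 0\<close> by (simp add: divide_less_eq)
    also have "\<dots> \<le> norm ((poly f ^^ (m + n)) z)" using iterate_escape[OF u, of m] by (simp add: funpow_add)
    finally show False using B[of "m + n"] by simp
  qed
qed (auto simp: filled_julia_def bounded_iff)

lemma norm_le_if_filled: "z \<in> filled_julia f \<Longrightarrow> norm z \<le> R"
  unfolding filled_julia_eq by (metis (mono_tags) funpow_0 mem_Collect_eq)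

lemma compact_filled_julia: "compact (filled_julia f)"
proof -
  have "continuous_on UNIV (poly f ^^ n)" for n
    by (intro holomorphic_on_imp_continuous_on holomorphic_on_funpow holomorphic_on_poly)
  then have "closed {z. \<forall>n. norm ((poly f ^^ n) z) \<le> R}"
    by (intro closed_Collect_all closed_Collect_le continuous_intros)
  moreover have "bounded (filled_julia f)" using norm_le_if_filled bounded_iff by blast
  ultimately show ?thesis by (simp add: compact_eq_bounded_closed filled_julia_eq)
qed

text \<open>On a bounded component of the complement the maximum principle would bound every iterate by \<open>R\<close>.\<close>

lemma connected_compl_filled_julia: "connected (- filled_julia f)"
proof (rule ccontr)
  assume "\<not> connected (- filled_julia f)"
  moreover have "bounded (- (- filled_julia f))" using compact_filled_julia by (simp add: compact_imp_bounded)
  ultimately obtain C where C: "C \<in> components (- filled_julia f)" "bounded C"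
    using cobounded_has_bounded_component[of "- filled_julia f"] by auto
  then obtain z where z: "z \<in> C" "z \<notin> filled_julia f"
    using in_components_nonempty in_components_subset by blast
  have frontier: "frontier C \<subseteq> filled_julia f"
    using C(1) compact_filled_julia by (intro frontier_of_components_closed_complement compact_imp_closed)
  have "norm ((poly f ^^ n) z) \<le> R" for n
  proof (rule maximum_modulus_frontier[OF _ _ C(2) _ z(1)])
    have hol: "(poly f ^^ n) holomorphic_on UNIV" by (intro holomorphic_on_funpow holomorphic_on_poly)
    show "(poly f ^^ n) holomorphic_on interior C" using hol by (rule holomorphic_on_subset) simp
    show "continuous_on (closure C) (poly f ^^ n)"
      using holomorphic_on_imp_continuous_on[OF hol] by (rule continuous_on_subset) simp
    show "norm ((poly f ^^ n) \<xi>) \<le> R" if "\<xi> \<in> frontier C" for \<xi>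
      using frontier that by (auto simp: filled_julia_eq)
  qed
  then show False using z(2) by (simp add: filled_julia_eq)
qed

lemma expanding_point_in_closure_complement:
  assumes expanding: "\<And>B. \<exists>n. norm (deriv (poly f ^^ n) z) > B"
  shows "z \<in> closure (- filled_julia f)"
proof (rule ccontr)
  assume "z \<notin> closure (- filled_julia f)"
  then have "z \<in> interior (filled_julia f)" by (simp add: interior_closure)
  then obtain e where e: "e > 0" "cball z e \<subseteq> filled_julia f" by (meson mem_interior_cball)
  obtain n where n: "norm (deriv (poly f ^^ n) z) > R / e" using expanding by blast
  have hol: "(poly f ^^ n) holomorphic_on UNIV" by (intro holomorphic_on_funpow holomorphic_on_poly)
  have "norm ((deriv ^^ 1) (poly f ^^ n) z) \<le> fact 1 * R / e ^ 1"
  proof (rule Cauchy_inequality)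
    show "(poly f ^^ n) holomorphic_on ball z e" using hol by (rule holomorphic_on_subset) simp
    show "continuous_on (cball z e) (poly f ^^ n)"
      using holomorphic_on_imp_continuous_on[OF hol] by (rule continuous_on_subset) simp
    fix x assume "norm (z - x) = e"
    then have "x \<in> filled_julia f" using e by (auto simp: dist_norm)
    then show "norm ((poly f ^^ n) x) \<le> R" by (simp add: filled_julia_eq)
  qed (use e in auto)
  then show False using n by simp
qed

theorem cauchy_transform_fixed_point_zero:
  assumes "disc_complex_measure M a w r"
    and fixed: "AE y in lborel. disc_complex_measure.cauchy_transform M a w y
      = transfer_operator f (disc_complex_measure.cauchy_transform M a w) y"
  shows "\<exists>y. norm y > B \<and> disc_complex_measure.cauchy_transform M a w y = 0"
proof -
  interpret disc_complex_measure M a w r by fact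
  define \<rho> where "\<rho> = 2 * (\<bar>B\<bar> + R + 1)"
  let ?V = "ball 0 \<rho> :: complex set" and ?S = "ball 0 \<rho> - cball 0 (\<rho> / 2) :: complex set"
  have preimage: "poly f -` ?V \<subseteq> cball 0 (\<rho> / 2)"
  proof
    fix x assume "x \<in> poly f -` ?V"
    then have "norm (poly f x) < \<rho>" by simp
    then have "norm x \<le> \<rho> / 2"
      using escape[of x] R_nonneg by (cases "norm x > R") (auto simp: \<rho>_def)
    then show "x \<in> cball 0 (\<rho> / 2)" by simp
  qed
  moreover have "cball 0 (\<rho> / 2) \<subseteq> ?V" using R_nonneg by (auto simp: \<rho>_def)
  ultimately have "AE y in lborel. y \<in> ?V - poly f -` ?V \<longrightarrow> cauchy_transform y = 0"
    using degree_ge_2 fixed nn_integral_cauchy_transform_finite cauchy_transform_measurable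
    by (intro transfer_operator_fixed_point_zero) (auto simp: measurable_lborel1)
  then have zero: "AE y in lborel. y \<in> ?S \<longrightarrow> cauchy_transform y = 0"
    by (rule AE_mp[OF _ AE_I2]) (use preimage in blast)
  have "\<rho> > 0" using R_nonneg by (simp add: \<rho>_def)
  then have "of_real (3 / 4 * \<rho>) \<in> ?S" by (simp add: norm_mult norm_divide)
  moreover have "open ?S" by (intro open_Diff open_ball closed_cball)
  ultimately have "\<not> (AE y in lborel. y \<in> ?S \<longrightarrow> y \<in> {})"
    using mem_closed_if_AE_lebesgue_open[OF _ closed_empty] AE_completion by blast
  then obtain y where y: "y \<in> ?S" "cauchy_transform y = 0"
    using AE_mp[OF zero, of "\<lambda>y. y \<in> ?S \<longrightarrow> y \<in> {}"] by blast
  have "norm y > \<bar>B\<bar> + R + 1" using y(1) by (simp add: \<rho>_def)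
  then have "norm y > B" using R_nonneg by linarith
  then show ?thesis using y(2) by blast
qed

end

section \<open>The dual basis and the transfer kernel\<close>

lemma prod_linear_powers_dvd:
  fixes c :: "'i \<Rightarrow> 'a::field"
  assumes "finite I" "inj_on c I" "\<And>i. i \<in> I \<Longrightarrow> [:- c i, 1:] ^ ms i dvd P"
  shows "(\<Prod>i\<in>I. [:- c i, 1:] ^ ms i) dvd P"
proof (cases "P = 0")
  case False
  show ?thesis using assms
  proof (induction I rule: finite_induct)
    case (insert j I)
    define A where "A = (\<Prod>i\<in>I. [:- c i, 1:] ^ ms i)"
    have "A dvd P" unfolding A_def using insert by auto
    then obtain S where S: "P = A * S" by (rule dvdE)
    have "poly A (c j) \<noteq> 0"
      unfolding A_def poly_prod poly_power using insert by (auto simp: prod_zero_iff inj_on_def)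
    then have "order (c j) A = 0" by (simp add: order_0I)
    then have "order (c j) P = order (c j) S" using order_mult[of A S] S False by simp
    moreover have "ms j \<le> order (c j) P" using insert.prems(2)[of j] False order_divides by blast
    ultimately have "[:- c j, 1:] ^ ms j dvd S" using order_divides by metis
    then have "[:- c j, 1:] ^ ms j * A dvd P" unfolding S by (simp add: mult.commute mult_dvd_mono)
    then show ?case using insert by (simp add: A_def)
  qed simp
qed simp

lemma pderiv_dvdI:
  assumes "has_critical_points f c ms" "degree f > 0" "\<And>i. [:- c i, 1:] ^ ms i dvd P"
  shows "pderiv f dvd P"
proof -
  have "(\<Prod>i\<in>UNIV. [:- c i, 1:] ^ ms i) dvd P"
    using assms by (intro prod_linear_powers_dvd) (auto simp: has_critical_points_def)
  then show ?thesis using assms by (simp add: has_critical_points_def smult_dvd_iff)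
qed

lemma poly_eq_if_congruent_at_critical_points:
  assumes crit: "has_critical_points f c ms" and degree: "degree p < degree f - 1" "degree q < degree f - 1"
    and congruent: "\<And>i. [:- c i, 1:] ^ ms i dvd p - q"
  shows "p = q"
proof (rule ccontr)
  assume "p \<noteq> q"
  moreover have "pderiv f dvd p - q" using degree by (intro pderiv_dvdI[OF crit _ congruent]) simp
  ultimately have "degree f - 1 \<le> degree (p - q)"
    using dvd_imp_degree_le[of "pderiv f" "p - q"] by (simp add: degree_pderiv)
  moreover have "degree (p - q) < degree f - 1" using degree by (rule degree_diff_less)
  ultimately show False by simp
qed

lemma linear_power_dvd_pderiv:
  assumes "has_critical_points f c ms"
  shows "[:- c k, 1:] ^ ms k dvd pderiv f"
proof -
  have "[:- c k, 1:] ^ ms k dvd (\<Prod>i\<in>UNIV. [:- c i, 1:] ^ ms i)" by (rule dvd_prodI) auto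
  then show ?thesis using assms by (simp add: has_critical_points_def dvd_smult)
qed

lemma poly_pderiv_critical_point:
  assumes "has_critical_points f c ms"
  shows "poly (pderiv f) (c k) = 0"
proof -
  have "[:- c k, 1:] dvd [:- c k, 1:] ^ ms k"
    using assms by (intro dvd_power) (auto simp: has_critical_points_def Suc_le_eq)
  also have "\<dots> dvd pderiv f" using assms by (rule linear_power_dvd_pderiv)
  finally show ?thesis by (simp add: poly_eq_0_iff_dvd)
qed

lemma linear_power_dvd_if_dvd_pderiv:
  fixes p :: "'a::{idom, semiring_char_0} poly"
  assumes "[:- a, 1:] ^ m dvd pderiv p" "poly p a = 0"
  shows "[:- a, 1:] ^ Suc m dvd p"
proof (cases "pderiv p = 0")
  case True
  then obtain b where "p = [:b:]" using pderiv_iszero by blast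
  then show ?thesis using assms(2) by simp
next
  case False
  then have p: "p \<noteq> 0" by auto
  then have "order a p = Suc (order a (pderiv p))" using assms(2) by (rule order_pderiv)
  moreover have "m \<le> order a (pderiv p)" using assms(1) False order_divides by blast
  ultimately show ?thesis using order_divides[of a "Suc m" p] by simp
qed

lemma card_simple_roots:
  fixes p :: "complex poly"
  assumes "p \<noteq> 0" "\<And>x. poly p x = 0 \<Longrightarrow> poly (pderiv p) x \<noteq> 0"
  shows "card {x. poly p x = 0} = degree p"
proof -
  have "rsquarefree p" unfolding rsquarefree_roots using assms(2) by auto
  then have "smult (lead_coeff p) (\<Prod>z | poly p z = 0. [:-z, 1:]) = p"
    by (rule complex_poly_decompose_rsquarefree)
  then have "degree p = degree (\<Prod>z | poly p z = 0. [:-z, 1:])"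
    using assms(1) by (metis degree_smult_eq leading_coeff_0_iff)
  also have "\<dots> = (\<Sum>z | poly p z = 0. 1)"
    by (subst degree_prod_eq_sum_degree) auto
  finally show ?thesis by simp
qed

lemma pderiv_eq_synthetic_div:
  fixes p :: "'a::idom poly"
  assumes "poly p x = 0"
  shows "p = [:- x, 1:] * synthetic_div p x" "poly (pderiv p) x = poly (synthetic_div p x) x"
proof -
  show p: "p = [:- x, 1:] * synthetic_div p x"
    using synthetic_div_correct'[of x p] assms by simp
  have "pderiv p = [:- x, 1:] * pderiv (synthetic_div p x) + synthetic_div p x * pderiv [:- x, 1:]"
    by (subst p) (rule pderiv_mult)
  then show "poly (pderiv p) x = poly (synthetic_div p x) x" by (simp add: pderiv_pCons)
qed

lemma poly_eq_if_eq_on_card: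
  fixes p q :: "'a::idom poly"
  assumes "degree p < card X" "degree q < card X" "\<And>x. x \<in> X \<Longrightarrow> poly p x = poly q x"
  shows "p = q"
proof (rule ccontr)
  assume "p \<noteq> q"
  then have nonzero: "p - q \<noteq> 0" by simp
  have "card X \<le> card {x. poly (p - q) x = 0}"
    using assms(3) by (intro card_mono poly_roots_finite nonzero) auto
  also have "\<dots> \<le> degree (p - q)" using nonzero by (rule card_poly_roots_bound)
  finally show False using assms(1,2) degree_diff_less[of p "card X" q] by simp
qed

lemma lagrange_interpolation:
  fixes p g :: "'a::field poly"
  assumes deg: "degree g < degree p" and split: "card {x. poly p x = 0} = degree p"
    and simple: "\<And>x. poly p x = 0 \<Longrightarrow> poly (pderiv p) x \<noteq> 0"
  shows "g = (\<Sum>x | poly p x = 0. smult (poly g x / poly (pderiv p) x) (synthetic_div p x))" (is "g = ?G")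
proof (rule poly_eq_if_eq_on_card)
  let ?X = "{x. poly p x = 0}"
  have finite: "finite ?X" using deg split by (intro card_ge_0_finite) simp
  show "degree g < card ?X" using deg split by simp
  show "degree ?G < card ?X"
    unfolding split using deg
    by (intro degree_sum_less) (auto simp: degree_synthetic_div intro: le_less_trans[OF degree_smult_le])
  fix x assume "x \<in> ?X"
  then have x: "poly p x = 0" by simp
  have other: "poly (synthetic_div p x') x = 0" if "poly p x' = 0" "x' \<noteq> x" for x'
  proof -
    have "(x - x') * poly (synthetic_div p x') x = poly p x"
      using arg_cong[OF pderiv_eq_synthetic_div(1)[OF that(1)], of "\<lambda>q. poly q x"]
      by (simp add: algebra_simps)
    then show ?thesis using x that(2) by simp
  qed
  have "poly ?G x = (\<Sum>x' | poly p x' = 0. poly g x' / poly (pderiv p) x' * poly (synthetic_div p x') x)"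
    by (simp add: poly_sum)
  also have "\<dots> = (\<Sum>x'\<in>{x}. poly g x' / poly (pderiv p) x' * poly (synthetic_div p x') x)"
    using x finite other by (intro sum.mono_neutral_right) auto
  finally show "poly g x = poly ?G x" using simple[OF x] pderiv_eq_synthetic_div(2)[OF x] by simp
qed

lemma lagrange_interpolation_eval:
  fixes p g :: "'a::field poly"
  assumes "degree g < degree p" "card {x. poly p x = 0} = degree p"
    and "\<And>x. poly p x = 0 \<Longrightarrow> poly (pderiv p) x \<noteq> 0" and w: "poly p w \<noteq> 0"
  shows "poly g w = (\<Sum>x | poly p x = 0. poly g x * poly p w / (poly (pderiv p) x * (w - x)))"
proof -
  have "poly g w = (\<Sum>x | poly p x = 0. poly g x / poly (pderiv p) x * poly (synthetic_div p x) w)"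
    using arg_cong[OF lagrange_interpolation[OF assms(1-3)], of "\<lambda>q. poly q w"] by (simp add: poly_sum)
  also have "\<dots> = (\<Sum>x | poly p x = 0. poly g x * poly p w / (poly (pderiv p) x * (w - x)))"
  proof (rule sum.cong[OF refl])
    fix x assume "x \<in> {x. poly p x = 0}"
    then have x: "poly p x = 0" by simp
    have "poly p w = (w - x) * poly (synthetic_div p x) w"
      using arg_cong[OF pderiv_eq_synthetic_div(1)[OF x], of "\<lambda>q. poly q w"] by (simp add: algebra_simps)
    moreover have "w - x \<noteq> 0" using w x by auto
    ultimately show "poly g x / poly (pderiv p) x * poly (synthetic_div p x) w
        = poly g x * poly p w / (poly (pderiv p) x * (w - x))"
      by simp
  qed
  finally show ?thesis .
qed

lemma transfer_operator_cauchy_kernel_eq_inverse: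
  assumes g: "degree g < degree f" and inverse: "\<And>x. poly f x = y \<Longrightarrow> poly (pderiv f) x * poly g x = 1"
    and w: "poly f w \<noteq> y"
  shows "(y - poly f w) * transfer_operator f (\<lambda>x. 1 / (x - w)) y = poly g w"
proof -
  define p where "p = f - [:y:]"
  have p: "pderiv p = pderiv f" "poly p u = poly f u - y" for u
    by (auto simp: p_def pderiv_diff pderiv_pCons)
  have degree_p: "degree p = degree f"
    unfolding p_def diff_conv_add_uminus using g by (intro degree_add_eq_left) simp
  have regular: "poly (pderiv f) x \<noteq> 0" if "poly f x = y" for x using inverse[OF that] by auto
  have "card {x. poly p x = 0} = degree p"
    using degree_p g regular by (intro card_simple_roots) (auto simp: p)
  then have "poly g w = (\<Sum>x | poly p x = 0. poly g x * poly p w / (poly (pderiv p) x * (w - x)))"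
    using g degree_p regular w by (intro lagrange_interpolation_eval) (auto simp: p)
  also have "\<dots> = (\<Sum>x | poly f x = y. (y - poly f w) * (1 / (x - w) / (poly (pderiv f) x)\<^sup>2))"
  proof (rule sum.cong)
    fix x assume "x \<in> {x. poly f x = y}"
    then have x: "poly f x = y" by simp
    then have "poly g x = 1 / poly (pderiv f) x"
      using inverse[OF x] regular[OF x] by (simp add: eq_divide_eq mult.commute)
    moreover have "1 / D * u / (D * - E) = - u * (1 / E / D\<^sup>2)" for D E u :: complex
      by (simp add: power2_eq_square)
    then have "1 / D * (a - y) / (D * - (x - w)) = - (a - y) * (1 / (x - w) / D\<^sup>2)" for D a .
    ultimately show "poly g x * poly p w / (poly (pderiv p) x * (w - x))
        = (y - poly f w) * (1 / (x - w) / (poly (pderiv f) x)\<^sup>2)"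
      by (simp only: p minus_diff_eq)
  qed (simp add: p)
  finally show ?thesis by (simp only: transfer_operator_def sum_distrib_left)
qed

text \<open>The polynomials \<open>Q k\<close> are the tangent vectors dual to the critical values.\<close>

locale dual_basis =
  fixes f :: "complex poly" and c :: "'p::finite \<Rightarrow> complex" and ms :: "'p \<Rightarrow> nat"
    and Q :: "'p \<Rightarrow> complex poly"
  assumes deg_f: "degree f \<ge> 2" and crit: "has_critical_points f c ms"
    and deg_Q: "\<And>k. degree (Q k) < degree f - 1"
    and dvd_Q: "\<And>i k. [:- c i, 1:] ^ ms i dvd Q k - [:of_bool (i = k):]"
begin

lemma sum_Q: "(\<Sum>k\<in>UNIV. Q k) = 1"
proof (rule poly_eq_if_congruent_at_critical_points[OF crit])
  show "degree (\<Sum>k\<in>UNIV. Q k) < degree f - 1" "degree (1 :: complex poly) < degree f - 1"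
    using deg_Q deg_f by (auto intro: degree_sum_less)
  fix i :: 'p
  have "(\<Sum>k\<in>UNIV. [:of_bool (i = k):]) = (\<Sum>k\<in>UNIV. if i = k then 1 else (0 :: complex poly))"
    by (rule sum.cong) auto
  then have "(\<Sum>k\<in>UNIV. Q k) - 1 = (\<Sum>k\<in>UNIV. Q k - [:of_bool (i = k):])" by (simp add: sum_subtractf)
  then show "[:- c i, 1:] ^ ms i dvd (\<Sum>k\<in>UNIV. Q k) - 1" using dvd_Q by (simp add: dvd_sum)
qed

lemma pderiv_dvd_Q_mult: "pderiv f dvd Q k * (f - [:poly f (c k):])"
proof (rule pderiv_dvdI[OF crit])
  show "degree f > 0" using deg_f by simp
  fix i
  show "[:- c i, 1:] ^ ms i dvd Q k * (f - [:poly f (c k):])"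
  proof (cases "i = k")
    case True
    have "[:- c k, 1:] ^ ms k dvd pderiv (f - [:poly f (c k):])"
      using linear_power_dvd_pderiv[OF crit] by (simp add: pderiv_diff pderiv_pCons)
    then have "[:- c k, 1:] ^ Suc (ms k) dvd f - [:poly f (c k):]"
      by (rule linear_power_dvd_if_dvd_pderiv) simp
    then have "[:- c k, 1:] ^ ms k dvd f - [:poly f (c k):]"
      by (rule dvd_trans[rotated]) (rule le_imp_power_dvd, simp)
    then show ?thesis using True by (simp add: dvd_mult)
  next
    case False
    then show ?thesis using dvd_Q[of i k] by simp
  qed
qed

lemma pderiv_inverse_modulo_fibre:
  assumes y: "\<And>k. y \<noteq> poly f (c k)"
  obtains g where "degree g < degree f"
    "pderiv f * g = 1 + (f - [:y:]) * (\<Sum>k\<in>UNIV. smult (1 / (y - poly f (c k))) (Q k))"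
proof -
  define v where "v k = poly f (c k)" for k
  obtain q where q: "\<And>k. Q k * (f - [:v k:]) = pderiv f * q k"
    using pderiv_dvd_Q_mult unfolding v_def dvd_def by metis
  have pd_nz: "pderiv f \<noteq> 0" using deg_f pderiv_eq_0_iff[of f] by auto
  have deg_q: "degree (q k) < degree f" for k
  proof (cases "q k = 0")
    case False
    have "degree f - 1 + degree (q k) = degree (Q k * (f - [:v k:]))"
      using degree_mult_eq[OF pd_nz False] by (simp add: q degree_pderiv)
    also have "\<dots> \<le> degree (Q k) + degree f"
      by (intro order_trans[OF degree_mult_le] add_left_mono degree_diff_le) auto
    finally show ?thesis using deg_Q[of k] by linarith
  qed (use deg_f in auto)
  define g where "g = (\<Sum>k\<in>UNIV. smult (1 / (y - v k)) (q k))"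
  have "degree g < degree f"
    unfolding g_def using deg_f deg_q
    by (intro degree_sum_less) (auto intro: le_less_trans[OF degree_smult_le])
  moreover have "pderiv f * g = (\<Sum>k\<in>UNIV. smult (1 / (y - v k)) (Q k * (f - [:v k:])))"
    by (simp add: g_def sum_distrib_left q)
  moreover have "smult (1 / (y - v k)) (Q k * (f - [:v k:]))
      = Q k + (f - [:y:]) * smult (1 / (y - v k)) (Q k)" for k
  proof -
    have "f - [:v k:] = (f - [:y:]) + [:y - v k:]" by simp
    moreover have "y - v k \<noteq> 0" using y by (simp add: v_def)
    ultimately show ?thesis by (simp only: distrib_left smult_add_right) (simp add: mult.commute)
  qed
  ultimately show ?thesis
    using that[of g] by (simp add: sum.distrib sum_Q sum_distrib_left v_def)
qed

lemma transfer_operator_cauchy_kernel: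
  assumes y: "\<And>x. poly f x = y \<Longrightarrow> poly (pderiv f) x \<noteq> 0" and w: "poly (pderiv f) w \<noteq> 0" "poly f w \<noteq> y"
  shows "transfer_operator f (\<lambda>x. 1 / (x - w)) y =
    1 / (poly (pderiv f) w * (y - poly f w))
    - (\<Sum>k\<in>UNIV. poly (Q k) w / poly (pderiv f) w * (1 / (y - poly f (c k))))"
proof -
  define T where "T = (\<Sum>k\<in>UNIV. smult (1 / (y - poly f (c k))) (Q k))"
  have "y \<noteq> poly f (c k)" for k using y poly_pderiv_critical_point[OF crit] by auto
  then obtain g where g: "degree g < degree f" "pderiv f * g = 1 + (f - [:y:]) * T"
    unfolding T_def by (rule pderiv_inverse_modulo_fibre)
  have g_eval: "poly (pderiv f) u * poly g u = 1 + (poly f u - y) * poly T u" for u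
    using arg_cong[OF g(2), of "\<lambda>q. poly q u"] by simp
  have g_w: "(y - poly f w) * transfer_operator f (\<lambda>x. 1 / (x - w)) y = poly g w"
    using g(1) g_eval w(2) by (intro transfer_operator_cauchy_kernel_eq_inverse) simp_all
  have "y - poly f w \<noteq> 0" using w by simp
  then have "transfer_operator f (\<lambda>x. 1 / (x - w)) y
      = (1 - (y - poly f w) * poly T w) / (poly (pderiv f) w * (y - poly f w))"
    using g_eval[of w] w unfolding g_w[symmetric]
    by (simp add: eq_divide_eq mult_ac) (simp add: algebra_simps)
  also have "\<dots> = 1 / (poly (pderiv f) w * (y - poly f w)) - poly T w / poly (pderiv f) w"
    using \<open>y - poly f w \<noteq> 0\<close> by (simp add: diff_divide_distrib)
  also have "poly T w / poly (pderiv f) w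
      = (\<Sum>k\<in>UNIV. poly (Q k) w / poly (pderiv f) w * (1 / (y - poly f (c k))))"
    by (simp add: T_def poly_sum sum_divide_distrib mult.commute)
  finally show ?thesis .
qed

end

section \<open>Weakly expanding critical points\<close>

lemma weakly_expanding_deriv_nonzero:
  "weakly_expanding f c \<Longrightarrow> deriv (poly f ^^ n) (poly f c) \<noteq> 0"
  by (simp add: weakly_expanding_def Let_def)

lemma weakly_expanding_weighted_summable:
  assumes "weakly_expanding f c"
  shows "summable (\<lambda>n. (1 + (norm ((poly f ^^ n) (poly f c)))\<^sup>2) / norm (deriv (poly f ^^ n) (poly f c)))"
proof -
  let ?v = "poly f c"
  let ?t = "\<lambda>n. (1 + (norm ((poly f ^^ n) ?v))\<^sup>2) / (1 + (norm ?v)\<^sup>2) * (1 / norm (deriv (poly f ^^ n) ?v))"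
  have "summable ?t" using assms by (simp add: weakly_expanding_def Let_def)
  then have "summable (\<lambda>n. (1 + (norm ?v)\<^sup>2) * ?t n)" by (rule summable_mult)
  moreover have "1 + (norm ?v)\<^sup>2 \<noteq> 0" by (simp add: add_nonneg_eq_0_iff)
  ultimately show ?thesis by simp
qed

lemma weakly_expanding_summable:
  assumes "weakly_expanding f c"
  shows "summable (\<lambda>n. 1 / norm (deriv (poly f ^^ n) (poly f c)))"
  by (rule summable_comparison_test'[OF weakly_expanding_weighted_summable[OF assms]])
     (simp add: divide_right_mono)

lemma (in escape_radius) escaping_square_div_deriv_mono:
  assumes z: "norm z > R" and regular: "\<And>m. deriv (poly f ^^ m) z \<noteq> 0"
  shows "(norm z)\<^sup>2 \<le> (norm ((poly f ^^ m) z))\<^sup>2 / norm (deriv (poly f ^^ m) z)"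
proof (induction m)
  case 0
  show ?case by (simp only: deriv_funpow_0) simp
next
  case (Suc m)
  let ?x = "(poly f ^^ m) z" and ?D = "\<lambda>m. deriv (poly f ^^ m) z"
  have D_Suc: "?D (Suc m) = poly (pderiv f) ?x * ?D m" by (rule deriv_poly_funpow_Suc)
  then have "norm (poly (pderiv f) ?x) > 0" using regular[of "Suc m"] by auto
  then have "(norm ?x)\<^sup>2 \<le> (norm (poly f ?x))\<^sup>2 / norm (poly (pderiv f) ?x)"
    using escape_deriv[OF iterate_escape[OF z, of m, THEN conjunct2]] by (simp add: le_divide_eq)
  then have "(norm ?x)\<^sup>2 / norm (?D m) \<le> (norm (poly f ?x))\<^sup>2 / norm (poly (pderiv f) ?x) / norm (?D m)"
    by (rule divide_right_mono) simp
  then have "(norm ?x)\<^sup>2 / norm (?D m) \<le> (norm ((poly f ^^ Suc m) z))\<^sup>2 / norm (?D (Suc m))"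
    unfolding D_Suc norm_mult by simp
  with Suc.IH show ?case by (rule order_trans)
qed

lemma (in escape_radius) weakly_expanding_imp_filled:
  assumes we: "weakly_expanding f c"
  shows "(poly f ^^ n) (poly f c) \<in> filled_julia f"
proof -
  define x where "x m = (poly f ^^ m) (poly f c)" for m
  define D where "D m = norm (deriv (poly f ^^ m) (poly f c))" for m
  have D: "D m > 0" for m using weakly_expanding_deriv_nonzero[OF we] by (simp add: D_def)
  have "norm (x n) \<le> R" for n
  proof (rule ccontr)
    assume "\<not> norm (x n) \<le> R"
    then have n: "norm (x n) > R" by simp
    have D_add: "D (m + n) = norm (deriv (poly f ^^ m) (x n)) * D n" for m
      by (simp add: D_def x_def deriv_funpow_add[OF holomorphic_on_poly] norm_mult)
    then have "deriv (poly f ^^ m) (x n) \<noteq> 0" for m using D[of "m + n"] by auto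
    then have "(norm (x n))\<^sup>2 \<le> (norm (x (m + n)))\<^sup>2 / norm (deriv (poly f ^^ m) (x n))" for m
      using escaping_square_div_deriv_mono[OF n] by (simp add: x_def funpow_add)
    then have "(norm (x n))\<^sup>2 / D n \<le> (norm (x (m + n)))\<^sup>2 / D (m + n)" for m
      unfolding D_add divide_divide_eq_left[symmetric] using D[of n] by (intro divide_right_mono) auto
    moreover have "(norm (x (m + n)))\<^sup>2 / D (m + n) \<le> (1 + (norm (x (m + n)))\<^sup>2) / D (m + n)" for m
      using D[of "m + n"] by (intro divide_right_mono) auto
    ultimately have lower: "(norm (x n))\<^sup>2 / D n \<le> (1 + (norm (x (m + n)))\<^sup>2) / D (m + n)" for m
      by (rule order_trans)
    have "(\<lambda>m. (1 + (norm (x m))\<^sup>2) / D m) \<longlonglongrightarrow> 0"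
      using weakly_expanding_weighted_summable[OF we] unfolding x_def D_def by (rule summable_LIMSEQ_zero)
    then have "(\<lambda>m. (1 + (norm (x (m + n)))\<^sup>2) / D (m + n)) \<longlonglongrightarrow> 0" by (rule LIMSEQ_ignore_initial_segment)
    then have "(norm (x n))\<^sup>2 / D n \<le> 0" by (rule LIMSEQ_le_const) (use lower in auto)
    moreover have "(norm (x n))\<^sup>2 / D n > 0" using n R_nonneg D[of n] by (intro divide_pos_pos) auto
    ultimately show False by simp
  qed
  then have "norm ((poly f ^^ m) (x n)) \<le> R" for m
    by (metis (mono_tags) comp_apply funpow_add x_def)
  then show ?thesis by (simp add: filled_julia_eq x_def)
qed

lemma (in escape_radius) weakly_expanding_imp_frontier:
  assumes we: "weakly_expanding f c"
  shows "(poly f ^^ n) (poly f c) \<in> closure (- filled_julia f)"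
proof (rule expanding_point_in_closure_complement)
  fix B
  define D where "D m = norm (deriv (poly f ^^ m) (poly f c))" for m
  have D: "D m > 0" for m using weakly_expanding_deriv_nonzero[OF we] by (simp add: D_def)
  have "(\<lambda>m. 1 / D m) \<longlonglongrightarrow> 0"
    using weakly_expanding_summable[OF we] unfolding D_def by (rule summable_LIMSEQ_zero)
  then have "(\<lambda>m. 1 / D (m + n)) \<longlonglongrightarrow> 0" by (rule LIMSEQ_ignore_initial_segment)
  moreover have "1 / ((\<bar>B\<bar> + 1) * D n) > 0" using D[of n] by simp
  ultimately have "\<forall>\<^sub>F m in sequentially. 1 / D (m + n) < 1 / ((\<bar>B\<bar> + 1) * D n)"
    by (rule order_tendstoD)
  then obtain m where m: "1 / D (m + n) < 1 / ((\<bar>B\<bar> + 1) * D n)"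
    using eventually_happens'[OF sequentially_bot] by blast
  have "(\<bar>B\<bar> + 1) * D n < D (m + n)"
    using m D[of "m + n"] D[of n] by (simp add: divide_less_eq less_divide_eq mult.commute split: if_splits)
  also have "D (m + n) = norm (deriv (poly f ^^ m) ((poly f ^^ n) (poly f c))) * D n"
    by (simp add: D_def deriv_funpow_add[OF holomorphic_on_poly] norm_mult)
  finally have "\<bar>B\<bar> + 1 < norm (deriv (poly f ^^ m) ((poly f ^^ n) (poly f c)))" using D[of n] by simp
  then show "\<exists>m. norm (deriv (poly f ^^ m) ((poly f ^^ n) (poly f c))) > B" by (intro exI[of _ m]) linarith
qed

lemma (in escape_radius) weakly_expanding_series_summable:
  assumes "weakly_expanding f c"
  shows "summable (\<lambda>n. norm (poly q ((poly f ^^ n) (poly f c)) / deriv (poly f ^^ Suc n) (poly f c)))"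
proof -
  obtain B where B: "\<And>z. z \<in> filled_julia f \<Longrightarrow> norm (poly q z) \<le> B"
    using poly_bounded_on_compact[OF compact_filled_julia] by metis
  let ?D = "\<lambda>n. deriv (poly f ^^ n) (poly f c)"
  have "summable (\<lambda>n. 1 / norm (?D (Suc n)))"
    using weakly_expanding_summable[OF assms] by (subst summable_Suc_iff)
  then have "summable (\<lambda>n. B * (1 / norm (?D (Suc n))))" by (rule summable_mult)
  then show ?thesis
  proof (rule summable_comparison_test')
    fix n
    have "norm (poly q ((poly f ^^ n) (poly f c))) \<le> B" by (intro B weakly_expanding_imp_filled assms)
    then show "norm (norm (poly q ((poly f ^^ n) (poly f c)) / ?D (Suc n))) \<le> B * (1 / norm (?D (Suc n)))"
      unfolding norm_divide by (simp add: divide_right_mono del: funpow.simps)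
  qed
qed

section \<open>Transversality of the dual basis\<close>

lemma integrable_count_space_finite_Times_nat:
  fixes G :: "'j \<times> nat \<Rightarrow> 'b::{banach, second_countable_topology}"
  assumes J: "finite J"
  shows "integrable (count_space (J \<times> UNIV)) G \<longleftrightarrow> (\<forall>j\<in>J. summable (\<lambda>n. norm (G (j, n))))"
    and "integrable (count_space (J \<times> UNIV)) G \<Longrightarrow> (\<integral>i. G i \<partial>count_space (J \<times> UNIV)) = (\<Sum>j\<in>J. \<Sum>n. G (j, n))"
proof -
  let ?N = "count_space (UNIV :: nat set)"
  have product: "count_space J \<Otimes>\<^sub>M ?N = count_space (J \<times> UNIV)"
    using J by (intro pair_measure_countable) (simp_all add: countable_finite)
  interpret pair_sigma_finite "count_space J" ?N
    using J
    by (intro pair_sigma_finite.intro sigma_finite_measure_count_space_countable)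
       (simp_all add: countable_finite)
  show iff: "integrable (count_space (J \<times> UNIV)) G \<longleftrightarrow> (\<forall>j\<in>J. summable (\<lambda>n. norm (G (j, n))))"
  proof
    assume "integrable (count_space (J \<times> UNIV)) G"
    then have "AE j in count_space J. integrable ?N (\<lambda>n. G (j, n))"
      unfolding product[symmetric] by (rule AE_integrable_fst')
    then show "\<forall>j\<in>J. summable (\<lambda>n. norm (G (j, n)))"
      by (simp add: AE_count_space integrable_count_space_nat_iff)
  next
    assume summable: "\<forall>j\<in>J. summable (\<lambda>n. norm (G (j, n)))"
    show "integrable (count_space (J \<times> UNIV)) G"
      unfolding product[symmetric]
    proof (rule Fubini_integrable)
      show "AE j in count_space J. integrable ?N (\<lambda>n. G (j, n))"
        using summable by (simp add: AE_count_space integrable_count_space_nat_iff)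
    qed (auto simp: product J intro!: integrable_count_space)
  qed
  assume integrable: "integrable (count_space (J \<times> UNIV)) G"
  have "(\<integral>i. G i \<partial>count_space (J \<times> UNIV)) = (\<integral>j. \<integral>n. G (j, n) \<partial>?N \<partial>count_space J)"
    using integral_fst'[of G] integrable by (simp add: product)
  also have "\<dots> = (\<Sum>j\<in>J. \<Sum>n. G (j, n))"
    using J integrable unfolding iff
    by (simp add: lebesgue_integral_count_space_finite integral_count_space_nat integrable_count_space_nat_iff)
  finally show "(\<integral>i. G i \<partial>count_space (J \<times> UNIV)) = (\<Sum>j\<in>J. \<Sum>n. G (j, n))" .
qed

lemma integral_count_space_finite_Times_nat_shift:
  fixes G :: "'j \<times> nat \<Rightarrow> 'b::{banach, second_countable_topology}"
  assumes J: "finite J" and G: "integrable (count_space (J \<times> UNIV)) G"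
  shows "integrable (count_space (J \<times> UNIV)) (\<lambda>(j, n). G (j, Suc n))"
    and "(\<integral>(j, n). G (j, Suc n) \<partial>count_space (J \<times> UNIV))
        = (\<integral>i. G i \<partial>count_space (J \<times> UNIV)) - (\<Sum>j\<in>J. G (j, 0))"
proof -
  have summable: "summable (\<lambda>n. norm (G (j, n)))" if "j \<in> J" for j
    using G that integrable_count_space_finite_Times_nat(1)[OF J] by blast
  then have "summable (\<lambda>n. norm (G (j, Suc n)))" if "j \<in> J" for j
    using that by (subst summable_Suc_iff)
  then show shift: "integrable (count_space (J \<times> UNIV)) (\<lambda>(j, n). G (j, Suc n))"
    by (simp add: integrable_count_space_finite_Times_nat(1)[OF J])
  have "(\<integral>(j, n). G (j, Suc n) \<partial>count_space (J \<times> UNIV)) = (\<Sum>j\<in>J. \<Sum>n. G (j, Suc n))"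
    using integrable_count_space_finite_Times_nat(2)[OF J shift] by simp
  also have "\<dots> = (\<Sum>j\<in>J. (\<Sum>n. G (j, n)) - G (j, 0))"
    by (intro sum.cong refl suminf_split_head summable_norm_cancel[OF summable])
  also have "\<dots> = (\<integral>i. G i \<partial>count_space (J \<times> UNIV)) - (\<Sum>j\<in>J. G (j, 0))"
    by (simp add: integrable_count_space_finite_Times_nat(2)[OF J G] sum_subtractf)
  finally show "(\<integral>(j, n). G (j, Suc n) \<partial>count_space (J \<times> UNIV))
      = (\<integral>i. G i \<partial>count_space (J \<times> UNIV)) - (\<Sum>j\<in>J. G (j, 0))" .
qed

lemma AE_fibre:
  fixes f :: "'a::euclidean_space \<Rightarrow> 'a"
  assumes f: "f differentiable_on UNIV" and P: "AE x in lborel. P x"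
  shows "AE y in lborel. \<forall>x. f x = y \<longrightarrow> P x"
proof -
  obtain N where N: "N \<in> null_sets lborel" "{x. \<not> P x} \<subseteq> N"
    using P unfolding eventually_ae_filter by auto
  then have "negligible N" by (simp add: negligible_iff_null_sets null_sets_completionI)
  then have "negligible (f ` N)"
    by (rule negligible_differentiable_image_negligible[OF order.refl _ differentiable_on_subset[OF f subset_UNIV]])
  then have "\<exists>N'\<in>null_sets lborel. f ` N \<subseteq> N'"
    by (simp only: negligible_iff_null_sets null_sets_completion_iff2)
  then obtain N' where N': "N' \<in> null_sets lborel" "f ` N \<subseteq> N'" by blast
  show ?thesis
  proof (rule AE_I')
    show "{y \<in> space lborel. \<not> (\<forall>x. f x = y \<longrightarrow> P x)} \<subseteq> N'" using N(2) N'(2) by auto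
  qed (rule N'(1))
qed

context dual_basis
begin

definition orbit :: "'p \<Rightarrow> nat \<Rightarrow> complex" where
  "orbit j n = (poly f ^^ n) (poly f (c j))"

definition multiplier :: "'p \<Rightarrow> nat \<Rightarrow> complex" where
  "multiplier j n = deriv (poly f ^^ n) (poly f (c j))"

definition limit_matrix :: "'p \<Rightarrow> 'p \<Rightarrow> complex" where
  "limit_matrix j k = of_bool (j = k) + (\<Sum>n. poly (Q k) (orbit j n) / multiplier j (Suc n))"

lemma orbit_Suc: "orbit j (Suc n) = poly f (orbit j n)"
  by (simp add: orbit_def)

lemma multiplier_0: "multiplier j 0 = 1"
  by (simp only: multiplier_def deriv_funpow_0)

lemma multiplier_Suc: "multiplier j (Suc n) = poly (pderiv f) (orbit j n) * multiplier j n"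
  by (simp only: multiplier_def orbit_def deriv_poly_funpow_Suc)

end

locale vanishing_combination = dual_basis f c ms Q + escape_radius f R
  for f :: "complex poly" and c :: "'p::finite \<Rightarrow> complex" and ms Q R +
  fixes b :: "'p \<Rightarrow> complex"
  assumes expanding: "\<And>j. b j \<noteq> 0 \<Longrightarrow> weakly_expanding f (c j)"
    and vanishing: "\<And>k. (\<Sum>j\<in>UNIV. b j * limit_matrix j k) = 0"
begin

abbreviation support :: "'p set" where
  "support \<equiv> {j. b j \<noteq> 0}"

abbreviation counting :: "('p \<times> nat) measure" where
  "counting \<equiv> count_space (support \<times> UNIV)"

definition density :: "'p \<times> nat \<Rightarrow> complex" where
  "density = (\<lambda>(j, n). b j / multiplier j n)"

definition point :: "'p \<times> nat \<Rightarrow> complex" where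
  "point = (\<lambda>(j, n). orbit j n)"

lemma multiplier_nonzero: "j \<in> support \<Longrightarrow> multiplier j n \<noteq> 0"
  using weakly_expanding_deriv_nonzero[OF expanding] by (simp add: multiplier_def)

lemma pderiv_point_nonzero: "i \<in> support \<times> UNIV \<Longrightarrow> poly (pderiv f) (point i) \<noteq> 0"
  using multiplier_nonzero[of "fst i" "Suc (snd i)"] by (auto simp: point_def multiplier_Suc)

lemma point_filled: "i \<in> support \<times> UNIV \<Longrightarrow> point i \<in> filled_julia f \<inter> closure (- filled_julia f)"
  using weakly_expanding_imp_filled weakly_expanding_imp_frontier expanding
  by (auto simp: point_def orbit_def)

lemma density_Suc: "density (j, Suc n) = density (j, n) / poly (pderiv f) (orbit j n)"
  by (simp add: density_def multiplier_Suc mult.commute)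

sublocale disc_complex_measure counting density point R
proof (rule disc_complex_measure.intro)
  show "sigma_finite_measure counting"
    by (intro sigma_finite_measure_count_space_countable) simp
  show "disc_complex_measure_axioms counting density point R"
  proof
    have "summable (\<lambda>n. norm (density (j, n)))" if "j \<in> support" for j
      using summable_mult[OF weakly_expanding_summable[OF expanding], of j "norm (b j)"] that
      by (simp add: density_def multiplier_def norm_divide)
    then show "integrable counting density"
      by (subst integrable_count_space_finite_Times_nat(1)) auto
    show "norm (point i) \<le> R" if "i \<in> space counting" for i
      using point_filled[of i] that norm_le_if_filled by simp
  qed simp
qed

lemma has_integral_Q:
  shows "integrable counting (\<lambda>i. density i * (poly (Q k) (point i) / poly (pderiv f) (point i)))"
    and "(\<integral>i. density i * (poly (Q k) (point i) / poly (pderiv f) (point i)) \<partial>counting) = - b k"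
proof -
  let ?G = "\<lambda>i. density i * (poly (Q k) (point i) / poly (pderiv f) (point i))"
  have G: "?G (j, n) = b j * (poly (Q k) (orbit j n) / multiplier j (Suc n))" for j n
    by (simp add: density_def point_def multiplier_Suc mult.commute)
  have series: "summable (\<lambda>n. norm (poly (Q k) (orbit j n) / multiplier j (Suc n)))" if "j \<in> support" for j
    unfolding orbit_def multiplier_def
    by (rule weakly_expanding_series_summable) (use that expanding in blast)
  have "summable (\<lambda>n. norm (?G (j, n)))" if "j \<in> support" for j
    unfolding G norm_mult[of "b j"] by (intro summable_mult series that)
  then show integrable: "integrable counting ?G"
    by (subst integrable_count_space_finite_Times_nat(1)) auto
  have "(\<integral>i. ?G i \<partial>counting) = (\<Sum>j\<in>support. \<Sum>n. ?G (j, n))"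
    by (rule integrable_count_space_finite_Times_nat(2)[OF _ integrable]) simp
  also have "\<dots> = (\<Sum>j\<in>support. b j * (limit_matrix j k - of_bool (j = k)))"
    unfolding G limit_matrix_def
    by (simp add: suminf_mult summable_norm_cancel[OF series] del: times_divide_eq_right)
  also have "\<dots> = (\<Sum>j\<in>UNIV. b j * (limit_matrix j k - of_bool (j = k)))"
    by (rule sum.mono_neutral_left) auto
  also have "\<dots> = - b k" by (simp add: right_diff_distrib sum_subtractf vanishing)
  finally show "(\<integral>i. ?G i \<partial>counting) = - b k" .
qed

lemma integral_image_cauchy_kernel:
  assumes integrable: "integrable counting (\<lambda>i. density i / (y - point i))"
  shows "integrable counting (\<lambda>i. density i / poly (pderiv f) (point i) * (1 / (y - poly f (point i))))"
    (is "integrable _ ?S")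
    and "(\<integral>i. density i / poly (pderiv f) (point i) * (1 / (y - poly f (point i))) \<partial>counting)
      = cauchy_transform y - (\<Sum>j\<in>support. b j / (y - poly f (c j)))"
proof -
  have shift: "?S = (\<lambda>(j, n). density (j, Suc n) / (y - point (j, Suc n)))"
    by (simp add: fun_eq_iff density_Suc point_def orbit_Suc)
  have initial: "density (j, 0) = b j" "point (j, 0) = poly f (c j)" for j
    by (simp_all add: density_def point_def multiplier_0 orbit_def)
  show "integrable counting ?S"
    "(\<integral>i. ?S i \<partial>counting) = cauchy_transform y - (\<Sum>j\<in>support. b j / (y - poly f (c j)))"
    using integral_count_space_finite_Times_nat_shift[OF _ integrable]
    by (simp_all only: shift initial cauchy_transform_def finite)
qed

lemma cauchy_transform_fixed:
  assumes integrable_y: "integrable counting (\<lambda>i. density i / (y - point i))"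
    and integrable_fibre: "\<And>x. poly f x = y \<Longrightarrow> integrable counting (\<lambda>i. density i / (x - point i))"
    and regular: "\<And>x. poly f x = y \<Longrightarrow> poly (pderiv f) x \<noteq> 0"
    and avoids: "\<And>i. i \<in> support \<times> UNIV \<Longrightarrow> poly f (point i) \<noteq> y"
  shows "cauchy_transform y = transfer_operator f cauchy_transform y"
proof -
  let ?S = "\<lambda>i. density i / poly (pderiv f) (point i) * (1 / (y - poly f (point i)))"
  let ?Q = "\<lambda>k i. density i * (poly (Q k) (point i) / poly (pderiv f) (point i)) * (1 / (y - poly f (c k)))"
  note S = integral_image_cauchy_kernel[OF integrable_y]
  have Q: "integrable counting (?Q k)" "(\<integral>i. ?Q k i \<partial>counting) = - b k / (y - poly f (c k))" for k
    by (intro integrable_mult_left has_integral_Q(1))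
       (subst integral_mult_left_zero, subst has_integral_Q(2), simp)
  have "transfer_operator f cauchy_transform y
      = (\<Sum>x | poly f x = y. \<integral>i. density i / (x - point i) / (poly (pderiv f) x)\<^sup>2 \<partial>counting)"
    by (simp add: transfer_operator_def cauchy_transform_def del: divide_divide_eq_left)
  also have "\<dots> = (\<integral>i. (\<Sum>x | poly f x = y. density i / (x - point i) / (poly (pderiv f) x)\<^sup>2) \<partial>counting)"
    by (rule Bochner_Integration.integral_sum[symmetric])
       (simp add: integrable_fibre del: divide_divide_eq_left)
  also have "\<dots> = (\<integral>i. ?S i - (\<Sum>k\<in>UNIV. ?Q k i) \<partial>counting)"
  proof (rule Bochner_Integration.integral_cong[OF refl])
    fix i assume "i \<in> space counting"
    then have i: "i \<in> support \<times> UNIV" by simp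
    have "(\<Sum>x | poly f x = y. density i / (x - point i) / (poly (pderiv f) x)\<^sup>2)
        = density i * transfer_operator f (\<lambda>x. 1 / (x - point i)) y"
      by (simp add: transfer_operator_def sum_distrib_left)
    also have "\<dots> = ?S i - (\<Sum>k\<in>UNIV. ?Q k i)"
      by (subst transfer_operator_cauchy_kernel)
         (simp_all add: regular pderiv_point_nonzero[OF i] avoids[OF i] right_diff_distrib sum_distrib_left)
    finally show "(\<Sum>x | poly f x = y. density i / (x - point i) / (poly (pderiv f) x)\<^sup>2)
        = ?S i - (\<Sum>k\<in>UNIV. ?Q k i)" .
  qed
  also have "\<dots> = (\<integral>i. ?S i \<partial>counting) - (\<Sum>k\<in>UNIV. \<integral>i. ?Q k i \<partial>counting)"
    by (subst Bochner_Integration.integral_diff[OF S(1) Bochner_Integration.integrable_sum[OF Q(1)]])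
       (subst Bochner_Integration.integral_sum[OF Q(1)], rule refl)
  also have "\<dots> = cauchy_transform y - (\<Sum>j\<in>support. b j / (y - poly f (c j)))
      + (\<Sum>k\<in>UNIV. b k / (y - poly f (c k)))"
    by (simp only: S(2) Q(2)) (simp add: sum_negf)
  also have "(\<Sum>k\<in>UNIV. b k / (y - poly f (c k))) = (\<Sum>j\<in>support. b j / (y - poly f (c j)))"
    by (rule sum.mono_neutral_right) auto
  finally show ?thesis by simp
qed

lemma AE_cauchy_transform_fixed: "AE y in lborel. cauchy_transform y = transfer_operator f cauchy_transform y"
proof -
  let ?C = "poly f ` {x. poly (pderiv f) x = 0}" and ?P = "(\<lambda>i. poly f (point i)) ` (support \<times> UNIV)"
  have "pderiv f \<noteq> 0" using deg_f pderiv_eq_0_iff[of f] by auto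
  then have "countable (?C \<union> ?P)"
    by (simp add: countable_finite poly_roots_finite)
  then have "AE y in lborel. y \<notin> ?C \<union> ?P" by (intro AE_not_in countable_imp_null_set_lborel)
  moreover have "AE y in lborel. \<forall>x. poly f x = y \<longrightarrow> integrable counting (\<lambda>i. density i / (x - point i))"
    using AE_integrable_cauchy_kernel holomorphic_on_imp_differentiable_on[OF holomorphic_on_poly]
    by (intro AE_fibre)
  ultimately show ?thesis
    using AE_integrable_cauchy_kernel
  proof eventually_elim
    case (elim y)
    then show ?case by (intro cauchy_transform_fixed) auto
  qed
qed

theorem coefficients_zero: "b k = 0"
proof -
  have "(\<integral>i. density i * (poly (Q k) (point i) / poly (pderiv f) (point i)) \<partial>counting) = 0"
  proof (rule integral_zero_if_cauchy_transform_zero[where g = "\<lambda>z. poly (Q k) z / poly (pderiv f) z"])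
    show "compact (filled_julia f)" "connected (- filled_julia f)"
      by (fact compact_filled_julia connected_compl_filled_julia)+
    show "point i \<in> filled_julia f \<inter> closure (- filled_julia f)" if "i \<in> space counting" for i
      using point_filled that by simp
    show "countable (point ` space counting)"
      by simp
    show "\<exists>y. norm y > B \<and> cauchy_transform y = 0" for B
      by (rule cauchy_transform_fixed_point_zero[OF disc_complex_measure_axioms AE_cauchy_transform_fixed])
  qed (rule has_integral_Q(1))
  then show ?thesis using has_integral_Q(2)[of k] by simp
qed

end

theorem (in dual_basis) limit_matrix_rows_independent:
  assumes "\<And>j. b j \<noteq> 0 \<Longrightarrow> weakly_expanding f (c j)" and "\<And>k. (\<Sum>j\<in>UNIV. b j * limit_matrix j k) = 0"
  shows "b k = 0"
proof -
  obtain R where "escape_radius f R" using escape_radius_exists[OF deg_f] by blast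
  then interpret vanishing_combination f c ms Q R b
    by (intro vanishing_combination.intro vanishing_combination_axioms.intro dual_basis_axioms assms)
  show ?thesis by (rule coefficients_zero)
qed

section \<open>Differentiable families of polynomials\<close>

definition has_poly_derivative ::
    "('a::real_normed_vector \<Rightarrow> 'b::real_normed_field poly) \<Rightarrow> ('a \<Rightarrow> 'b poly) \<Rightarrow> 'a \<Rightarrow> bool" where
  "has_poly_derivative P P' x \<longleftrightarrow>
     (\<exists>N. \<forall>y. degree (P y) \<le> N) \<and> (\<forall>n. ((\<lambda>y. coeff (P y) n) has_derivative (\<lambda>h. coeff (P' h) n)) (at x))"

lemma has_poly_derivativeI:
  assumes "\<And>y. degree (P y) \<le> N" "\<And>n. ((\<lambda>y. coeff (P y) n) has_derivative (\<lambda>h. coeff (P' h) n)) (at x)"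
  shows "has_poly_derivative P P' x"
  using assms unfolding has_poly_derivative_def by blast

lemma has_poly_derivative_coeff:
  "has_poly_derivative P P' x \<Longrightarrow> ((\<lambda>y. coeff (P y) n) has_derivative (\<lambda>h. coeff (P' h) n)) (at x)"
  by (simp add: has_poly_derivative_def)

lemma has_poly_derivative_degree_bounded:
  assumes "has_poly_derivative P P' x"
  obtains N where "\<And>y. degree (P y) \<le> N"
  using assms unfolding has_poly_derivative_def by blast

lemma has_poly_derivative_const: "has_poly_derivative (\<lambda>y. p) (\<lambda>h. 0) x"
  by (rule has_poly_derivativeI) auto

lemma has_poly_derivative_pCons:
  assumes F: "(F has_derivative F') (at x)" and P: "has_poly_derivative P P' x"
  shows "has_poly_derivative (\<lambda>y. pCons (F y) (P y)) (\<lambda>h. pCons (F' h) (P' h)) x"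
proof -
  obtain N where N: "\<And>y. degree (P y) \<le> N"
    using has_poly_derivative_degree_bounded[OF P] by blast
  show ?thesis
  proof (rule has_poly_derivativeI)
    show "degree (pCons (F y) (P y)) \<le> Suc N" for y
      using N[of y] by (simp add: order_trans[OF degree_pCons_le])
    show "((\<lambda>y. coeff (pCons (F y) (P y)) n) has_derivative (\<lambda>h. coeff (pCons (F' h) (P' h)) n)) (at x)" for n
      using F has_poly_derivative_coeff[OF P] by (cases n) simp_all
  qed
qed

lemma has_poly_derivative_add:
  assumes P: "has_poly_derivative P P' x" and Q: "has_poly_derivative Q Q' x"
  shows "has_poly_derivative (\<lambda>y. P y + Q y) (\<lambda>h. P' h + Q' h) x"
proof -
  obtain N M where N: "\<And>y. degree (P y) \<le> N" and M: "\<And>y. degree (Q y) \<le> M"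
    using has_poly_derivative_degree_bounded[OF P] has_poly_derivative_degree_bounded[OF Q] by metis
  have "degree (P y + Q y) \<le> max N M" for y
    using N[of y] M[of y] by (intro degree_add_le) auto
  then show ?thesis
    by (rule has_poly_derivativeI)
       (simp add: has_derivative_add has_poly_derivative_coeff[OF P] has_poly_derivative_coeff[OF Q])
qed

lemma has_poly_derivative_mult:
  assumes P: "has_poly_derivative P P' x" and Q: "has_poly_derivative Q Q' x"
  shows "has_poly_derivative (\<lambda>y. P y * Q y) (\<lambda>h. P x * Q' h + P' h * Q x) x"
proof -
  obtain N M where N: "\<And>y. degree (P y) \<le> N" and M: "\<And>y. degree (Q y) \<le> M"
    using has_poly_derivative_degree_bounded[OF P] has_poly_derivative_degree_bounded[OF Q] by metis
  show ?thesis
  proof (rule has_poly_derivativeI)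
    show "degree (P y * Q y) \<le> N + M" for y
      using degree_mult_le[of "P y" "Q y"] N[of y] M[of y] by linarith
    show "((\<lambda>y. coeff (P y * Q y) n) has_derivative (\<lambda>h. coeff (P x * Q' h + P' h * Q x) n)) (at x)" for n
      unfolding coeff_mult coeff_add sum.distrib[symmetric]
      by (intro has_derivative_sum has_derivative_mult has_poly_derivative_coeff P Q)
  qed
qed

lemma has_poly_derivative_smult:
  "has_poly_derivative P P' x \<Longrightarrow> has_poly_derivative (\<lambda>y. smult a (P y)) (\<lambda>h. smult a (P' h)) x"
  using has_poly_derivative_mult[OF has_poly_derivative_const[of "[:a:]" x]] by simp

lemma has_poly_derivative_prod:
  assumes "\<And>i. i \<in> I \<Longrightarrow> has_poly_derivative (P i) (P' i) x"
  shows "has_poly_derivative (\<lambda>y. \<Prod>i\<in>I. P i y) (\<lambda>h. \<Sum>i\<in>I. P' i h * (\<Prod>j\<in>I - {i}. P j x)) x"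
  using assms
proof (induction I rule: infinite_finite_induct)
  case (insert i I)
  have others: "(\<Sum>j\<in>I. P' j h * (\<Prod>k\<in>insert i I - {j}. P k x))
      = P i x * (\<Sum>j\<in>I. P' j h * (\<Prod>k\<in>I - {j}. P k x))" for h
    unfolding sum_distrib_left
  proof (rule sum.cong[OF refl])
    fix j assume "j \<in> I"
    then have "insert i I - {j} = insert i (I - {j})" using insert.hyps(2) by auto
    then show "P' j h * (\<Prod>k\<in>insert i I - {j}. P k x) = P i x * (P' j h * (\<Prod>k\<in>I - {j}. P k x))"
      using insert.hyps by (simp add: mult.left_commute)
  qed
  have "has_poly_derivative (\<lambda>y. P i y * (\<Prod>j\<in>I. P j y))
      (\<lambda>h. P i x * (\<Sum>j\<in>I. P' j h * (\<Prod>k\<in>I - {j}. P k x)) + P' i h * (\<Prod>j\<in>I. P j x)) x"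
    by (intro has_poly_derivative_mult insert.IH insert.prems) auto
  then show ?case using insert.hyps by (simp add: others add.commute)
qed (simp_all add: has_poly_derivative_const)

lemma has_poly_derivative_power:
  assumes "has_poly_derivative P P' x"
  shows "has_poly_derivative (\<lambda>y. P y ^ n) (\<lambda>h. smult (of_nat n) (P' h * P x ^ (n - 1))) x"
  using has_poly_derivative_prod[of "{..<n}" "\<lambda>_. P" "\<lambda>_. P'", OF assms] by (simp add: of_nat_poly)

lemma has_poly_derivative_sum:
  assumes "\<And>i. i \<in> I \<Longrightarrow> has_poly_derivative (P i) (P' i) x"
  shows "has_poly_derivative (\<lambda>y. \<Sum>i\<in>I. P i y) (\<lambda>h. \<Sum>i\<in>I. P' i h) x"
  using assms
  by (induction I rule: infinite_finite_induct)
     (simp_all add: has_poly_derivative_const has_poly_derivative_add)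

lemma has_poly_derivative_coeff_const:
  assumes "has_poly_derivative P P' x" "\<And>y. coeff (P y) n = a"
  shows "coeff (P' h) n = 0"
proof -
  have "((\<lambda>y. coeff (P y) n) has_derivative (\<lambda>h. 0)) (at x)" by (simp add: assms(2))
  from has_derivative_unique[OF has_poly_derivative_coeff[OF assms(1)] this]
  show ?thesis by (rule fun_cong)
qed

lemma has_derivative_poly:
  fixes P :: "'a::real_normed_vector \<Rightarrow> 'b::real_normed_field poly"
  assumes P: "has_poly_derivative P P' x" and z: "(z has_derivative z') (at x)"
  shows "((\<lambda>y. poly (P y) (z y))
      has_derivative (\<lambda>h. poly (P' h) (z x) + poly (pderiv (P x)) (z x) * z' h)) (at x)"
proof -
  obtain N where N: "\<And>y. degree (P y) \<le> N"
    using has_poly_derivative_degree_bounded[OF P] by blast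
  have eval: "poly q w = (\<Sum>n\<le>N. coeff q n * w ^ n)" if "degree q \<le> N" for q :: "'b poly" and w
    unfolding poly_altdef by (rule sum.mono_neutral_left) (use that in \<open>auto simp: coeff_eq_0\<close>)
  have "coeff (P' h) n = 0" if "n > N" for n h
    using P by (rule has_poly_derivative_coeff_const) (use N that in \<open>auto intro: coeff_eq_0 le_less_trans\<close>)
  then have degree: "degree (P' h) \<le> N" for h by (intro degree_le) auto
  have fixed: "((\<lambda>y. poly (P x) (z y)) has_derivative (\<lambda>h. poly (pderiv (P x)) (z x) * z' h)) (at x)"
    using has_derivative_compose[OF z] poly_DERIV[of "P x" "z x"] unfolding has_field_derivative_def by blast
  have "((\<lambda>y. \<Sum>n\<le>N. coeff (P x) n * z y ^ n) has_derivative
      (\<lambda>h. \<Sum>n\<le>N. coeff (P x) n * (of_nat n * z' h * z x ^ (n - 1)))) (at x)"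
    by (intro has_derivative_sum has_derivative_mult_right has_derivative_power z)
  then have pderiv: "(\<lambda>h. \<Sum>n\<le>N. coeff (P x) n * (of_nat n * z' h * z x ^ (n - 1)))
      = (\<lambda>h. poly (pderiv (P x)) (z x) * z' h)"
    using fixed has_derivative_unique by (simp only: eval[OF N, symmetric])
  have "((\<lambda>y. \<Sum>n\<le>N. coeff (P y) n * z y ^ n) has_derivative
      (\<lambda>h. \<Sum>n\<le>N. coeff (P x) n * (of_nat n * z' h * z x ^ (n - 1)) + coeff (P' h) n * z x ^ n)) (at x)"
    by (intro has_derivative_sum has_derivative_mult has_derivative_power z has_poly_derivative_coeff[OF P])
  then show ?thesis
    unfolding sum.distrib eval[OF N, symmetric] eval[OF degree, symmetric] fun_cong[OF pderiv]
    by (simp add: add.commute)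
qed

section \<open>Primitives of polynomials and the next-to-leading coefficient\<close>

definition poly_primitive :: "'a::field_char_0 poly \<Rightarrow> 'a poly" where
  "poly_primitive p = (\<Sum>n\<le>degree p. monom (coeff p n / of_nat (Suc n)) (Suc n))"

lemma coeff_poly_primitive_0 [simp]: "coeff (poly_primitive p) 0 = 0"
  by (simp add: poly_primitive_def coeff_sum)

lemma coeff_poly_primitive_Suc: "coeff (poly_primitive p) (Suc n) = coeff p n / of_nat (Suc n)"
  by (simp add: poly_primitive_def coeff_sum coeff_eq_0 del: of_nat_Suc)

lemma pderiv_poly_primitive: "pderiv (poly_primitive p) = p"
  by (rule poly_eqI) (simp add: coeff_pderiv coeff_poly_primitive_Suc del: of_nat_Suc)

lemma poly_primitive_pderiv: "[:coeff p 0:] + poly_primitive (pderiv p) = p"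
proof (rule poly_eqI)
  fix n show "coeff ([:coeff p 0:] + poly_primitive (pderiv p)) n = coeff p n"
    by (cases n) (simp_all add: coeff_poly_primitive_Suc coeff_pderiv del: of_nat_Suc)
qed

lemma degree_poly_primitive_le: "degree (poly_primitive p) \<le> Suc (degree p)"
  unfolding poly_primitive_def by (intro degree_sum_le order_trans[OF degree_monom_le]) auto

lemma has_poly_derivative_primitive:
  fixes P :: "'a::real_normed_vector \<Rightarrow> 'b::real_normed_field poly"
  assumes "has_poly_derivative P P' x"
  shows "has_poly_derivative (\<lambda>y. poly_primitive (P y)) (\<lambda>h. poly_primitive (P' h)) x"
proof -
  obtain N where N: "\<And>y. degree (P y) \<le> N"
    using has_poly_derivative_degree_bounded[OF assms] by blast
  show ?thesis
  proof (rule has_poly_derivativeI)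
    show "degree (poly_primitive (P y)) \<le> Suc N" for y
      using degree_poly_primitive_le[of "P y"] N[of y] by simp
    show "((\<lambda>y. coeff (poly_primitive (P y)) n)
        has_derivative (\<lambda>h. coeff (poly_primitive (P' h)) n)) (at x)" for n
      using has_poly_derivative_coeff[OF assms]
      by (cases n)
         (auto simp: coeff_poly_primitive_Suc divide_inverse intro: has_derivative_mult_left simp del: of_nat_Suc)
  qed
qed

lemma coeff_1_prod:
  assumes "\<And>i. i \<in> I \<Longrightarrow> coeff (p i) 0 = 1"
  shows "coeff (\<Prod>i\<in>I. p i) (Suc 0) = (\<Sum>i\<in>I. coeff (p i :: 'a::comm_ring_1 poly) (Suc 0))"
  using assms
proof (induction I rule: infinite_finite_induct)
  case (insert i I)
  have "coeff (\<Prod>j\<in>I. p j) 0 = 1"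
    using insert.prems insert.hyps(1) by (simp add: poly_0_coeff_0[symmetric] poly_prod)
  then show ?case using insert by (simp add: coeff_mult)
qed simp_all

lemma coeff_prod_linear_powers_next:
  fixes r :: "'i::finite \<Rightarrow> 'a::idom"
  assumes degree: "(\<Sum>i\<in>UNIV. ms i) = Suc n"
  shows "coeff (\<Prod>i\<in>UNIV. [:- r i, 1:] ^ ms i) n = - (\<Sum>i\<in>UNIV. of_nat (ms i) * r i)"
proof -
  let ?P = "\<Prod>i\<in>UNIV. [:- r i, 1:] ^ ms i" and ?R = "\<lambda>i. [:1, - r i:]"
  have reflect: "reflect_poly [:- a, 1:] = [:1, - a:]" for a :: 'a
    by (cases "a = 0") (simp_all add: reflect_poly_def)
  have "degree ?P = Suc n" by (simp add: degree_prod_sum_eq degree_linear_power degree)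
  then have "coeff ?P n = coeff (reflect_poly ?P) (Suc 0)" by (simp add: coeff_reflect_poly)
  also have "reflect_poly ?P = (\<Prod>i\<in>UNIV. ?R i ^ ms i)"
    by (simp add: reflect_poly_prod reflect_poly_power reflect)
  also have "coeff (\<Prod>i\<in>UNIV. ?R i ^ ms i) (Suc 0) = (\<Sum>i\<in>UNIV. coeff (?R i ^ ms i) (Suc 0))"
    by (rule coeff_1_prod) (simp add: coeff_0_power)
  also have "\<dots> = (\<Sum>i\<in>UNIV. - (of_nat (ms i) * r i))"
    using coeff_1_prod[of "{..<ms i}" "\<lambda>_. ?R i" for i] by simp
  finally show ?thesis by (simp add: sum_negf)
qed

section \<open>Parametrisation of the stratum\<close>

lemma monic_centered_critical_points:
  assumes g: "g \<in> monic_centered d" and "d \<ge> 2" and crit: "has_critical_points g c ms"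
  shows "(\<Sum>i\<in>UNIV. ms i) = d - 1" "(\<Sum>i\<in>UNIV. of_nat (ms i) * c i) = 0"
proof -
  let ?P = "\<Prod>i\<in>UNIV. [:- c i, 1:] ^ ms i"
  have degree_g: "degree g = d" and next_g: "coeff g (d - 1) = 0" using g by (auto simp: monic_centered_def)
  have pderiv_g: "pderiv g = smult (of_nat d) ?P" using crit degree_g by (simp add: has_critical_points_def)
  have "degree ?P = (\<Sum>i\<in>UNIV. ms i)" by (simp add: degree_prod_sum_eq degree_linear_power)
  then show sum_ms: "(\<Sum>i\<in>UNIV. ms i) = d - 1"
    using degree_pderiv[of g] \<open>d \<ge> 2\<close> by (simp add: pderiv_g degree_g)
  have "of_nat d * coeff ?P (d - 2) = coeff (pderiv g) (d - 2)" by (simp add: pderiv_g)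
  also have "\<dots> = 0" using next_g \<open>d \<ge> 2\<close> by (simp add: coeff_pderiv Suc_diff_Suc numeral_2_eq_2)
  finally have "coeff ?P (d - 2) = 0" using \<open>d \<ge> 2\<close> by simp
  then show "(\<Sum>i\<in>UNIV. of_nat (ms i) * c i) = 0"
    using coeff_prod_linear_powers_next[of ms "d - 2" c] sum_ms \<open>d \<ge> 2\<close> by simp
qed

lemma has_derivative_vec_lambda:
  fixes f :: "'p::finite \<Rightarrow> 'a::real_normed_vector \<Rightarrow> 'b::euclidean_space"
  assumes "\<And>i. (f i has_derivative f' i) (at x)"
  shows "((\<lambda>x. \<chi> i. f i x) has_derivative (\<lambda>h. \<chi> i. f' i h)) (at x)"
proof (subst has_derivative_componentwise_within, intro ballI)
  fix b :: "'b ^ 'p" assume "b \<in> Basis"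
  then obtain i e where b: "b = axis i e" by (auto simp: Basis_vec_def)
  show "((\<lambda>x. (\<chi> i. f i x) \<bullet> b) has_derivative (\<lambda>h. (\<chi> i. f' i h) \<bullet> b)) (at x)"
    unfolding b inner_axis vec_lambda_beta by (rule has_derivative_inner_left[OF assms])
qed

text \<open>
  The critical points of a centered polynomial have weighted mean zero. The stratum is therefore
  parametrised by \<open>\<complex>\<^sup>p\<close>: the critical points are \<open>u $ i\<close> minus their weighted mean, and the
  weighted mean itself is used as the increment of the constant coefficient.
\<close>

locale critical_polynomial =
  fixes f :: "complex poly" and c :: "'p::finite \<Rightarrow> complex" and ms :: "'p \<Rightarrow> nat"
  assumes deg_f: "degree f \<ge> 2" and centered: "f \<in> monic_centered (degree f)"
    and crit: "has_critical_points f c ms"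
begin

definition shift :: "complex ^ 'p \<Rightarrow> complex" where
  "shift u = (\<Sum>i\<in>UNIV. of_nat (ms i) * u $ i) / of_nat (degree f - 1)"

definition cpt :: "complex ^ 'p \<Rightarrow> 'p \<Rightarrow> complex" where
  "cpt u i = u $ i - shift u"

definition param_deriv :: "complex ^ 'p \<Rightarrow> complex poly" where
  "param_deriv u = smult (of_nat (degree f)) (\<Prod>i\<in>UNIV. [:- cpt u i, 1:] ^ ms i)"

definition param_poly :: "complex ^ 'p \<Rightarrow> complex poly" where
  "param_poly u = [:coeff f 0 + shift u:] + poly_primitive (param_deriv u)"

definition base :: "complex ^ 'p" where
  "base = (\<chi> i. c i)"

lemma ms_pos: "ms i > 0"
  using crit by (auto simp: has_critical_points_def Suc_le_eq)

lemma sum_ms: "(\<Sum>i\<in>UNIV. ms i) = degree f - 1"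
  by (rule monic_centered_critical_points(1)[OF centered deg_f crit])

lemma sum_of_nat_ms: "(\<Sum>i\<in>UNIV. complex_of_nat (ms i)) = of_nat (degree f - 1)"
  using arg_cong[OF sum_ms, of complex_of_nat] by simp

lemma sum_ms_cpt: "(\<Sum>i\<in>UNIV. of_nat (ms i) * cpt u i) = 0"
proof -
  have "(\<Sum>i\<in>UNIV. of_nat (ms i) * cpt u i)
      = (\<Sum>i\<in>UNIV. of_nat (ms i) * u $ i) - (\<Sum>i\<in>UNIV. of_nat (ms i)) * shift u"
    by (simp add: cpt_def right_diff_distrib sum_subtractf sum_distrib_right)
  also have "\<dots> = 0" unfolding sum_of_nat_ms using deg_f by (simp add: shift_def)
  finally show ?thesis .
qed

lemma pderiv_param_poly: "pderiv (param_poly u) = param_deriv u"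
  by (simp add: param_poly_def pderiv_add pderiv_pCons pderiv_poly_primitive)

lemma poly_param_deriv_cpt: "poly (param_deriv u) (cpt u i) = 0"
  using ms_pos[of i] by (auto simp: param_deriv_def poly_prod)

lemma coeff_param_poly:
  assumes "n \<ge> degree f - 1"
  shows "coeff (param_poly u) n = of_bool (n = degree f)"
proof -
  let ?P = "\<Prod>i\<in>UNIV. [:- cpt u i, 1:] ^ ms i"
  obtain m where n: "n = Suc m" using assms deg_f by (cases n) auto
  then have coeff: "coeff (param_poly u) n = of_nat (degree f) * coeff ?P m / of_nat n"
    by (simp add: param_poly_def coeff_poly_primitive_Suc param_deriv_def del: of_nat_Suc)
  have degree: "degree ?P = degree f - 1" by (simp add: degree_prod_sum_eq degree_linear_power sum_ms)
  consider "n = degree f - 1" | "n = degree f" | "n > degree f" using assms by linarith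
  then show ?thesis
  proof cases
    case 1
    then have "coeff ?P m = - (\<Sum>i\<in>UNIV. of_nat (ms i) * cpt u i)"
      using n by (intro coeff_prod_linear_powers_next) (simp add: sum_ms)
    then show ?thesis using coeff 1 deg_f by (simp add: sum_ms_cpt)
  next
    case 2
    then have m: "m = degree ?P" using n degree by simp
    have "coeff ?P m = 1" unfolding m by (simp add: lead_coeff_prod lead_coeff_power)
    then show ?thesis using coeff 2 deg_f by simp
  next
    case 3
    then have "coeff ?P m = 0" using n deg_f degree by (intro coeff_eq_0) simp
    then show ?thesis using coeff 3 by simp
  qed
qed

lemma degree_param_poly: "degree (param_poly u) = degree f"
proof (rule antisym)
  show "degree (param_poly u) \<le> degree f" by (rule degree_le) (simp add: coeff_param_poly)
  show "degree f \<le> degree (param_poly u)" by (rule le_degree) (simp add: coeff_param_poly)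
qed

lemma param_poly_monic_centered: "param_poly u \<in> monic_centered (degree f)"
  using deg_f by (simp add: monic_centered_def degree_param_poly coeff_param_poly)

lemma param_poly_critical_points: "inj (cpt u) \<Longrightarrow> has_critical_points (param_poly u) (cpt u) ms"
  using crit by (simp add: has_critical_points_def pderiv_param_poly param_deriv_def degree_param_poly)

lemma param_poly_surj:
  assumes g: "g \<in> monic_centered (degree f)" "has_critical_points g c' ms"
  obtains u where "cpt u = c'" "param_poly u = g" "shift u = coeff g 0 - coeff f 0"
proof (rule that)
  let ?u = "\<chi> i. c' i + (coeff g 0 - coeff f 0)"
  have "(\<Sum>i\<in>UNIV. of_nat (ms i) * ?u $ i) = of_nat (degree f - 1) * (coeff g 0 - coeff f 0)"
    using monic_centered_critical_points(2)[OF g(1) deg_f g(2)]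
    by (simp add: distrib_left sum.distrib sum_distrib_right[symmetric] sum_of_nat_ms)
  then show shift: "shift ?u = coeff g 0 - coeff f 0" using deg_f by (simp add: shift_def)
  then show cpt: "cpt ?u = c'" by (auto simp: cpt_def)
  have "degree g = degree f" using g(1) by (simp add: monic_centered_def)
  then have "pderiv g = param_deriv ?u" using g(2) by (simp add: has_critical_points_def param_deriv_def cpt)
  then show "param_poly ?u = g" using poly_primitive_pderiv[of g] by (simp add: param_poly_def shift)
qed

lemma cpt_base: "cpt base = c" and param_poly_base: "param_poly base = f"
proof -
  obtain u where u: "cpt u = c" "param_poly u = f" "shift u = coeff f 0 - coeff f 0"
    using param_poly_surj[OF centered crit] .
  then have "u = base" by (auto simp: vec_eq_iff base_def cpt_def)
  with u show "cpt base = c" "param_poly base = f" by auto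
qed

lemma has_derivative_shift: "(shift has_derivative shift) (at u)"
  unfolding shift_def
  by (intro bounded_linear_imp_has_derivative bounded_linear_sum bounded_linear_const_mult bounded_linear_vec_nth
      bounded_linear_compose[OF bounded_linear_divide])

lemma has_derivative_cpt: "((\<lambda>u. cpt u i) has_derivative (\<lambda>h. cpt h i)) (at u)"
  unfolding cpt_def
  by (intro has_derivative_diff has_derivative_shift bounded_linear_imp_has_derivative bounded_linear_vec_nth)

definition cofactor :: "complex ^ 'p \<Rightarrow> 'p \<Rightarrow> complex poly" where
  "cofactor u i = (\<Prod>l\<in>UNIV. [:- cpt u l, 1:] ^ (ms l - 1)) * (\<Prod>l\<in>UNIV - {i}. [:- cpt u l, 1:])"

definition tangent :: "complex ^ 'p \<Rightarrow> complex ^ 'p \<Rightarrow> complex poly" where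
  "tangent u h = [:shift h:] +
     poly_primitive (smult (of_nat (degree f)) (\<Sum>i\<in>UNIV. smult (- (of_nat (ms i) * cpt h i)) (cofactor u i)))"

lemma pderiv_tangent:
  "pderiv (tangent u h)
      = smult (of_nat (degree f)) (\<Sum>i\<in>UNIV. smult (- (of_nat (ms i) * cpt h i)) (cofactor u i))"
  by (simp add: tangent_def pderiv_add pderiv_pCons pderiv_poly_primitive)

lemma cofactor_eq: "cofactor u i = [:- cpt u i, 1:] ^ (ms i - 1) * (\<Prod>l\<in>UNIV - {i}. [:- cpt u l, 1:] ^ ms l)"
proof -
  have "[:- cpt u l, 1:] ^ (ms l - 1) * [:- cpt u l, 1:] = [:- cpt u l, 1:] ^ ms l" for l
    using ms_pos by (rule power_minus_mult)
  then have "(\<Prod>l\<in>UNIV - {i}. [:- cpt u l, 1:] ^ (ms l - 1)) * (\<Prod>l\<in>UNIV - {i}. [:- cpt u l, 1:])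
      = (\<Prod>l\<in>UNIV - {i}. [:- cpt u l, 1:] ^ ms l)"
    by (simp only: prod.distrib[symmetric])
  then show ?thesis by (simp only: cofactor_def prod.remove[of UNIV i, OF finite UNIV_I] mult.assoc)
qed

lemma has_poly_derivative_linear_factor: "has_poly_derivative (\<lambda>u. [:- cpt u i, 1:]) (\<lambda>h. [:- cpt h i:]) u"
  by (intro has_poly_derivative_pCons has_derivative_minus has_derivative_cpt has_poly_derivative_const)

lemma has_poly_derivative_param_poly: "has_poly_derivative param_poly (tangent u) u"
proof -
  let ?l = "\<lambda>u i. [:- cpt u i, 1:]"
  have "has_poly_derivative (\<lambda>u. \<Prod>i\<in>UNIV. ?l u i ^ ms i)
      (\<lambda>h. \<Sum>i\<in>UNIV. smult (of_nat (ms i)) ([:- cpt h i:] * ?l u i ^ (ms i - 1)) * (\<Prod>j\<in>UNIV - {i}. ?l u j ^ ms j)) u"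
    by (intro has_poly_derivative_prod has_poly_derivative_power has_poly_derivative_linear_factor)
  also have "(\<lambda>h. \<Sum>i\<in>UNIV. smult (of_nat (ms i)) ([:- cpt h i:] * ?l u i ^ (ms i - 1)) * (\<Prod>j\<in>UNIV - {i}. ?l u j ^ ms j))
      = (\<lambda>h. \<Sum>i\<in>UNIV. smult (- (of_nat (ms i) * cpt h i)) (cofactor u i))"
    by (simp add: cofactor_eq)
  finally have "has_poly_derivative (\<lambda>u. \<Prod>i\<in>UNIV. ?l u i ^ ms i)
      (\<lambda>h. \<Sum>i\<in>UNIV. smult (- (of_nat (ms i) * cpt h i)) (cofactor u i)) u" .
  moreover have "((\<lambda>u. coeff f 0 + shift u) has_derivative shift) (at u)"
    using has_derivative_add[OF has_derivative_const has_derivative_shift, of "coeff f 0" u] by simp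
  ultimately show ?thesis
    unfolding param_poly_def param_deriv_def tangent_def
    by (intro has_poly_derivative_add has_poly_derivative_primitive has_poly_derivative_smult
        has_poly_derivative_pCons has_poly_derivative_const)
qed

lemma isCont_poly_tangent: "isCont (\<lambda>u. poly (tangent u h) (cpt u i)) u"
proof -
  have "\<exists>P'. has_poly_derivative (\<lambda>u. tangent u h) P' u"
    unfolding tangent_def cofactor_def
    by (rule exI has_poly_derivative_const has_poly_derivative_add has_poly_derivative_primitive
        has_poly_derivative_smult has_poly_derivative_sum has_poly_derivative_mult has_poly_derivative_prod
        has_poly_derivative_power has_poly_derivative_linear_factor)+
  then obtain P' where "has_poly_derivative (\<lambda>u. tangent u h) P' u" ..
  from has_derivative_continuous[OF has_derivative_poly[OF this has_derivative_cpt]] show ?thesis .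
qed

lemma degree_tangent: "degree (tangent u h) < degree f - 1"
proof -
  have "coeff (tangent u h) n = 0" if "n \<ge> degree f - 1" for n
    using has_poly_derivative_param_poly coeff_param_poly[OF that] by (rule has_poly_derivative_coeff_const)
  then have "degree (tangent u h) \<le> degree f - 2" using deg_f by (intro degree_le) auto
  then show ?thesis using deg_f by linarith
qed

lemma linear_power_dvd_tangent: "[:- cpt u i, 1:] ^ ms i dvd tangent u h - [:poly (tangent u h) (cpt u i):]"
proof -
  have "[:- cpt u i, 1:] ^ (ms i - 1) dvd cofactor u l" for l
    unfolding cofactor_def by (intro dvd_mult2 dvd_prodI) auto
  then have "[:- cpt u i, 1:] ^ (ms i - 1) dvd pderiv (tangent u h - [:poly (tangent u h) (cpt u i):])"
    unfolding pderiv_diff pderiv_tangent by (simp add: pderiv_pCons dvd_smult dvd_sum)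
  then have "[:- cpt u i, 1:] ^ Suc (ms i - 1) dvd tangent u h - [:poly (tangent u h) (cpt u i):]"
    by (rule linear_power_dvd_if_dvd_pderiv) simp
  then show ?thesis using ms_pos[of i] by simp
qed

lemma tangent_eq_0_imp:
  assumes inj: "inj (cpt u)" and "tangent u h = 0"
  shows "h = 0"
proof -
  let ?a = "\<lambda>i. - (of_nat (ms i) * cpt h i)" and ?G = "\<Prod>l\<in>UNIV. [:- cpt u l, 1:] ^ (ms l - 1)"
  let ?S = "\<Sum>i\<in>UNIV. smult (?a i) (\<Prod>l\<in>UNIV - {i}. [:- cpt u l, 1:])"
  have "?G * ?S = (\<Sum>i\<in>UNIV. smult (?a i) (cofactor u i))"
    by (simp only: cofactor_def sum_distrib_left mult_smult_right)
  also have "\<dots> = 0" using pderiv_tangent[of u h] assms(2) deg_f by simp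
  finally have "?S = 0" by simp
  have "cpt h k = 0" for k
  proof -
    have "0 = poly ?S (cpt u k)" by (simp only: \<open>?S = 0\<close> poly_0)
    also have "\<dots> = (\<Sum>i\<in>UNIV. ?a i * (\<Prod>l\<in>UNIV - {i}. cpt u k - cpt u l))" by (simp add: poly_sum poly_prod)
    also have "\<dots> = (\<Sum>i\<in>{k}. ?a i * (\<Prod>l\<in>UNIV - {i}. cpt u k - cpt u l))"
      by (rule sum.mono_neutral_right) auto
    finally show ?thesis using ms_pos[of k] inj by (auto simp: inj_eq)
  qed
  moreover have "shift h = coeff (tangent u h) 0" by (simp add: tangent_def)
  ultimately show ?thesis using assms(2) by (simp add: vec_eq_iff cpt_def)
qed

definition cval :: "complex ^ 'p \<Rightarrow> complex ^ 'p" where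
  "cval u = (\<chi> i. poly (param_poly u) (cpt u i))"

definition cval_deriv :: "complex ^ 'p \<Rightarrow> complex ^ 'p \<Rightarrow> complex ^ 'p" where
  "cval_deriv u h = (\<chi> i. poly (tangent u h) (cpt u i))"

lemma has_derivative_cval: "(cval has_derivative cval_deriv u) (at u)"
proof -
  have "((\<lambda>u. poly (param_poly u) (cpt u i)) has_derivative (\<lambda>h. poly (tangent u h) (cpt u i))) (at u)" for i
    using has_derivative_poly[OF has_poly_derivative_param_poly[of u] has_derivative_cpt[of i u]]
    by (simp add: pderiv_param_poly poly_param_deriv_cpt)
  then show ?thesis unfolding cval_def cval_deriv_def by (rule has_derivative_vec_lambda)
qed

lemma cval_deriv_eq_0_imp:
  assumes inj: "inj (cpt u)" and "cval_deriv u h = 0"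
  shows "h = 0"
proof (rule tangent_eq_0_imp[OF inj])
  show "tangent u h = 0"
  proof (rule poly_eq_if_congruent_at_critical_points[OF param_poly_critical_points[OF inj]])
    show "degree (tangent u h) < degree (param_poly u) - 1"
      "degree (0 :: complex poly) < degree (param_poly u) - 1"
      using degree_tangent[of u h] deg_f by (auto simp: degree_param_poly)
    have "poly (tangent u h) (cpt u i) = 0" for i
      using assms(2) by (simp add: cval_deriv_def vec_eq_iff)
    then show "[:- cpt u i, 1:] ^ ms i dvd tangent u h - 0" for i
      using linear_power_dvd_tangent[of u i h] by simp
  qed
qed

end

section \<open>Critical values as coordinates\<close>

definition separated :: "real \<Rightarrow> ('i \<Rightarrow> 'a::metric_space) \<Rightarrow> bool" where
  "separated \<epsilon> c \<longleftrightarrow> (\<forall>i l. i \<noteq> l \<longrightarrow> 2 * \<epsilon> \<le> dist (c i) (c l))"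

lemma eventually_separated:
  fixes c :: "'i::finite \<Rightarrow> 'a::metric_space"
  assumes "inj c"
  shows "\<forall>\<^sub>F \<epsilon> in at_right 0. separated \<epsilon> c"
  unfolding separated_def
proof (intro eventually_all_finite)
  fix i l
  show "\<forall>\<^sub>F \<epsilon> in at_right 0. i \<noteq> l \<longrightarrow> 2 * \<epsilon> \<le> dist (c i) (c l)"
  proof (cases "i = l")
    case False
    then have "0 < dist (c i) (c l) / 2" using assms by (simp add: inj_eq)
    then show ?thesis by (rule eventually_mono[OF eventually_at_right_real]) auto
  qed simp
qed

lemma has_derivative_imp_tendsto_nhds: "(F has_derivative F') (at x) \<Longrightarrow> (F \<longlongrightarrow> F x) (nhds x)"
  by (simp only: tendsto_at_iff_tendsto_nhds[symmetric] continuous_at[symmetric] has_derivative_continuous)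

lemma separated_close_imp_eq:
  assumes "separated \<epsilon> c" "dist z (c i) < \<epsilon>" "dist z (c l) < \<epsilon>"
  shows "i = l"
proof (rule ccontr)
  assume "i \<noteq> l"
  then have "2 * \<epsilon> \<le> dist (c i) (c l)" using assms(1) by (simp add: separated_def)
  also have "\<dots> \<le> dist z (c i) + dist z (c l)" by (rule dist_triangle3)
  finally show False using assms by simp
qed

lemma poly_pderiv_eq_0_iff:
  assumes "has_critical_points g c ms" "degree g > 0"
  shows "poly (pderiv g) z = 0 \<longleftrightarrow> (\<exists>i. z = c i)"
proof -
  have "ms i > 0" for i using assms(1) by (auto simp: has_critical_points_def Suc_le_eq)
  then show ?thesis using assms by (auto simp: has_critical_points_def poly_prod)
qed

lemma crit_pt_eq:
  assumes g: "has_critical_points g c' ms" "degree g > 0"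
    and "separated \<epsilon> c" and close: "\<And>i. dist (c' i) (c i) < \<epsilon>"
  shows "crit_pt \<epsilon> c i g = c' i"
  unfolding crit_pt_def poly_pderiv_eq_0_iff[OF g]
proof (rule the_equality)
  show "(\<exists>l. c' i = c' l) \<and> dist (c' i) (c i) < \<epsilon>" using close by blast
  show "z = c' i" if "(\<exists>l. z = c' l) \<and> dist z (c i) < \<epsilon>" for z
    using that close separated_close_imp_eq[OF \<open>separated \<epsilon> c\<close>] by blast
qed

primrec orbit_variation :: "complex poly \<Rightarrow> complex poly \<Rightarrow> complex \<Rightarrow> complex \<Rightarrow> nat \<Rightarrow> complex" where
  "orbit_variation f q \<delta> v 0 = \<delta>"
| "orbit_variation f q \<delta> v (Suc m) =
     poly q ((poly f ^^ m) v) + poly (pderiv f) ((poly f ^^ m) v) * orbit_variation f q \<delta> v m"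

lemma orbit_variation_smult: "orbit_variation f (smult t q) (t * \<delta>) v m = t * orbit_variation f q \<delta> v m"
  by (induction m) (simp_all add: algebra_simps)

abbreviation orbit_coord_deriv ::
    "real \<Rightarrow> complex poly \<Rightarrow> ('p::finite \<Rightarrow> complex) \<Rightarrow> ('p \<Rightarrow> nat) \<Rightarrow> 'p \<Rightarrow> 'p \<Rightarrow> nat \<Rightarrow> complex" where
  "orbit_coord_deriv \<epsilon> f c ms j k m \<equiv>
     coord_deriv (stratum \<epsilon> f c ms) (crit_vals \<epsilon> c) k (\<lambda>g. (poly g ^^ m) (crit_pt \<epsilon> c j g)) f"

context critical_polynomial
begin

lemma has_derivative_orbit:
  "((\<lambda>u. (poly (param_poly u) ^^ Suc m) (cpt u j)) has_derivative
    (\<lambda>h. orbit_variation f (tangent base h) (cval_deriv base h $ j) (poly f (c j)) m)) (at base)"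
proof (induction m)
  case 0
  have "((\<lambda>u. cval u $ j) has_derivative (\<lambda>h. cval_deriv base h $ j)) (at base)"
    by (rule bounded_linear.has_derivative[OF bounded_linear_vec_nth has_derivative_cval])
  then show ?case by (simp add: cval_def)
next
  case (Suc m)
  from has_derivative_poly[OF has_poly_derivative_param_poly Suc] show ?case
    by (simp add: param_poly_base cpt_base funpow_swap1)
qed

lemma inj_cval_deriv_base: "inj (cval_deriv base)"
proof (rule linear_injective_0[THEN iffD2])
  show "linear (cval_deriv base)" using has_derivative_linear[OF has_derivative_cval] .
  have "inj (cpt base)" using crit by (simp add: cpt_base has_critical_points_def)
  then show "\<forall>h. cval_deriv base h = 0 \<longrightarrow> h = 0" using cval_deriv_eq_0_imp by blast
qed

lemma critical_value_chart:
  obtains U \<gamma> B where "open U" "base \<in> U" "inj_on cval U"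
    "\<gamma> (cval base) = base" "\<forall>\<^sub>F w in nhds (cval base). cval (\<gamma> w) = w"
    "(\<gamma> has_derivative B) (at (cval base))" "\<And>h. cval_deriv base (B h) = h"
proof -
  define D where "D u = Blinfun (cval_deriv u)" for u
  have D: "blinfun_apply (D u) = cval_deriv u" for u
    unfolding D_def
    by (rule bounded_linear_Blinfun_apply[OF has_derivative_bounded_linear[OF has_derivative_cval]])
  have "continuous_on UNIV (\<lambda>u. cval_deriv u h)" for h
    unfolding cval_deriv_def
    by (intro continuous_on_vec_lambda continuous_at_imp_continuous_on ballI isCont_poly_tangent)
  then have continuous: "continuous_on UNIV D" by (intro continuous_on_blinfun_componentwise) (simp add: D)
  obtain E where E: "linear E" "E \<circ> cval_deriv base = id"
    using linear_injective_left_inverse[OF has_derivative_linear[OF has_derivative_cval] inj_cval_deriv_base] by blast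
  have inverse: "Blinfun E o\<^sub>L D base = id_blinfun"
    using E
    by (intro blinfun_eqI) (simp add: D bounded_linear_Blinfun_apply linear_conv_bounded_linear fun_eq_iff)
  obtain U V \<gamma> \<gamma>' where chart: "open U" "base \<in> U" "open V" "cval base \<in> V" "homeomorphism U V cval \<gamma>"
      "\<And>w. w \<in> V \<Longrightarrow> (\<gamma> has_derivative \<gamma>' w) (at w)"
      "\<And>w. w \<in> V \<Longrightarrow> \<gamma>' w = inv (blinfun_apply (D (\<gamma> w)))"
      "\<And>w. w \<in> V \<Longrightarrow> bij (blinfun_apply (D (\<gamma> w)))"
    using inverse_function_theorem[OF open_UNIV _ continuous UNIV_I inverse, of cval] has_derivative_cval D by metis
  show ?thesis
  proof (rule that[OF chart(1,2) _ _ _ chart(6)[OF chart(4)]])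
    show "inj_on cval U" using chart(5) by (metis homeomorphism_def inj_on_inverseI)
    show base: "\<gamma> (cval base) = base" using chart(2,5) by (simp add: homeomorphism_def)
    show "\<forall>\<^sub>F w in nhds (cval base). cval (\<gamma> w) = w"
      using eventually_nhds_in_open[OF chart(3,4)]
      by eventually_elim (use chart(5) in \<open>simp add: homeomorphism_def\<close>)
    have "surj (cval_deriv base)" "\<gamma>' (cval base) = inv (cval_deriv base)"
      using chart(7,8)[OF chart(4)] by (simp_all add: base D bij_is_surj)
    then show "cval_deriv base (\<gamma>' (cval base) h) = h" for h by (simp add: surj_f_inv_f)
  qed
qed

definition chart_domain :: "real \<Rightarrow> (complex ^ 'p) set" where
  "chart_domain \<epsilon> = {u. (\<forall>i. dist (cpt u i) (c i) < \<epsilon>) \<and> (\<forall>n. dist (coeff (param_poly u) n) (coeff f n) < \<epsilon>)}"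

lemma inj_cpt_chart_domain: "separated \<epsilon> c \<Longrightarrow> u \<in> chart_domain \<epsilon> \<Longrightarrow> inj (cpt u)"
  using separated_close_imp_eq[of \<epsilon> c] by (metis (mono_tags, lifting) chart_domain_def injI mem_Collect_eq)

lemma stratum_eq:
  assumes "separated \<epsilon> c"
  shows "stratum \<epsilon> f c ms = param_poly ` chart_domain \<epsilon>"
proof
  show "stratum \<epsilon> f c ms \<subseteq> param_poly ` chart_domain \<epsilon>"
  proof
    fix g assume "g \<in> stratum \<epsilon> f c ms"
    then obtain c' where g: "g \<in> monic_centered (degree f)" "has_critical_points g c' ms"
        "\<And>n. dist (coeff g n) (coeff f n) < \<epsilon>" "\<And>i. dist (c' i) (c i) < \<epsilon>"
      unfolding stratum_def by blast
    obtain u where "cpt u = c'" "param_poly u = g" using param_poly_surj[OF g(1,2)] .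
    with g(3,4) show "g \<in> param_poly ` chart_domain \<epsilon>" unfolding chart_domain_def by blast
  qed
  show "param_poly ` chart_domain \<epsilon> \<subseteq> stratum \<epsilon> f c ms"
    using param_poly_critical_points[OF inj_cpt_chart_domain[OF assms]] param_poly_monic_centered
    unfolding stratum_def chart_domain_def by blast
qed

lemma crit_pt_param_poly:
  assumes "separated \<epsilon> c" "u \<in> chart_domain \<epsilon>"
  shows "crit_pt \<epsilon> c i (param_poly u) = cpt u i"
proof (rule crit_pt_eq[OF param_poly_critical_points[OF inj_cpt_chart_domain[OF assms]] _ assms(1)])
  show "degree (param_poly u) > 0" using deg_f by (simp add: degree_param_poly)
  show "dist (cpt u i) (c i) < \<epsilon>" for i using assms(2) by (simp add: chart_domain_def)
qed

lemma crit_vals_param_poly: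
  "separated \<epsilon> c \<Longrightarrow> u \<in> chart_domain \<epsilon> \<Longrightarrow> crit_vals \<epsilon> c (param_poly u) = cval u"
  by (simp add: crit_vals_def cval_def crit_pt_param_poly)

lemma base_in_chart_domain: "\<epsilon> > 0 \<Longrightarrow> base \<in> chart_domain \<epsilon>"
  by (simp add: chart_domain_def cpt_base param_poly_base)

lemma eventually_in_chart_domain:
  assumes "\<epsilon> > 0"
  shows "\<forall>\<^sub>F u in nhds base. u \<in> chart_domain \<epsilon>"
proof -
  have near: "\<forall>\<^sub>F u in nhds base. dist (F u) (F base) < \<epsilon>"
    if "(F has_derivative F') (at base)" for F :: "complex ^ 'p \<Rightarrow> complex" and F'
    using has_derivative_imp_tendsto_nhds[OF that] assms by (rule tendstoD)
  have "\<forall>\<^sub>F u in nhds base. \<forall>i. dist (cpt u i) (c i) < \<epsilon>"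
    using near[OF has_derivative_cpt] by (intro eventually_all_finite) (simp add: cpt_base)
  moreover have "\<forall>\<^sub>F u in nhds base. \<forall>n\<in>{..degree f}. dist (coeff (param_poly u) n) (coeff f n) < \<epsilon>"
    using near[OF has_poly_derivative_coeff[OF has_poly_derivative_param_poly]]
    by (intro eventually_ball_finite) (simp_all add: param_poly_base)
  ultimately show ?thesis
  proof eventually_elim
    case (elim u)
    have "dist (coeff (param_poly u) n) (coeff f n) < \<epsilon>" for n
      using elim(2) assms by (cases "n \<le> degree f") (auto simp: coeff_eq_0 degree_param_poly)
    then show ?case using elim(1) by (simp add: chart_domain_def)
  qed
qed

lemma eventually_chart_domain_subset:
  assumes "open U" "base \<in> U"
  shows "\<forall>\<^sub>F \<epsilon> in at_right 0. chart_domain \<epsilon> \<subseteq> U"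
proof -
  obtain r where r: "r > 0" "ball base r \<subseteq> U" using assms openE by blast
  have "chart_domain \<epsilon> \<subseteq> U" if \<epsilon>: "\<epsilon> \<in> {0<..<r / (2 * CARD('p))}" for \<epsilon>
  proof
    fix u assume u: "u \<in> chart_domain \<epsilon>"
    have "norm ((u - base) $ i) \<le> 2 * \<epsilon>" for i
    proof -
      have "(u - base) $ i = (cpt u i - c i) + (coeff (param_poly u) 0 - coeff f 0)"
        by (simp add: cpt_def base_def param_poly_def)
      also have "norm \<dots> \<le> dist (cpt u i) (c i) + dist (coeff (param_poly u) 0) (coeff f 0)"
        unfolding dist_norm by (rule norm_triangle_ineq)
      also have "\<dots> \<le> \<epsilon> + \<epsilon>" using u by (intro add_mono less_imp_le) (auto simp: chart_domain_def)
      finally show ?thesis by simp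
    qed
    then have "(\<Sum>i\<in>UNIV. norm ((u - base) $ i)) \<le> CARD('p) * (2 * \<epsilon>)" by (intro sum_bounded_above) auto
    moreover have "norm (u - base) \<le> (\<Sum>i\<in>UNIV. norm ((u - base) $ i))"
      unfolding norm_vec_def by (rule L2_set_le_sum) auto
    moreover have "CARD('p) * (2 * \<epsilon>) < r" using \<epsilon> by (simp add: field_simps)
    ultimately show "u \<in> U" using r(2) by (auto simp: dist_norm norm_minus_commute)
  qed
  moreover have "0 < r / (2 * CARD('p))" using r(1) by simp
  ultimately show ?thesis by (intro eventually_mono[OF eventually_at_right_real])
qed

end

locale stratum_chart = critical_polynomial f c ms
  for f :: "complex poly" and c :: "'p::finite \<Rightarrow> complex" and ms +
  fixes U :: "(complex ^ 'p) set" and \<gamma> B :: "complex ^ 'p \<Rightarrow> complex ^ 'p" and \<epsilon> :: real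
  assumes inj_on_cval: "inj_on cval U"
    and chart_base: "\<gamma> (cval base) = base"
    and cval_chart: "\<forall>\<^sub>F w in nhds (cval base). cval (\<gamma> w) = w"
    and chart_deriv: "(\<gamma> has_derivative B) (at (cval base))"
    and cval_deriv_chart_deriv: "\<And>h. cval_deriv base (B h) = h"
    and eps_pos: "\<epsilon> > 0" and separated: "separated \<epsilon> c" and chart_domain_subset: "chart_domain \<epsilon> \<subseteq> U"
begin

definition Q :: "'p \<Rightarrow> complex poly" where
  "Q k = tangent base (B (axis k 1))"

lemma poly_tangent_chart_deriv: "poly (tangent base (B h)) (c i) = h $ i"
  using cval_deriv_chart_deriv[of h] by (simp add: cval_deriv_def cpt_base vec_eq_iff)

lemma linear_power_dvd_Q: "[:- c i, 1:] ^ ms i dvd Q k - [:of_bool (i = k):]"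
proof -
  have "poly (Q k) (c i) = of_bool (i = k)" by (simp add: Q_def poly_tangent_chart_deriv axis_def)
  then show ?thesis using linear_power_dvd_tangent[of base i "B (axis k 1)"] by (simp add: Q_def cpt_base)
qed

lemma dual_basis_Q: "dual_basis f c ms Q"
  unfolding Q_def
  by (rule dual_basis.intro) (fact deg_f crit degree_tangent linear_power_dvd_Q[unfolded Q_def])+

lemma tangent_chart_deriv_axis: "tangent base (B (axis k t)) = smult t (Q k)"
proof (rule poly_eq_if_congruent_at_critical_points[OF crit])
  show "degree (tangent base (B (axis k t))) < degree f - 1" by (rule degree_tangent)
  show "degree (smult t (Q k)) < degree f - 1"
    unfolding Q_def by (rule le_less_trans[OF degree_smult_le degree_tangent])
  fix i
  have axis: "axis k t $ i = t * of_bool (i = k)" by (auto simp: axis_def)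
  have "[:- c i, 1:] ^ ms i dvd tangent base (B (axis k t)) - [:axis k t $ i:]"
    using linear_power_dvd_tangent[of base i "B (axis k t)"] by (simp add: poly_tangent_chart_deriv cpt_base)
  moreover have "[:- c i, 1:] ^ ms i dvd smult t (Q k - [:of_bool (i = k):])"
    by (rule dvd_smult[OF linear_power_dvd_Q])
  ultimately have "[:- c i, 1:] ^ ms i dvd
      (tangent base (B (axis k t)) - [:axis k t $ i:]) - smult t (Q k - [:of_bool (i = k):])"
    by (rule dvd_diff)
  then show "[:- c i, 1:] ^ ms i dvd tangent base (B (axis k t)) - smult t (Q k)"
    by (simp add: axis smult_diff_right)
qed

lemma eventually_inv_into_crit_vals:
  "\<forall>\<^sub>F w in nhds (cval base). \<gamma> w \<in> chart_domain \<epsilon>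
      \<and> inv_into (stratum \<epsilon> f c ms) (crit_vals \<epsilon> c) w = param_poly (\<gamma> w)"
proof -
  have "inj_on (crit_vals \<epsilon> c) (stratum \<epsilon> f c ms)"
    unfolding stratum_eq[OF separated]
    using inj_on_cval chart_domain_subset by (auto simp: inj_on_def crit_vals_param_poly[OF separated])
  then have inv: "inv_into (stratum \<epsilon> f c ms) (crit_vals \<epsilon> c) (cval u) = param_poly u"
    if "u \<in> chart_domain \<epsilon>" for u
    using that
    by (intro inv_into_f_eq) (auto simp: stratum_eq[OF separated] crit_vals_param_poly[OF separated])
  have "(\<gamma> \<longlongrightarrow> base) (nhds (cval base))"
    using has_derivative_imp_tendsto_nhds[OF chart_deriv] by (simp add: chart_base)
  then have "\<forall>\<^sub>F w in nhds (cval base). \<gamma> w \<in> chart_domain \<epsilon>"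
    using eventually_in_chart_domain[OF eps_pos] by (rule filterlim_iff[THEN iffD1, rule_format])
  with cval_chart show ?thesis
    by eventually_elim (metis inv)
qed

lemma coord_deriv_eq:
  assumes F: "\<And>u. u \<in> chart_domain \<epsilon> \<Longrightarrow> F (param_poly u) = G u"
    and G: "(G has_derivative G') (at base)" and G'_axis: "\<And>t. G' (B (axis k t)) = a * t"
  shows "coord_deriv (stratum \<epsilon> f c ms) (crit_vals \<epsilon> c) k F f = a"
proof -
  let ?curve = "\<lambda>t. cval base + axis k t"
  have f: "crit_vals \<epsilon> c f = cval base"
    using crit_vals_param_poly[OF separated base_in_chart_domain[OF eps_pos]] by (simp add: param_poly_base)
  have axis_0: "axis k (0 :: complex) = 0" by (simp add: axis_def vec_eq_iff)
  have "linear (axis k :: complex \<Rightarrow> complex ^ 'p)" by (rule linearI) (auto simp: axis_def vec_eq_iff)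
  then have "(axis k has_derivative axis k) (at (0 :: complex))"
    by (simp add: bounded_linear_imp_has_derivative linear_conv_bounded_linear)
  then have curve: "(?curve has_derivative axis k) (at 0)" by (auto intro!: derivative_eq_intros)
  then have "(?curve \<longlongrightarrow> cval base) (nhds 0)"
    using has_derivative_imp_tendsto_nhds[OF curve] by (simp add: axis_0)
  then have "\<forall>\<^sub>F t in nhds 0. \<gamma> (?curve t) \<in> chart_domain \<epsilon> \<and>
      inv_into (stratum \<epsilon> f c ms) (crit_vals \<epsilon> c) (?curve t) = param_poly (\<gamma> (?curve t))"
    using eventually_inv_into_crit_vals by (rule filterlim_iff[THEN iffD1, rule_format])
  then have "\<forall>\<^sub>F t in nhds 0. F (inv_into (stratum \<epsilon> f c ms) (crit_vals \<epsilon> c) (?curve t)) = G (\<gamma> (?curve t))"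
    by eventually_elim (simp add: F)
  then have "coord_deriv (stratum \<epsilon> f c ms) (crit_vals \<epsilon> c) k F f = deriv (\<lambda>t. G (\<gamma> (?curve t))) 0"
    unfolding coord_deriv_def f by (rule deriv_cong_ev) simp
  also have "\<dots> = a"
  proof (rule DERIV_imp_deriv)
    have "((\<lambda>t. \<gamma> (?curve t)) has_derivative (\<lambda>t. B (axis k t))) (at 0)"
      by (rule has_derivative_compose[OF curve]) (simp add: axis_0 chart_deriv)
    then have "((\<lambda>t. G (\<gamma> (?curve t))) has_derivative (\<lambda>t. G' (B (axis k t)))) (at 0)"
      by (rule has_derivative_compose) (simp add: axis_0 chart_base G)
    then show "((\<lambda>t. G (\<gamma> (?curve t))) has_field_derivative a) (at 0)"
      by (simp only: G'_axis has_field_derivative_def)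
  qed
  finally show ?thesis .
qed

lemma coord_deriv_orbit:
  "orbit_coord_deriv \<epsilon> f c ms j k (Suc m) = orbit_variation f (Q k) (of_bool (j = k)) (poly f (c j)) m"
proof (rule coord_deriv_eq[OF _ has_derivative_orbit])
  show "(poly (param_poly u) ^^ Suc m) (crit_pt \<epsilon> c j (param_poly u))
      = (poly (param_poly u) ^^ Suc m) (cpt u j)"
    if "u \<in> chart_domain \<epsilon>" for u
    using crit_pt_param_poly[OF separated that] by simp
  fix t :: complex
  have "axis k t $ j = t * of_bool (j = k)" by (auto simp: axis_def)
  then show "orbit_variation f (tangent base (B (axis k t))) (cval_deriv base (B (axis k t)) $ j) (poly f (c j)) m
      = orbit_variation f (Q k) (of_bool (j = k)) (poly f (c j)) m * t"
    by (simp only: tangent_chart_deriv_axis cval_deriv_chart_deriv orbit_variation_smult mult.commute)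
qed

end

theorem (in critical_polynomial) eventually_coord_deriv_orbit:
  "\<forall>\<^sub>F \<epsilon> in at_right 0. \<exists>Q. dual_basis f c ms Q \<and> (\<forall>j k m.
     orbit_coord_deriv \<epsilon> f c ms j k (Suc m)
     = orbit_variation f (Q k) (of_bool (j = k)) (poly f (c j)) m)"
proof -
  obtain U \<gamma> B where chart: "open U" "base \<in> U" "inj_on cval U" "\<gamma> (cval base) = base"
      "\<forall>\<^sub>F w in nhds (cval base). cval (\<gamma> w) = w" "(\<gamma> has_derivative B) (at (cval base))"
      "\<And>h. cval_deriv base (B h) = h"
    by (rule critical_value_chart) blast
  have "inj c" using crit by (simp add: has_critical_points_def)
  from eventually_at_right_less[of 0] eventually_separated[OF this] eventually_chart_domain_subset[OF chart(1,2)]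
  show ?thesis
  proof eventually_elim
    case (elim \<epsilon>)
    interpret stratum_chart f c ms U \<gamma> B \<epsilon> by unfold_locales (fact chart elim)+
    show ?case using dual_basis_Q coord_deriv_orbit by blast
  qed
qed

section \<open>The limit matrix\<close>

lemma (in dual_basis) orbit_variation_div_multiplier:
  assumes "\<And>n. multiplier j n \<noteq> 0"
  shows "orbit_variation f q \<delta> (poly f (c j)) m / multiplier j m
    = \<delta> + (\<Sum>n<m. poly q (orbit j n) / multiplier j (Suc n))"
proof (induction m)
  case 0
  show ?case by (simp add: multiplier_0)
next
  case (Suc m)
  have "poly (pderiv f) (orbit j m) \<noteq> 0" using assms[of "Suc m"] by (simp add: multiplier_Suc)
  then have "orbit_variation f q \<delta> (poly f (c j)) (Suc m) / multiplier j (Suc m)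
      = orbit_variation f q \<delta> (poly f (c j)) m / multiplier j m + poly q (orbit j m) / multiplier j (Suc m)"
    by (simp add: multiplier_Suc orbit_def add_divide_distrib)
  then show ?case by (simp add: Suc)
qed

lemma (in dual_basis) L_quot_tendsto:
  assumes expanding: "weakly_expanding f (c j)"
    and coord_deriv: "\<And>m. orbit_coord_deriv \<epsilon> f c ms j k (Suc m)
      = orbit_variation f (Q k) (of_bool (j = k)) (poly f (c j)) m"
  shows "L_quot \<epsilon> f c ms j k \<longlonglongrightarrow> limit_matrix j k"
proof -
  let ?a = "\<lambda>n. poly (Q k) (orbit j n) / multiplier j (Suc n)"
  have "multiplier j n \<noteq> 0" for n
    using weakly_expanding_deriv_nonzero[OF expanding] by (simp add: multiplier_def)
  then have quot: "L_quot \<epsilon> f c ms j k (Suc m) = of_bool (j = k) + (\<Sum>n<m. ?a n)" for m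
    using orbit_variation_div_multiplier
    by (simp add: L_quot_def coord_deriv multiplier_def del: funpow.simps)
  obtain R where "escape_radius f R" using escape_radius_exists[OF deg_f] by blast
  then have "summable (\<lambda>n. norm (?a n))"
    unfolding orbit_def multiplier_def
    by (rule escape_radius.weakly_expanding_series_summable[OF _ expanding])
  then have "summable ?a" by (rule summable_norm_cancel)
  then have "(\<lambda>m. of_bool (j = k) + (\<Sum>n<m. ?a n)) \<longlonglongrightarrow> limit_matrix j k"
    unfolding limit_matrix_def by (intro tendsto_add tendsto_const summable_LIMSEQ)
  then show ?thesis unfolding quot[symmetric] by (rule filterlim_sequentially_Suc[THEN iffD1])
qed

lemma rank_eq_card_rows:
  fixes A :: "'a::field ^ 'n::finite ^ 'm::finite"
  assumes indep: "\<And>b j. (\<And>k. (\<Sum>i\<in>UNIV. b i * A $ i $ k) = 0) \<Longrightarrow> b j = 0"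
  shows "rank A = CARD('m)"
proof -
  have combination: "b j = 0" if "(\<Sum>i\<in>UNIV. b i *s row i A) = 0" for b j
    by (rule indep[of b]) (use that in \<open>simp add: vec_eq_iff row_def\<close>)
  have inj: "inj (\<lambda>j. row j A)"
  proof (rule injI, rule ccontr)
    fix i j assume eq: "row i A = row j A" and "i \<noteq> j"
    define b where "b l = of_bool (l = i) - (of_bool (l = j) :: 'a)" for l
    have "(\<Sum>l\<in>UNIV. b l *s row l A) = (\<Sum>l\<in>{i, j}. b l *s row l A)"
      by (rule sum.mono_neutral_right) (auto simp: b_def)
    also have "\<dots> = 0" using \<open>i \<noteq> j\<close> eq by (simp add: b_def)
    finally have "b i = 0" by (rule combination[of b])
    then show False using \<open>i \<noteq> j\<close> by (simp add: b_def)
  qed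
  have rows: "rows A = range (\<lambda>j. row j A)" by (auto simp: rows_def)
  have "vec.independent (rows A)"
  proof (rule vec.independent_if_scalars_zero)
    show "finite (rows A)" unfolding rows by simp
    fix g x assume g: "(\<Sum>x\<in>rows A. g x *s x) = 0" and x: "x \<in> rows A"
    have "(\<Sum>j\<in>UNIV. g (row j A) *s row j A) = 0"
      using g unfolding rows by (subst (asm) sum.reindex[OF inj]) (simp add: o_def)
    then have "g (row j A) = 0" for j by (rule combination[of "\<lambda>j. g (row j A)"])
    then show "g x = 0" using x by (auto simp: rows)
  qed
  then have "vec.dim (rows A) = card (rows A)" by (rule vec.dim_eq_card_independent)
  also have "\<dots> = CARD('m)" unfolding rows using inj by (simp add: card_image)
  finally show ?thesis by (simp add: row_rank_def_gen)
qed

lemma (in dual_basis) rank_limit_matrix: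
  fixes s :: "'r::finite \<Rightarrow> 'p"
  assumes s: "inj s" and expanding: "\<And>j. weakly_expanding f (c (s j))"
  shows "rank ((\<chi> j k. limit_matrix (s j) k) :: complex ^ 'p ^ 'r) = CARD('r)"
proof (rule rank_eq_card_rows)
  fix b :: "'r \<Rightarrow> complex" and j
  assume b: "\<And>k. (\<Sum>i\<in>UNIV. b i * (\<chi> j k. limit_matrix (s j) k) $ i $ k) = 0"
  define b' where "b' i = (if i \<in> range s then b (inv s i) else 0)" for i
  have b'_s: "b' (s j) = b j" for j using s by (simp add: b'_def)
  have b'_vanishing: "(\<Sum>i\<in>UNIV. b' i * limit_matrix i k) = 0" for k
  proof -
    have "(\<Sum>i\<in>UNIV. b' i * limit_matrix i k) = (\<Sum>i\<in>range s. b' i * limit_matrix i k)"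
      by (rule sum.mono_neutral_right) (auto simp: b'_def)
    also have "\<dots> = (\<Sum>j\<in>UNIV. b j * limit_matrix (s j) k)" using s by (simp add: sum.reindex b'_s)
    also have "\<dots> = 0" using b[of k] by simp
    finally show ?thesis .
  qed
  have "b' (s j) = 0"
  proof (rule limit_matrix_rows_independent[OF _ b'_vanishing])
    show "weakly_expanding f (c i)" if "b' i \<noteq> 0" for i
      using that expanding by (auto simp: b'_def split: if_splits)
  qed
  then show "b j = 0" by (simp add: b'_s)
qed

theorem theorem2:
  fixes d :: nat
    and f :: "complex poly"
    and c :: "'p::finite \<Rightarrow> complex"
    and ms :: "'p \<Rightarrow> nat"
  assumes "d \<ge> 2"
    and "f \<in> monic_centered d"
    and "has_critical_points f c ms"
  shows "\<forall>\<^sub>F \<epsilon> in at_right 0.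
    (\<forall>j. weakly_expanding f (c j) \<longrightarrow> (\<forall>k. convergent (L_quot \<epsilon> f c ms j k))) \<and>
    (\<forall>s :: 'r::finite \<Rightarrow> 'p.
       inj s \<and> (\<forall>j. weakly_expanding f (c (s j))) \<longrightarrow>
       rank ((\<chi> j k. L_lim \<epsilon> f c ms (s j) k) :: complex ^ 'p ^ 'r) = CARD('r))"
proof -
  have "degree f = d" using assms(2) by (simp add: monic_centered_def)
  then interpret critical_polynomial f c ms using assms by unfold_locales auto
  from eventually_coord_deriv_orbit show ?thesis
  proof eventually_elim
    case (elim \<epsilon>)
    then obtain Q where "dual_basis f c ms Q" and
      coord_deriv: "\<And>j k m. orbit_coord_deriv \<epsilon> f c ms j k (Suc m)
        = orbit_variation f (Q k) (of_bool (j = k)) (poly f (c j)) m"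
      by blast
    then interpret dual_basis f c ms Q by simp
    have limit: "L_quot \<epsilon> f c ms j k \<longlonglongrightarrow> limit_matrix j k" if "weakly_expanding f (c j)" for j k
      by (rule L_quot_tendsto[OF that coord_deriv])
    then have L_lim: "L_lim \<epsilon> f c ms j k = limit_matrix j k" if "weakly_expanding f (c j)" for j k
      unfolding L_lim_def using that by (intro limI)
    show ?case
    proof (intro conjI allI impI)
      show "convergent (L_quot \<epsilon> f c ms j k)" if "weakly_expanding f (c j)" for j k
        using limit[OF that] by (rule convergentI)
      show "rank ((\<chi> j k. L_lim \<epsilon> f c ms (s j) k) :: complex ^ 'p ^ 'r) = CARD('r)"
        if "inj s \<and> (\<forall>j. weakly_expanding f (c (s j)))" for s :: "'r \<Rightarrow> 'p"
        using that rank_limit_matrix[of s] by (simp add: L_lim)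
    qed
  qed
qed

end
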